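(* Let $(M,F,dV)$ be an AR-Finsler manifold, with $g_{ij}=\eta\,a_{ij}$, equipped with an arbitrary volume form $dV=\sigma(x)\,dx^1\wedge\dots\wedge dx^n$. Then the $S$-curvature is given by $$\begin{aligned}S={}&\tfrac12\left(n\,y^{l}-\tfrac12 y^{r}y^{s}\{a^{ml}\,\dot{\partial}_{m}a_{rs}+a_{rs}\,\dot{\partial}_{m}a^{ml}\}\right)\partial_{l}\log(\eta)\\&+\tfrac12\left(y^{m}y^{l}-\tfrac12 y^{r}y^{s}a_{rs}a^{ml}\right)\dot{\partial}_{m}\partial_{l}\log(\eta)+\tfrac12 y^{k}a^{ml}\left(\partial_{m}a_{lk}+\partial_{k}a_{lm}-\tfrac14\partial_{l}a_{mk}\right)\\&+\tfrac12 y^{k}y^{s}\left[\dot{\partial}_{m}a^{ml}\left(\partial_{k}a_{ls}-\tfrac12\partial_{l}a_{ks}\right)+a^{ml}\left(\dot{\partial}_{m}\partial_{k}a_{ls}-\tfrac12\dot{\partial}_{m}\partial_{l}a_{ks}\right)\right]-y^{m}\partial_{m}\log(\sigma(x)).\end{aligned}$$ Thus, the $S$-curvature is a rational function in $y$ if and only if the functions $\partial_i\log(\eta(x,y))$ are rational in $y$. Consequently, the $E$-curvature is rational in $y$ if and only if the functions $\partial_i\log(\eta(x,y))$ are rational in $y$.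
   Context: $M$ is a smooth $n$-dimensional manifold with local coordinates $(x^i)$ and induced fibre coordinates $(y^i)$ on $TM$; $\partial_i=\partial/\partial x^i$, $\dot{\partial}_i=\partial/\partial y^i$; the summation convention is used. A Finsler metric on $M$ is a map $F:TM\to[0,\infty)$ which is $C^\infty$ on $TM\setminus\{0\}$, positively homogeneous of degree one in $y$, and such that $g_{ij}(x,y):=\frac12\dot{\partial}_i\dot{\partial}_jF^2$ is positive definite at each point of $TM\setminus\{0\}$; $(g^{ij})$ is the inverse matrix. "Rational in $y$" means: a quotient of two polynomials in the fibre coordinates $y$ whose coefficients are (smooth) functions of $x$. $F$ is an AR-Finsler (Almost Rational Finsler) metric, and $(M,F)$ an AR-Finsler manifold, if $g_{ij}(x,y)=\eta(x,y)\,a_{ij}(x,y)$ where (a) $\eta:TM\setminus\{0\}\to[0,\infty)$ is smooth; (b) $(a_{ij}(x,y))$ is a symmetric positive definite matrix with each $a_{ij}$ rational in $y$; (c) each product $\eta\,a_{ij}$ is positively homogeneous of degree zero in $y$. $(a^{ij})$ is the inverse matrix of $(a_{ij})$. Spray coefficients: $G^i=\frac14 g^{ir}\left(y^k\dot{\partial}_r\partial_kF^2-\partial_rF^2\right)$; Barthel connection: $N^i_j=\dot{\partial}_jG^i$. For a volume form $dV=\sigma(x)\,dx^1\wedge\dots\wedge dx^n$, the $S$-curvature has the local expression $S(x,y)=N^m_m(x,y)-y^m\partial_m\log(\sigma(x))$, and the $E$-curvature is $E_{ij}=\frac12\dot{\partial}_i\dot{\partial}_jS$.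
   Formalization: The coefficient 1/4 of ∂_l a_mk in the S-curvature formula is corrected to 1 (the printed formula fails for n=1, η=1, a=g(x)), and the E-curvature equivalence is stated for n ≥ 2 only, since for n=1 E vanishes identically and the equivalence can fail. *)

theory Defs
  imports "HOL-Analysis.Analysis"
begin

subsection \<open>Smooth maps\<close>

fun k_times_differentiable_on ::
    "nat \<Rightarrow> 'a::real_normed_vector set \<Rightarrow> ('a \<Rightarrow> 'b::real_normed_vector) \<Rightarrow> bool" where
  "k_times_differentiable_on 0 S f \<longleftrightarrow> continuous_on S f"
| "k_times_differentiable_on (Suc k) S f \<longleftrightarrow>
     (\<forall>x\<in>S. f differentiable (at x)) \<and>
     (\<forall>v. k_times_differentiable_on k S (\<lambda>x. frechet_derivative f (at x) v))"

text \<open>\<open>C\<^sup>\<infinity>\<close> on \<open>S\<close>; only used for open sets \<open>S\<close>.\<close>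

definition smooth_on ::
    "'a::real_normed_vector set \<Rightarrow> ('a \<Rightarrow> 'b::real_normed_vector) \<Rightarrow> bool" where
  "smooth_on S f \<longleftrightarrow> (\<forall>k. k_times_differentiable_on k S f)"


subsection \<open>Manifolds and the tangent bundle\<close>

text \<open>A chart is a pair of its domain and its coordinate map; the values of the map outside the
  domain are irrelevant. The manifold described by an atlas is the union of the chart domains, with
  the subspace topology of the (Hausdorff, second countable) ambient type. Maximality is not
  required, so a statement about all atlases applies in particular to the maximal ones.\<close>

type_synonym ('m, 'n) chart = "'m set \<times> ('m \<Rightarrow> real ^ 'n)"

definition coord_range :: "('m, 'n::finite) chart \<Rightarrow> (real ^ 'n) set" where
  "coord_range c = snd c ` fst c"

definition point_of :: "('m, 'n::finite) chart \<Rightarrow> real ^ 'n \<Rightarrow> 'm" where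
  "point_of c = inv_into (fst c) (snd c)"

definition transition :: "('m, 'n::finite) chart \<Rightarrow> ('m, 'n) chart \<Rightarrow> real ^ 'n \<Rightarrow> real ^ 'n" where
  "transition c d = (\<lambda>x. snd d (point_of c x))"

definition smooth_atlas ::
    "('m::{t2_space, second_countable_topology}, 'n::finite) chart set \<Rightarrow> bool" where
  "smooth_atlas A \<longleftrightarrow>
     (\<forall>c\<in>A. open (fst c) \<and> open (coord_range c) \<and>
            homeomorphism (fst c) (coord_range c) (snd c) (point_of c)) \<and>
     (\<forall>c\<in>A. \<forall>d\<in>A. smooth_on (snd c ` (fst c \<inter> fst d)) (transition c d))"

text \<open>A tangent vector at \<open>p\<close> is the family of its coordinate columns, one for every chart
  around \<open>p\<close> (and zero for all other indices), related by the Jacobians of the coordinate changes.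
  The linear structure of a tangent space is therefore the pointwise one.\<close>

type_synonym ('m, 'n) tangent = "('m, 'n) chart \<Rightarrow> real ^ 'n"

definition tangent_space :: "('m, 'n::finite) chart set \<Rightarrow> 'm \<Rightarrow> ('m, 'n) tangent set" where
  "tangent_space A p =
     {v. (\<forall>c. \<not> (c \<in> A \<and> p \<in> fst c) \<longrightarrow> v c = 0) \<and>
         (\<forall>c\<in>A. \<forall>d\<in>A. p \<in> fst c \<and> p \<in> fst d \<longrightarrow>
            v d = frechet_derivative (transition c d) (at (snd c p)) (v c))}"

definition tangent_bundle :: "('m, 'n::finite) chart set \<Rightarrow> ('m \<times> ('m, 'n) tangent) set" where
  "tangent_bundle A = {(p, v). p \<in> \<Union> (fst ` A) \<and> v \<in> tangent_space A p}"

text \<open>The inverse of the induced chart \<open>(x, y)\<close> on the tangent bundle.\<close>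

definition tangent_point ::
    "('m, 'n::finite) chart set \<Rightarrow> ('m, 'n) chart \<Rightarrow> real ^ 'n \<Rightarrow> real ^ 'n \<Rightarrow> 'm \<times> ('m, 'n) tangent" where
  "tangent_point A c x y =
     (point_of c x,
      \<lambda>d. if d \<in> A \<and> point_of c x \<in> fst d
          then frechet_derivative (transition c d) (at x) y else 0)"

definition in_coords ::
    "('m, 'n::finite) chart set \<Rightarrow> ('m, 'n) chart \<Rightarrow> ('m \<times> ('m, 'n) tangent \<Rightarrow> real) \<Rightarrow>
     real ^ 'n \<Rightarrow> real ^ 'n \<Rightarrow> real" where
  "in_coords A c h = (\<lambda>x y. h (tangent_point A c x y))"

definition smooth_on_slit_bundle ::
    "('m, 'n::finite) chart set \<Rightarrow> ('m \<times> ('m, 'n) tangent \<Rightarrow> real) \<Rightarrow> bool" where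
  "smooth_on_slit_bundle A h \<longleftrightarrow>
     (\<forall>c\<in>A. smooth_on (coord_range c \<times> (- {0})) (\<lambda>(x, y). in_coords A c h x y))"


subsection \<open>Coordinate expressions\<close>

text \<open>Functions on (part of) the tangent bundle in induced coordinates are written curried,
  \<open>f x y\<close>; \<open>Dx i\<close> is \<open>\<partial>\<^sub>i\<close> and \<open>Dy i\<close> is the dotted \<open>\<partial>\<^sub>i\<close>.\<close>

definition pderiv_at :: "'n::finite \<Rightarrow> (real ^ 'n \<Rightarrow> real) \<Rightarrow> real ^ 'n \<Rightarrow> real" where
  "pderiv_at i f x = deriv (\<lambda>t. f (x + t *\<^sub>R axis i 1)) 0"

definition Dx :: "'n::finite \<Rightarrow> (real ^ 'n \<Rightarrow> real ^ 'n \<Rightarrow> real) \<Rightarrow> real ^ 'n \<Rightarrow> real ^ 'n \<Rightarrow> real" where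
  "Dx i f x y = pderiv_at i (\<lambda>x'. f x' y) x"

definition Dy :: "'n::finite \<Rightarrow> (real ^ 'n \<Rightarrow> real ^ 'n \<Rightarrow> real) \<Rightarrow> real ^ 'n \<Rightarrow> real ^ 'n \<Rightarrow> real" where
  "Dy i f x y = pderiv_at i (\<lambda>y'. f x y') y"

definition sym_posdef :: "real ^ 'n::finite ^ 'n \<Rightarrow> bool" where
  "sym_posdef M \<longleftrightarrow> transpose M = M \<and> (\<forall>v. v \<noteq> 0 \<longrightarrow> v \<bullet> (M *v v) > 0)"

definition metric_tensor ::
    "(real ^ 'n::finite \<Rightarrow> real ^ 'n \<Rightarrow> real) \<Rightarrow> real ^ 'n \<Rightarrow> real ^ 'n \<Rightarrow> real ^ 'n ^ 'n" where
  "metric_tensor F x y = (\<chi> i j. 1/2 * Dy i (Dy j (\<lambda>x y. (F x y)\<^sup>2)) x y)"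

definition spray_coeff ::
    "(real ^ 'n::finite \<Rightarrow> real ^ 'n \<Rightarrow> real) \<Rightarrow> 'n \<Rightarrow> real ^ 'n \<Rightarrow> real ^ 'n \<Rightarrow> real" where
  "spray_coeff F i x y =
     1/4 * (\<Sum>r\<in>UNIV. matrix_inv (metric_tensor F x y) $ i $ r *
       ((\<Sum>k\<in>UNIV. y $ k * Dy r (Dx k (\<lambda>x y. (F x y)\<^sup>2)) x y) - Dx r (\<lambda>x y. (F x y)\<^sup>2) x y))"

definition barthel ::
    "(real ^ 'n::finite \<Rightarrow> real ^ 'n \<Rightarrow> real) \<Rightarrow> 'n \<Rightarrow> 'n \<Rightarrow> real ^ 'n \<Rightarrow> real ^ 'n \<Rightarrow> real" where
  "barthel F i j = Dy j (spray_coeff F i)"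

definition S_curvature ::
    "(real ^ 'n::finite \<Rightarrow> real ^ 'n \<Rightarrow> real) \<Rightarrow> (real ^ 'n \<Rightarrow> real) \<Rightarrow>
     real ^ 'n \<Rightarrow> real ^ 'n \<Rightarrow> real" where
  "S_curvature F \<sigma> x y =
     (\<Sum>m\<in>UNIV. barthel F m m x y) - (\<Sum>m\<in>UNIV. y $ m * pderiv_at m (\<lambda>x. ln (\<sigma> x)) x)"

definition E_curvature ::
    "(real ^ 'n::finite \<Rightarrow> real ^ 'n \<Rightarrow> real) \<Rightarrow> (real ^ 'n \<Rightarrow> real) \<Rightarrow> 'n \<Rightarrow> 'n \<Rightarrow>
     real ^ 'n \<Rightarrow> real ^ 'n \<Rightarrow> real" where
  "E_curvature F \<sigma> i j x y = 1/2 * Dy i (Dy j (S_curvature F \<sigma>)) x y"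


subsection \<open>Rationality in the fibre coordinates\<close>

text \<open>In \<open>polynomial_in_y\<close>, \<open>I\<close> is a finite set of exponent multi-indices.\<close>

definition polynomial_in_y ::
    "(real ^ 'n::finite) set \<Rightarrow> (real ^ 'n \<Rightarrow> real ^ 'n \<Rightarrow> real) \<Rightarrow> bool" where
  "polynomial_in_y U p \<longleftrightarrow>
     (\<exists>(I :: ('n \<Rightarrow> nat) set) C. finite I \<and> (\<forall>\<alpha>\<in>I. smooth_on U (C \<alpha>)) \<and>
        (\<forall>x\<in>U. \<forall>y. p x y = (\<Sum>\<alpha>\<in>I. C \<alpha> x * (\<Prod>i\<in>UNIV. (y $ i) ^ \<alpha> i))))"

text \<open>The functions concerned live on the whole slit tangent bundle, so the denominator of a
  quotient representing one of them must not vanish at any \<open>y \<noteq> 0\<close>.\<close>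

definition rational_in_y ::
    "(real ^ 'n::finite) set \<Rightarrow> (real ^ 'n \<Rightarrow> real ^ 'n \<Rightarrow> real) \<Rightarrow> bool" where
  "rational_in_y U f \<longleftrightarrow>
     (\<exists>P Q. polynomial_in_y U P \<and> polynomial_in_y U Q \<and>
        (\<forall>x\<in>U. \<forall>y. y \<noteq> 0 \<longrightarrow> Q x y \<noteq> 0 \<and> f x y = P x y / Q x y))"


subsection \<open>Finsler and almost rational Finsler metrics, volume forms\<close>

definition finsler_metric ::
    "('m::{t2_space, second_countable_topology}, 'n::finite) chart set \<Rightarrow>
     ('m \<times> ('m, 'n) tangent \<Rightarrow> real) \<Rightarrow> bool" where
  "finsler_metric A F \<longleftrightarrow>
     smooth_atlas A \<and>
     (\<forall>w\<in>tangent_bundle A. F w \<ge> 0) \<and>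
     smooth_on_slit_bundle A F \<and>
     (\<forall>(p, v)\<in>tangent_bundle A. \<forall>t>0. F (p, \<lambda>c. t *\<^sub>R v c) = t * F (p, v)) \<and>
     (\<forall>c\<in>A. \<forall>x\<in>coord_range c. \<forall>y. y \<noteq> 0 \<longrightarrow> sym_posdef (metric_tensor (in_coords A c F) x y))"

text \<open>The matrix \<open>(a\<^sub>i\<^sub>j)\<close> is given separately in every chart. No transformation rule has to be
  imposed: it follows from \<open>g = \<eta> a\<close>, since \<open>\<eta>\<close> cannot vanish.\<close>

definition AR_finsler ::
    "('m::{t2_space, second_countable_topology}, 'n::finite) chart set \<Rightarrow>
     ('m \<times> ('m, 'n) tangent \<Rightarrow> real) \<Rightarrow> ('m \<times> ('m, 'n) tangent \<Rightarrow> real) \<Rightarrow>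
     (('m, 'n) chart \<Rightarrow> real ^ 'n \<Rightarrow> real ^ 'n \<Rightarrow> real ^ 'n ^ 'n) \<Rightarrow> bool" where
  "AR_finsler A F \<eta> a \<longleftrightarrow>
     finsler_metric A F \<and>
     (\<forall>(p, v)\<in>tangent_bundle A. v \<noteq> (\<lambda>_. 0) \<longrightarrow> \<eta> (p, v) \<ge> 0) \<and>
     smooth_on_slit_bundle A \<eta> \<and>
     (\<forall>c\<in>A. \<forall>x\<in>coord_range c. \<forall>y. y \<noteq> 0 \<longrightarrow>
        metric_tensor (in_coords A c F) x y = in_coords A c \<eta> x y *\<^sub>R a c x y \<and>
        sym_posdef (a c x y) \<and>
        (\<forall>t>0. \<forall>i j. in_coords A c \<eta> x (t *\<^sub>R y) * a c x (t *\<^sub>R y) $ i $ j =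
                     in_coords A c \<eta> x y * a c x y $ i $ j)) \<and>
     (\<forall>c\<in>A. \<forall>i j. rational_in_y (coord_range c) (\<lambda>x y. a c x y $ i $ j))"

text \<open>A volume form is given by its positive densities \<open>\<sigma>\<close> in the charts. The absolute value of
  the Jacobian makes the notion independent of orientations; in an oriented atlas it is redundant
  and \<open>\<sigma> dx\<^sup>1 \<and> \<dots> \<and> dx\<^sup>n\<close> is a positive \<open>n\<close>-form in the usual sense.\<close>

definition volume_form ::
    "('m, 'n::finite) chart set \<Rightarrow> (('m, 'n) chart \<Rightarrow> real ^ 'n \<Rightarrow> real) \<Rightarrow> bool" where
  "volume_form A \<sigma> \<longleftrightarrow>
     (\<forall>c\<in>A. smooth_on (coord_range c) (\<sigma> c) \<and> (\<forall>x\<in>coord_range c. \<sigma> c x > 0)) \<and>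
     (\<forall>c\<in>A. \<forall>d\<in>A. \<forall>p\<in>fst c \<inter> fst d.
        \<sigma> c (snd c p) =
        \<sigma> d (snd d p) * \<bar>det (matrix (frechet_derivative (transition c d) (at (snd c p))))\<bar>)"

end

theory Submission
  imports Defs "HOL-Computational_Algebra.Polynomial_Factorial" "HOL-Computational_Algebra.Field_as_Ring"
begin

text \<open>
  Write \<open>L = ln \<eta>\<close>, \<open>D = ln det g\<close> and \<open>Q = a\<^sub>r\<^sub>s y\<^sup>r y\<^sup>s\<close>, so that \<open>F\<^sup>2 = \<eta> Q\<close>. Euler's relation gives
  \<open>Q \<partial>L/\<partial>y\<^sup>m = - y\<^sup>r y\<^sup>s \<partial>a\<^sub>r\<^sub>s/\<partial>y\<^sup>m\<close>, hence all fibre derivatives of \<open>L\<close>, and of the functions \<open>\<partial>\<^sub>l L\<close>, are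
  rational, and modulo rational functions \<open>S\<close> is \<open>c\<^sup>l \<partial>\<^sub>l L / 2\<close> with
  \<open>c\<^sup>l = n y\<^sup>l + F\<^sup>2 g\<^sup>l\<^sup>j (\<partial>D/\<partial>y\<^sup>j) / 2\<close>. If \<open>S\<close> is rational, differentiating this contraction along
  the fibre yields many linear equations for the \<open>\<partial>\<^sub>l L\<close> with rational coefficients. They determine
  the \<open>\<partial>\<^sub>l L\<close> at every point, because no combination \<open>h\<^sub>l c\<^sup>l\<close> with constant \<open>h \<noteq> 0\<close> vanishes
  identically: it equals \<open>\<lambda> n F\<^sup>2\<close> where \<open>h\<close> is \<open>\<lambda>\<close> times the Legendre transform of \<open>y\<close>.

  For \<open>E\<close> the same argument needs that no \<open>h\<^sub>l c\<^sup>l\<close> is affine in \<open>y\<close>. This may fail where \<open>D\<close> is constant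
  on the fibre, but only there: if \<open>F\<^sup>2 h\<^sub>l g\<^sup>l\<^sup>j \<partial>D/\<partial>y\<^sup>j = 2 w \<bullet> y\<close>, a maximum of \<open>D\<close> on the Legendre
  preimage of the span of \<open>h\<close> and \<open>w\<close> leads to a contradiction with strict convexity. In the interior
  of the remaining set of base points \<open>\<partial>\<^sub>l D\<close> depends on \<open>x\<close> only. So \<open>\<partial>\<^sub>l D\<close> is rational in \<open>y\<close> over a
  dense set of base points; since its fibre derivatives have a denominator without zeros, multiplying
  \<open>\<partial>\<^sub>l D\<close> by it gives polynomials of bounded degree, a condition that passes to limits.
\<close>

subsection \<open>Smooth functions\<close>

text \<open>Rationality is asked for over the whole coordinate domain, with coefficients that are
  only smooth in x and a denominator without zeros at y \<noteq> 0. So there is no field of rational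
  functions to eliminate over: a pivot could vanish somewhere. Instead all derived equations enter
  one Gram matrix. Its determinant has no zero over a base point where no constant h \<noteq> 0
  annihilates the original coefficients along the whole fibre, and finitely many derivatives
  suffice, because a polynomial that vanishes to an order above its degree at one direction is zero.
  For \<open>E\<close> the obstacle is a base point where D is constant along the fibre: there c^l =
  n y^l, and the second fibre derivatives of c^l, the only coefficients that E sees, vanish. At the
  boundary of this set the determinant degenerates and no quotient formula extends across. The
  degree bound that survives comes from one variable: differentiation raises the order of every
  pole, so the poles along a line are controlled by those of the derivative. Interpolation at fixed
  nodes then gives coefficients that are smooth in x.\<close>

lemma frechet_derivative_worksI:
  "f differentiable at x \<Longrightarrow> (f has_derivative frechet_derivative f (at x)) (at x)"
  using frechet_derivative_works by blast

lemma frechet_derivative_eq: "(f has_derivative f') (at x) \<Longrightarrow> frechet_derivative f (at x) = f'"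
  by (rule frechet_derivative_at[symmetric])

lemma k_times_differentiable_on_Suc_imp:
  "k_times_differentiable_on (Suc k) S f \<Longrightarrow> k_times_differentiable_on k S f"
proof (induction k arbitrary: f)
  case 0
  then show ?case
    by (metis continuous_at_imp_continuous_on differentiable_imp_continuous_within
        k_times_differentiable_on.simps)
next
  case (Suc k)
  then show ?case by (metis k_times_differentiable_on.simps(2))
qed

lemma k_times_differentiable_on_cong:
  assumes "open S" "\<And>x. x \<in> S \<Longrightarrow> f x = g x" "k_times_differentiable_on k S f"
  shows "k_times_differentiable_on k S g"
  using assms(2,3)
proof (induction k arbitrary: f g)
  case 0
  then show ?case using continuous_on_cong by force
next
  case (Suc k)
  have d: "g differentiable at x \<and> frechet_derivative g (at x) = frechet_derivative f (at x)"
    if "x \<in> S" for x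
  proof -
    have "f differentiable at x" using Suc.prems(2) that by simp
    then have "(f has_derivative frechet_derivative f (at x)) (at x)"
      by (rule frechet_derivative_worksI)
    then have "(g has_derivative frechet_derivative f (at x)) (at x)"
      using has_derivative_transform_within_open[OF _ assms(1) that] Suc.prems(1) by blast
    then have "g differentiable at x" "frechet_derivative g (at x) = frechet_derivative f (at x)"
      by (rule differentiableI, rule frechet_derivative_eq)
    then show ?thesis ..
  qed
  have "k_times_differentiable_on k S (\<lambda>x. frechet_derivative g (at x) v)" for v
  proof (rule Suc.IH)
    show "frechet_derivative f (at x) v = frechet_derivative g (at x) v" if "x \<in> S" for x
      using d[OF that] by simp
    show "k_times_differentiable_on k S (\<lambda>x. frechet_derivative f (at x) v)"
      using Suc.prems(2) by simp
  qed
  moreover have "\<forall>x\<in>S. g differentiable at x" using d by blast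
  ultimately show ?case by simp
qed

lemma smooth_on_cong:
  "open S \<Longrightarrow> (\<And>x. x \<in> S \<Longrightarrow> f x = g x) \<Longrightarrow> smooth_on S f \<Longrightarrow> smooth_on S g"
  unfolding smooth_on_def by (blast intro: k_times_differentiable_on_cong)

lemma smooth_on_subset: "smooth_on S f \<Longrightarrow> T \<subseteq> S \<Longrightarrow> smooth_on T f"
proof -
  assume T: "T \<subseteq> S"
  have "k_times_differentiable_on k S f \<Longrightarrow> k_times_differentiable_on k T f" for k
    using T by (induction k arbitrary: f) (auto intro: continuous_on_subset)
  then show "smooth_on S f \<Longrightarrow> smooth_on T f" by (auto simp: smooth_on_def)
qed

lemma smooth_on_imp_differentiable: "smooth_on S f \<Longrightarrow> x \<in> S \<Longrightarrow> f differentiable at x"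
  unfolding smooth_on_def by (metis k_times_differentiable_on.simps(2))

lemma smooth_on_imp_continuous_on: "smooth_on S f \<Longrightarrow> continuous_on S f"
  unfolding smooth_on_def by (metis k_times_differentiable_on.simps(1))

lemma smooth_on_frechet: "smooth_on S f \<Longrightarrow> smooth_on S (\<lambda>x. frechet_derivative f (at x) v)"
  unfolding smooth_on_def by (metis k_times_differentiable_on.simps(2))

lemma smooth_onI:
  assumes "open S" "\<And>x. x \<in> S \<Longrightarrow> (f has_derivative f' x) (at x)"
    "\<And>v. smooth_on S (\<lambda>x. f' x v)"
  shows "smooth_on S f"
  unfolding smooth_on_def
proof
  fix k
  have eq: "f' x = frechet_derivative f (at x)" if "x \<in> S" for x
    using frechet_derivative_eq[OF assms(2)[OF that]] by simp
  have "k_times_differentiable_on k S (\<lambda>x. frechet_derivative f (at x) v)" for v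
    by (rule k_times_differentiable_on_cong[OF assms(1), of "\<lambda>x. f' x v"])
       (use assms(3) eq in \<open>auto simp: smooth_on_def\<close>)
  moreover have "f differentiable at x" if "x \<in> S" for x
    using assms(2)[OF that] by (rule differentiableI)
  ultimately have "k_times_differentiable_on (Suc k) S f" by simp
  then show "k_times_differentiable_on k S f" by (rule k_times_differentiable_on_Suc_imp)
qed

lemma smooth_on_const [simp]: "smooth_on S (\<lambda>x. c)"
proof -
  have "k_times_differentiable_on k S (\<lambda>x. c)" for k
    by (induction k arbitrary: c) auto
  then show ?thesis by (simp add: smooth_on_def)
qed

lemma smooth_on_bounded_linear: "bounded_linear f \<Longrightarrow> smooth_on S f"
proof -
  assume f: "bounded_linear f"
  have "smooth_on UNIV f"
    by (rule smooth_onI[where f' = "\<lambda>x. f"])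
       (auto intro: bounded_linear_imp_has_derivative f)
  then show ?thesis by (rule smooth_on_subset) simp
qed


lemma k_times_differentiable_on_add:
  assumes S: "open S" and "k_times_differentiable_on k S f" "k_times_differentiable_on k S g"
  shows "k_times_differentiable_on k S (\<lambda>x. f x + g x)"
  using assms(2,3)
proof (induction k arbitrary: f g)
  case 0
  then show ?case by (simp add: continuous_on_add)
next
  case (Suc k)
  have d: "f differentiable at x" "g differentiable at x" if "x \<in> S" for x
    using Suc.prems that by auto
  have D: "((\<lambda>x. f x + g x) has_derivative (\<lambda>v. frechet_derivative f (at x) v +
      frechet_derivative g (at x) v)) (at x)" if "x \<in> S" for x
    by (intro has_derivative_add frechet_derivative_worksI d that)
  have "k_times_differentiable_on k S (\<lambda>x. frechet_derivative f (at x) v + frechet_derivative g (at x) v)" for v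
    using Suc.prems by (intro Suc.IH) simp_all
  then have "k_times_differentiable_on k S (\<lambda>x. frechet_derivative (\<lambda>x. f x + g x) (at x) v)" for v
    by (rule k_times_differentiable_on_cong[OF S, rotated]) (simp add: frechet_derivative_eq[OF D])
  then show ?case using d by (auto intro: differentiable_add)
qed

lemma smooth_on_add:
  "open S \<Longrightarrow> smooth_on S f \<Longrightarrow> smooth_on S g \<Longrightarrow> smooth_on S (\<lambda>x. f x + g x)"
  unfolding smooth_on_def by (blast intro: k_times_differentiable_on_add)

lemma smooth_on_sum:
  "open S \<Longrightarrow> (\<And>i. i \<in> I \<Longrightarrow> smooth_on S (f i)) \<Longrightarrow> smooth_on S (\<lambda>x. \<Sum>i\<in>I. f i x)"
  by (induction I rule: infinite_finite_induct) (auto intro: smooth_on_add)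

text \<open>The induction is on the order while both factors stay fully smooth, so the hypothesis
  applies to products in which only one factor has been differentiated.\<close>

lemma smooth_on_mult:
  fixes f g :: "'a::real_normed_vector \<Rightarrow> real"
  assumes S: "open S" and "smooth_on S f" "smooth_on S g"
  shows "smooth_on S (\<lambda>x. f x * g x)"
  unfolding smooth_on_def
proof
  fix k
  show "k_times_differentiable_on k S (\<lambda>x. f x * g x)"
    using assms(2,3)
  proof (induction k arbitrary: f g)
    case 0
    then show ?case by (simp add: continuous_on_mult smooth_on_imp_continuous_on)
  next
    case (Suc k)
    have d: "f differentiable at x" "g differentiable at x" if "x \<in> S" for x
      using Suc.prems smooth_on_imp_differentiable that by blast+
    have D: "((\<lambda>x. f x * g x) has_derivative (\<lambda>v. f x * frechet_derivative g (at x) v +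
        frechet_derivative f (at x) v * g x)) (at x)" if "x \<in> S" for x
      by (intro has_derivative_mult frechet_derivative_worksI d that)
    have "k_times_differentiable_on k S (\<lambda>x. frechet_derivative (\<lambda>x. f x * g x) (at x) v)" for v
      by (rule k_times_differentiable_on_cong[OF S _ k_times_differentiable_on_add[OF S
            Suc.IH[OF Suc.prems(1) smooth_on_frechet[OF Suc.prems(2)]]
            Suc.IH[OF smooth_on_frechet[OF Suc.prems(1)] Suc.prems(2)]]])
        (simp add: frechet_derivative_eq[OF D])
    then show ?case using d by (auto intro: differentiable_mult)
  qed
qed

lemma smooth_on_prod:
  fixes f :: "'i \<Rightarrow> 'a::real_normed_vector \<Rightarrow> real"
  shows "open S \<Longrightarrow> (\<And>i. i \<in> I \<Longrightarrow> smooth_on S (f i)) \<Longrightarrow> smooth_on S (\<lambda>x. \<Prod>i\<in>I. f i x)"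
  by (induction I rule: infinite_finite_induct) (auto intro: smooth_on_mult)

text \<open>The induction needs a class closed under differentiation: the derivative of
  \<open>inverse (f x)^m * g x\<close> is \<open>inverse (f x)^(Suc m)\<close> times a smooth
  function. The claim is the case m = 1, g = 1.\<close>

lemma smooth_on_inverse:
  fixes f :: "'a::real_normed_vector \<Rightarrow> real"
  assumes S: "open S" and f: "smooth_on S f" and nz: "\<And>x. x \<in> S \<Longrightarrow> f x \<noteq> 0"
  shows "smooth_on S (\<lambda>x. inverse (f x))"
proof -
  have d: "(f has_derivative frechet_derivative f (at x)) (at x)" if "x \<in> S" for x
    using f smooth_on_imp_differentiable that frechet_derivative_worksI by blast
  have D: "((\<lambda>x. inverse (f x)^m * g x) has_derivative
      (\<lambda>v. inverse (f x)^(Suc m) * (f x * frechet_derivative g (at x) v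
         + - of_nat m * (frechet_derivative f (at x) v * g x)))) (at x)"
    if x: "x \<in> S" and g: "smooth_on S g" for x m g
  proof -
    have g': "(g has_derivative frechet_derivative g (at x)) (at x)"
      using g smooth_on_imp_differentiable x frechet_derivative_worksI by blast
    have nz': "f x \<noteq> 0" by (rule nz[OF x])
    have "((\<lambda>x. inverse (f x)^m * g x) has_derivative
      (\<lambda>v. inverse (f x)^m * frechet_derivative g (at x) v +
        of_nat m * (- (inverse (f x) * frechet_derivative f (at x) v * inverse (f x))) *
        inverse (f x)^(m - 1) * g x)) (at x)"
      by (intro has_derivative_mult has_derivative_power Deriv.has_derivative_inverse nz' d x g')
    then show ?thesis
      by (rule has_derivative_eq_rhs) (use nz' in \<open>cases m; simp add: fun_eq_iff field_simps\<close>)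
  qed
  have "k_times_differentiable_on k S (\<lambda>x. inverse (f x)^m * g x)" if "smooth_on S g" for k m g
    using that
  proof (induction k arbitrary: m g)
    case 0
    then have "continuous_on S (\<lambda>x. inverse (f x)^m * g x)"
      using f nz by (intro continuous_on_mult continuous_on_power continuous_on_inverse
          smooth_on_imp_continuous_on) auto
    then show ?case by simp
  next
    case (Suc k)
    have sm: "smooth_on S (\<lambda>x. f x * frechet_derivative g (at x) v
         + - of_nat m * (frechet_derivative f (at x) v * g x))" for v
      by (intro smooth_on_add smooth_on_mult S f Suc.prems smooth_on_frechet smooth_on_const)
    have "k_times_differentiable_on k S
        (\<lambda>x. frechet_derivative (\<lambda>x. inverse (f x)^m * g x) (at x) v)" for v
      by (rule k_times_differentiable_on_cong[OF S _ Suc.IH[where m = "Suc m", OF sm[of v]]])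
         (simp add: frechet_derivative_eq[OF D[OF _ Suc.prems]])
    then show ?case using D[OF _ Suc.prems] by (auto simp: differentiable_def)
  qed
  from this[of "\<lambda>_. 1" _ 1] show ?thesis by (simp add: smooth_on_def)
qed

lemma smooth_on_divide:
  fixes f g :: "'a::real_normed_vector \<Rightarrow> real"
  assumes "open S" "smooth_on S f" "smooth_on S g" "\<And>x. x \<in> S \<Longrightarrow> g x \<noteq> 0"
  shows "smooth_on S (\<lambda>x. f x / g x)"
  unfolding divide_inverse by (intro smooth_on_mult smooth_on_inverse assms)

lemma smooth_on_ln:
  fixes f :: "'a::real_normed_vector \<Rightarrow> real"
  assumes S: "open S" and f: "smooth_on S f" and pos: "\<And>x. x \<in> S \<Longrightarrow> f x > 0"
  shows "smooth_on S (\<lambda>x. ln (f x))"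
proof (rule smooth_onI[OF S])
  fix x assume x: "x \<in> S"
  have "(f has_derivative frechet_derivative f (at x)) (at x)"
    using f smooth_on_imp_differentiable x frechet_derivative_worksI by blast
  from has_derivative_ln[OF pos[OF x] this]
  show "((\<lambda>x. ln (f x)) has_derivative (\<lambda>v. frechet_derivative f (at x) v / f x)) (at x)"
    by (simp add: divide_inverse)
next
  fix v
  show "smooth_on S (\<lambda>x. frechet_derivative f (at x) v / f x)"
    using pos by (force intro!: smooth_on_divide S f smooth_on_frechet)
qed

lemma smooth_on_slice:
  fixes f :: "'a::real_normed_vector \<times> 'b::real_normed_vector \<Rightarrow> real"
  assumes S: "open S" "open T" and f: "smooth_on S f" and sub: "\<And>x. x \<in> T \<Longrightarrow> (x, y) \<in> S"
  shows "smooth_on T (\<lambda>x. f (x, y))"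
  unfolding smooth_on_def
proof
  fix k
  show "k_times_differentiable_on k T (\<lambda>x. f (x, y))"
    using f
  proof (induction k arbitrary: f)
    case 0
    have "continuous_on T (\<lambda>x. f (x, y))"
      by (rule continuous_on_compose2[OF smooth_on_imp_continuous_on[OF 0]])
         (use sub in \<open>auto intro!: continuous_on_Pair\<close>)
    then show ?case by simp
  next
    case (Suc k)
    have D: "((\<lambda>x. f (x, y)) has_derivative (\<lambda>v. frechet_derivative f (at (x, y)) (v, 0))) (at x)"
      if "x \<in> T" for x
    proof -
      have "(f has_derivative frechet_derivative f (at (x, y))) (at (x, y))"
        using Suc.prems sub that smooth_on_imp_differentiable frechet_derivative_worksI by blast
      moreover have "((\<lambda>x. (x, y)) has_derivative (\<lambda>v. (v, 0))) (at x)"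
        by (auto intro!: derivative_eq_intros)
      ultimately show ?thesis using has_derivative_compose by blast
    qed
    have "k_times_differentiable_on k T (\<lambda>x. frechet_derivative (\<lambda>x. f (x, y)) (at x) v)" for v
      by (rule k_times_differentiable_on_cong[OF S(2) _
            Suc.IH[OF smooth_on_frechet[OF Suc.prems, of "(v, 0)"]]])
         (simp add: frechet_derivative_eq[OF D])
    then show ?case using D by (auto simp: differentiable_def)
  qed
qed

section \<open>Symmetry of second derivatives\<close>

lemma has_real_derivative_along_line:
  fixes g :: "'a::real_normed_vector \<Rightarrow> real"
  assumes "g differentiable at (z + t *\<^sub>R w)"
  shows "((\<lambda>t. g (z + t *\<^sub>R w)) has_real_derivative frechet_derivative g (at (z + t *\<^sub>R w)) w) (at t)"
proof -
  have "((\<lambda>t. g (z + t *\<^sub>R w)) has_derivative (\<lambda>s. frechet_derivative g (at (z + t *\<^sub>R w)) (s *\<^sub>R w))) (at t)"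
    by (rule has_derivative_compose[of "\<lambda>t. z + t *\<^sub>R w", OF _ frechet_derivative_worksI[OF assms]])
       (auto intro!: derivative_eq_intros)
  then show ?thesis
    unfolding has_field_derivative_def using linear_frechet_derivative[OF assms]
    by (simp add: linear_cmul mult_commute_abs)
qed

text \<open>The mean value theorem is applied to the difference in direction v as a function of the
  step along u, then to the u-derivative along v. The left side is symmetric in u and v, which is
  what allows derivatives to be interchanged.\<close>

lemma second_difference:
  fixes f :: "'a::real_normed_vector \<Rightarrow> real"
  assumes f: "smooth_on S f" and h: "h > 0"
    and S: "\<And>s t. 0 \<le> s \<Longrightarrow> s \<le> h \<Longrightarrow> 0 \<le> t \<Longrightarrow> t \<le> h \<Longrightarrow> x + s *\<^sub>R u + t *\<^sub>R v \<in> S"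
  shows "\<exists>s t. 0 < s \<and> s < h \<and> 0 < t \<and> t < h \<and>
    f (x + h *\<^sub>R u + h *\<^sub>R v) - f (x + h *\<^sub>R u) - f (x + h *\<^sub>R v) + f x =
    h * h * frechet_derivative (\<lambda>x. frechet_derivative f (at x) u) (at (x + s *\<^sub>R u + t *\<^sub>R v)) v"
proof -
  let ?Du = "\<lambda>x. frechet_derivative f (at x) u"
  define \<phi> where "\<phi> s = f ((x + h *\<^sub>R v) + s *\<^sub>R u) - f (x + s *\<^sub>R u)" for s
  have "\<exists>s. 0 < s \<and> s < h \<and> \<phi> h - \<phi> 0 = (h - 0) *
      (?Du ((x + h *\<^sub>R v) + s *\<^sub>R u) - ?Du (x + s *\<^sub>R u))"
  proof (rule MVT2[OF h])
    fix s assume s: "0 \<le> s" "s \<le> h"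
    have "x + h *\<^sub>R v + s *\<^sub>R u \<in> S" "x + s *\<^sub>R u \<in> S"
      using S[of s h] S[of s 0] s h by (simp_all add: algebra_simps)
    then show "(\<phi> has_real_derivative ?Du ((x + h *\<^sub>R v) + s *\<^sub>R u) - ?Du (x + s *\<^sub>R u)) (at s)"
      unfolding \<phi>_def
      by (intro DERIV_diff has_real_derivative_along_line smooth_on_imp_differentiable[OF f])
  qed
  then obtain s where s: "0 < s" "s < h"
    and 1: "\<phi> h - \<phi> 0 = h * (?Du ((x + h *\<^sub>R v) + s *\<^sub>R u) - ?Du (x + s *\<^sub>R u))" by auto
  have "\<exists>t. 0 < t \<and> t < h \<and> ?Du ((x + s *\<^sub>R u) + h *\<^sub>R v) - ?Du ((x + s *\<^sub>R u) + 0 *\<^sub>R v) = (h - 0) *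
      frechet_derivative ?Du (at ((x + s *\<^sub>R u) + t *\<^sub>R v)) v"
    using S s by (intro MVT2[OF h] has_real_derivative_along_line
        smooth_on_imp_differentiable[OF smooth_on_frechet[OF f]]) auto
  then obtain t where t: "0 < t" "t < h" "?Du ((x + s *\<^sub>R u) + h *\<^sub>R v) - ?Du (x + s *\<^sub>R u) = h *
      frechet_derivative ?Du (at ((x + s *\<^sub>R u) + t *\<^sub>R v)) v" by auto
  have e: "x + h *\<^sub>R v + s *\<^sub>R u = x + s *\<^sub>R u + h *\<^sub>R v" by (simp add: algebra_simps)
  have "f (x + h *\<^sub>R u + h *\<^sub>R v) - f (x + h *\<^sub>R u) - f (x + h *\<^sub>R v) + f x = \<phi> h - \<phi> 0"
    by (simp add: \<phi>_def algebra_simps)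
  also have "\<dots> = h * h * frechet_derivative ?Du (at (x + s *\<^sub>R u + t *\<^sub>R v)) v"
    using 1 t(3) by (simp add: e)
  finally show ?thesis using s t by blast
qed

text \<open>Divided by h * h, one and the same second difference is a value of either iterated
  derivative at a point close to x; continuity at x identifies the two.\<close>

lemma frechet_derivative_commute:
  fixes f :: "'a::real_normed_vector \<Rightarrow> real"
  assumes S: "open S" "x \<in> S" and f: "smooth_on S f"
  shows "frechet_derivative (\<lambda>x. frechet_derivative f (at x) u) (at x) v =
         frechet_derivative (\<lambda>x. frechet_derivative f (at x) v) (at x) u"
proof -
  define A where "A = (\<lambda>x. frechet_derivative (\<lambda>x. frechet_derivative f (at x) u) (at x) v)"
  define B where "B = (\<lambda>x. frechet_derivative (\<lambda>x. frechet_derivative f (at x) v) (at x) u)"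
  have c: "isCont A x" "isCont B x"
    using S smooth_on_imp_continuous_on[OF smooth_on_frechet[OF smooth_on_frechet[OF f]]]
    by (auto simp: A_def B_def continuous_on_eq_continuous_at)
  have lim: "((\<lambda>p. x + fst p *\<^sub>R u + snd p *\<^sub>R v) \<longlongrightarrow> x) (nhds ((0,0)::real\<times>real))"
  proof -
    have "isCont (\<lambda>p::real\<times>real. x + fst p *\<^sub>R u + snd p *\<^sub>R v) (0,0)" by (intro continuous_intros)
    then show ?thesis
      using tendsto_at_iff_tendsto_nhds[of "\<lambda>p::real\<times>real. x + fst p *\<^sub>R u + snd p *\<^sub>R v" "(0,0)"]
      by (simp add: continuous_at)
  qed
  have "\<bar>A x - B x\<bar> \<le> e" if e: "e > 0" for e
  proof -
    have "(A \<longlongrightarrow> A x) (nhds x)" "(B \<longlongrightarrow> B x) (nhds x)"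
      using c by (simp_all add: continuous_at tendsto_at_iff_tendsto_nhds)
    then have "\<forall>\<^sub>F y in nhds x. dist (A y) (A x) < e/2 \<and> dist (B y) (B x) < e/2 \<and> y \<in> S"
      using e S by (intro eventually_conj tendstoD eventually_nhds_in_open) auto
    then have "\<forall>\<^sub>F p in nhds ((0,0)::real\<times>real). dist (A (x + fst p *\<^sub>R u + snd p *\<^sub>R v)) (A x) < e/2 \<and>
        dist (B (x + fst p *\<^sub>R u + snd p *\<^sub>R v)) (B x) < e/2 \<and> x + fst p *\<^sub>R u + snd p *\<^sub>R v \<in> S"
      by (rule eventually_compose_filterlim[OF _ lim])
    then obtain d where d: "d > 0" and D: "\<And>p. dist p ((0,0)::real\<times>real) < d \<Longrightarrow>
        dist (A (x + fst p *\<^sub>R u + snd p *\<^sub>R v)) (A x) < e/2 \<and>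
        dist (B (x + fst p *\<^sub>R u + snd p *\<^sub>R v)) (B x) < e/2 \<and> x + fst p *\<^sub>R u + snd p *\<^sub>R v \<in> S"
      unfolding eventually_nhds_metric by blast
    \<comment> \<open>The intermediate points have parameters s, t \<le> h, so (s, t) has norm at
      most 2 d / 3.\<close>
    define h where "h = d / 3"
    have h: "h > 0" using d by (simp add: h_def)
    have D': "dist (A (x + s *\<^sub>R u + t *\<^sub>R v)) (A x) < e/2 \<and>
        dist (B (x + s *\<^sub>R u + t *\<^sub>R v)) (B x) < e/2 \<and> x + s *\<^sub>R u + t *\<^sub>R v \<in> S"
      if "0 \<le> s" "s \<le> h" "0 \<le> t" "t \<le> h" for s t
    proof -
      have "dist (s,t) (0,0) \<le> \<bar>s\<bar> + \<bar>t\<bar>"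
        using norm_Pair_le[of s t] by (simp add: dist_norm)
      then show ?thesis using D[of "(s,t)"] that d by (simp add: h_def)
    qed
    obtain s t where 1: "0 < s" "s < h" "0 < t" "t < h"
      "f (x + h *\<^sub>R u + h *\<^sub>R v) - f (x + h *\<^sub>R u) - f (x + h *\<^sub>R v) + f x = h * h * A (x + s *\<^sub>R u + t *\<^sub>R v)"
      using second_difference[OF f h, of x u v] D' unfolding A_def by blast
    have "x + s *\<^sub>R v + t *\<^sub>R u \<in> S" if "0 \<le> s" "s \<le> h" "0 \<le> t" "t \<le> h" for s t
      using D'[of t s] that by (simp add: algebra_simps)
    then obtain s' t' where 2: "0 < s'" "s' < h" "0 < t'" "t' < h"
      "f (x + h *\<^sub>R v + h *\<^sub>R u) - f (x + h *\<^sub>R v) - f (x + h *\<^sub>R u) + f x = h * h * B (x + s' *\<^sub>R v + t' *\<^sub>R u)"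
      using second_difference[OF f h, of x v u] unfolding B_def by blast
    have "h * h * A (x + s *\<^sub>R u + t *\<^sub>R v) = h * h * B (x + t' *\<^sub>R u + s' *\<^sub>R v)"
      using 1(5) 2(5) by (simp add: algebra_simps)
    then have "A (x + s *\<^sub>R u + t *\<^sub>R v) = B (x + t' *\<^sub>R u + s' *\<^sub>R v)" using h by simp
    moreover have "\<bar>A (x + s *\<^sub>R u + t *\<^sub>R v) - A x\<bar> < e/2" "\<bar>B (x + t' *\<^sub>R u + s' *\<^sub>R v) - B x\<bar> < e/2"
      using D'[of s t] D'[of t' s'] 1(1-4) 2(1-4) by (simp_all add: dist_real_def)
    ultimately show ?thesis by linarith
  qed
  then have "\<bar>A x - B x\<bar> \<le> 0" by (rule field_le_epsilon) simp
  then show ?thesis by (simp add: A_def B_def)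
qed

subsection \<open>Partial derivatives of functions of position and direction\<close>

text \<open>One operator for a direction in the product space covers base and fibre derivatives, so
  that the calculus rules and the interchange of derivatives are proved once for both.\<close>

definition pd :: "(real ^ 'n) \<times> (real ^ 'n) \<Rightarrow> (real ^ 'n::finite \<Rightarrow> real ^ 'n \<Rightarrow> real) \<Rightarrow>
    real ^ 'n \<Rightarrow> real ^ 'n \<Rightarrow> real" where
  "pd e f x y = deriv (\<lambda>t. f (x + t *\<^sub>R fst e) (y + t *\<^sub>R snd e)) 0"

abbreviation ex :: "'n \<Rightarrow> (real ^ 'n::finite) \<times> (real ^ 'n)" where "ex i \<equiv> (axis i 1, 0)"
abbreviation ey :: "'n \<Rightarrow> (real ^ 'n::finite) \<times> (real ^ 'n)" where "ey i \<equiv> (0, axis i 1)"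

lemma Dx_pd: "Dx i f = pd (ex i) f"
  by (simp add: fun_eq_iff Dx_def pd_def pderiv_at_def)

lemma Dy_pd: "Dy i f = pd (ey i) f"
  by (simp add: fun_eq_iff Dy_def pd_def pderiv_at_def)

lemma pd_ex_const: "pd (ex i) (\<lambda>x y. f x) x y = pderiv_at i f x"
  by (simp add: pd_def pderiv_at_def)

lemma pd_ey_const: "pd (ey i) (\<lambda>x y. f x) x y = 0"
  by (simp add: pd_def)

text \<open>\<open>Y\<close> is the whole fibre when polynomials are differentiated, and the
  punctured fibre for functions on the slit bundle.\<close>

locale domain2 =
  fixes U :: "(real ^ 'n::finite) set" and Y :: "(real ^ 'n) set"
  assumes open_U: "open U" and open_Y: "open Y"
begin

abbreviation sm :: "(real ^ 'n \<Rightarrow> real ^ 'n \<Rightarrow> real) \<Rightarrow> bool" where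
  "sm f \<equiv> smooth_on (U \<times> Y) (\<lambda>(x, y). f x y)"

lemma open_UY: "open (U \<times> Y)"
  by (intro open_Times open_U open_Y)

lemma sm_has_derivative:
  assumes "sm f" "x \<in> U" "y \<in> Y"
  shows "((\<lambda>(x, y). f x y) has_derivative (\<lambda>e. pd e f x y)) (at (x, y))"
proof -
  let ?F = "\<lambda>(x, y). f x y"
  have d: "?F differentiable at (x, y)"
    using assms smooth_on_imp_differentiable by blast
  have "pd e f x y = frechet_derivative ?F (at (x, y)) e" for e
  proof -
    have "((\<lambda>t. ?F ((x, y) + t *\<^sub>R e)) has_real_derivative frechet_derivative ?F (at ((x, y) + 0 *\<^sub>R e)) e) (at 0)"
      by (rule has_real_derivative_along_line) (use d in simp)
    then show ?thesis unfolding pd_def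
      by (intro DERIV_imp_deriv) (simp add: case_prod_unfold)
  qed
  then show ?thesis using frechet_derivative_worksI[OF d] by (metis (no_types, lifting) ext)
qed

lemma pd_eqI:
  assumes "((\<lambda>(x, y). f x y) has_derivative f') (at (x, y))"
  shows "pd e f x y = f' e"
proof -
  let ?F = "\<lambda>(x, y). f x y"
  have d: "?F differentiable at ((x, y) + 0 *\<^sub>R e)" using assms by (simp add: differentiableI)
  show ?thesis
    using has_real_derivative_along_line[OF d] frechet_derivative_eq[OF assms]
    unfolding pd_def by (intro DERIV_imp_deriv) (simp add: case_prod_unfold)
qed

lemma pd_cong:
  assumes "\<And>x y. x \<in> U \<Longrightarrow> y \<in> Y \<Longrightarrow> f x y = g x y" "x \<in> U" "y \<in> Y"
  shows "pd e f x y = pd e g x y"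
  unfolding pd_def
proof (rule deriv_cong_ev)
  have "((\<lambda>t. (x + t *\<^sub>R fst e, y + t *\<^sub>R snd e)) \<longlongrightarrow> (x + 0 *\<^sub>R fst e, y + 0 *\<^sub>R snd e)) (at (0::real))"
    by (intro tendsto_intros)
  then have "\<forall>\<^sub>F t in at (0::real). (x + t *\<^sub>R fst e, y + t *\<^sub>R snd e) \<in> U \<times> Y"
    by (rule topological_tendstoD[OF _ open_UY]) (use assms(2,3) in simp)
  then have "\<forall>\<^sub>F t in nhds (0::real). (x + t *\<^sub>R fst e, y + t *\<^sub>R snd e) \<in> U \<times> Y"
    using assms(2,3) by (simp add: eventually_nhds_conv_at)
  then show "\<forall>\<^sub>F t in nhds 0. f (x + t *\<^sub>R fst e) (y + t *\<^sub>R snd e) = g (x + t *\<^sub>R fst e) (y + t *\<^sub>R snd e)"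
    by eventually_elim (use assms(1) in simp)
qed simp

lemma sm_cong:
  assumes "\<And>x y. x \<in> U \<Longrightarrow> y \<in> Y \<Longrightarrow> f x y = g x y" "sm f"
  shows "sm g"
  by (rule smooth_on_cong[OF open_UY _ assms(2)]) (use assms(1) in auto)

lemma sm_pd:
  assumes f: "sm f"
  shows "sm (pd e f)"
  by (rule smooth_on_cong[OF open_UY _ smooth_on_frechet[OF f, of e]])
     (auto simp: frechet_derivative_eq[OF sm_has_derivative[OF f]])

lemma pd_commute:
  assumes f: "sm f" and xy: "x \<in> U" "y \<in> Y"
  shows "pd e (pd e' f) x y = pd e' (pd e f) x y"
proof -
  let ?F = "\<lambda>(x, y). f x y"
  have D: "((\<lambda>(x, y). pd e f x y) has_derivative
      frechet_derivative (\<lambda>z. frechet_derivative ?F (at z) e) (at (x, y))) (at (x, y))" for e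
  proof (rule has_derivative_transform_within_open[OF _ open_UY])
    show "((\<lambda>z. frechet_derivative ?F (at z) e) has_derivative
      frechet_derivative (\<lambda>z. frechet_derivative ?F (at z) e) (at (x, y))) (at (x, y))"
      using smooth_on_imp_differentiable[OF smooth_on_frechet[OF f]] xy
      by (intro frechet_derivative_worksI) auto
  qed (use xy in \<open>auto simp: frechet_derivative_eq[OF sm_has_derivative[OF f]]\<close>)
  have "(x, y) \<in> U \<times> Y" using xy by simp
  from frechet_derivative_commute[OF open_UY this f] show ?thesis
    by (simp add: pd_eqI[OF D])
qed

lemma sm_const: "sm (\<lambda>x y. c)"
  by (simp add: case_prod_unfold)

lemma sm_fst: "smooth_on U C \<Longrightarrow> sm (\<lambda>x y. C x)"
proof -
  assume C: "smooth_on U C"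
  have "k_times_differentiable_on k (U \<times> Y) (\<lambda>z. C (fst z))" if "k_times_differentiable_on k U C"
    for k and C :: "real ^ 'n \<Rightarrow> real"
    using that
  proof (induction k arbitrary: C)
    case 0
    then have "continuous_on (U \<times> Y) (\<lambda>z. C (fst z))"
      by (intro continuous_on_compose2[of U C _ fst] continuous_on_fst continuous_on_id) auto
    then show ?case by simp
  next
    case (Suc k)
    have D: "((\<lambda>z. C (fst z)) has_derivative (\<lambda>v. frechet_derivative C (at (fst z)) (fst v))) (at z)"
      if "z \<in> U \<times> Y" for z
    proof -
      have "C differentiable at (fst z)" using Suc.prems that by auto
      from has_derivative_compose[OF has_derivative_fst[OF has_derivative_ident] frechet_derivative_worksI[OF this]]
      show ?thesis .
    qed
    have ih: "k_times_differentiable_on k (U \<times> Y) (\<lambda>z. frechet_derivative C (at (fst z)) (fst v))" for v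
      using Suc.prems by (intro Suc.IH) simp
    have "k_times_differentiable_on k (U \<times> Y) (\<lambda>z. frechet_derivative (\<lambda>z. C (fst z)) (at z) v)" for v
      by (rule k_times_differentiable_on_cong[OF open_UY _ ih[of v]])
         (simp add: frechet_derivative_eq[OF D])
    then show ?case using D by (metis differentiable_def k_times_differentiable_on.simps(2))
  qed
  with C show ?thesis by (simp add: smooth_on_def case_prod_unfold)
qed

lemma sm_coord: "sm (\<lambda>x y. y $ k)"
proof -
  have "bounded_linear (\<lambda>z::(real ^ 'n) \<times> (real ^ 'n). snd z $ k)"
    by (intro bounded_linear_compose[OF bounded_linear_vec_nth bounded_linear_snd])
  then show ?thesis using smooth_on_bounded_linear by (simp add: case_prod_unfold)
qed

lemma sm_add: "sm f \<Longrightarrow> sm g \<Longrightarrow> sm (\<lambda>x y. f x y + g x y)"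
  using smooth_on_add[OF open_UY, of "\<lambda>(x, y). f x y" "\<lambda>(x, y). g x y"] by (simp add: case_prod_unfold)

lemma sm_mult: "sm f \<Longrightarrow> sm g \<Longrightarrow> sm (\<lambda>x y. f x y * g x y)"
  using smooth_on_mult[OF open_UY, of "\<lambda>(x, y). f x y" "\<lambda>(x, y). g x y"] by (simp add: case_prod_unfold)

lemma sm_minus: "sm f \<Longrightarrow> sm (\<lambda>x y. - f x y)"
  using sm_mult[OF sm_const[of "-1"], of f] by simp

lemma sm_diff: "sm f \<Longrightarrow> sm g \<Longrightarrow> sm (\<lambda>x y. f x y - g x y)"
  using sm_add[OF _ sm_minus, of f g] by simp

lemma sm_sum: "(\<And>i. i \<in> I \<Longrightarrow> sm (f i)) \<Longrightarrow> sm (\<lambda>x y. \<Sum>i\<in>I. f i x y)"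
  using smooth_on_sum[OF open_UY, of I "\<lambda>i (x, y). f i x y"] by (simp add: case_prod_unfold)

lemma sm_prod: "(\<And>i. i \<in> I \<Longrightarrow> sm (f i)) \<Longrightarrow> sm (\<lambda>x y. \<Prod>i\<in>I. f i x y)"
  using smooth_on_prod[OF open_UY, of I "\<lambda>i (x, y). f i x y"] by (simp add: case_prod_unfold)

lemma sm_divide:
  assumes "sm f" "sm g" "\<And>x y. x \<in> U \<Longrightarrow> y \<in> Y \<Longrightarrow> g x y \<noteq> 0"
  shows "sm (\<lambda>x y. f x y / g x y)"
  using smooth_on_divide[OF open_UY assms(1,2)] assms(3) by (simp add: case_prod_unfold mem_Times_iff)

lemma sm_ln:
  assumes "sm f" "\<And>x y. x \<in> U \<Longrightarrow> y \<in> Y \<Longrightarrow> f x y > 0"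
  shows "sm (\<lambda>x y. ln (f x y))"
  using smooth_on_ln[OF open_UY assms(1)] assms(2) by (simp add: case_prod_unfold mem_Times_iff)

lemma pd_const: "pd e (\<lambda>x y. c) x y = 0"
  by (simp add: pd_def)

lemma pd_coord: fixes e :: "(real ^ 'n) \<times> (real ^ 'n)" shows "pd e (\<lambda>x y. y $ k) x y = snd e $ k"
proof (rule pd_eqI)
  have "bounded_linear (\<lambda>z::(real ^ 'n) \<times> (real ^ 'n). snd z $ k)"
    by (intro bounded_linear_compose[OF bounded_linear_vec_nth bounded_linear_snd])
  then show "((\<lambda>(x, y). y $ k) has_derivative (\<lambda>e. snd e $ k)) (at (x, y))"
    using bounded_linear_imp_has_derivative by (simp add: case_prod_unfold)
qed

context
  fixes x y assumes x: "x \<in> U" and y: "y \<in> Y"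
begin

lemma pd_add:
  assumes "sm f" "sm g"
  shows "pd e (\<lambda>x y. f x y + g x y) x y = pd e f x y + pd e g x y"
  by (subst pd_eqI[where f' = "\<lambda>e. pd e f x y + pd e g x y"])
     (use has_derivative_add[OF sm_has_derivative[OF assms(1) x y] sm_has_derivative[OF assms(2) x y]]
      in \<open>simp_all add: case_prod_unfold\<close>)

lemma pd_mult:
  assumes "sm f" "sm g"
  shows "pd e (\<lambda>x y. f x y * g x y) x y = pd e f x y * g x y + f x y * pd e g x y"
  by (subst pd_eqI[where f' = "\<lambda>e. f x y * pd e g x y + pd e f x y * g x y"])
     (use has_derivative_mult[OF sm_has_derivative[OF assms(1) x y] sm_has_derivative[OF assms(2) x y]]
      in \<open>simp_all add: case_prod_unfold\<close>)

lemma pd_cmult: "sm f \<Longrightarrow> pd e (\<lambda>x y. c * f x y) x y = c * pd e f x y"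
  by (simp add: pd_mult[OF sm_const] pd_const)

lemma pd_minus: "sm f \<Longrightarrow> pd e (\<lambda>x y. - f x y) x y = - pd e f x y"
  using pd_cmult[of f e "-1"] by simp

lemma pd_diff:
  assumes "sm f" "sm g"
  shows "pd e (\<lambda>x y. f x y - g x y) x y = pd e f x y - pd e g x y"
  using pd_add[OF assms(1) sm_minus[OF assms(2)]] pd_minus[OF assms(2)] by simp

lemma pd_sum:
  "(\<And>i. i \<in> I \<Longrightarrow> sm (f i)) \<Longrightarrow> pd e (\<lambda>x y. \<Sum>i\<in>I. f i x y) x y = (\<Sum>i\<in>I. pd e (f i) x y)"
  by (induction I rule: infinite_finite_induct)
     (simp_all add: pd_const pd_add sm_sum)

text \<open>Solved from the product rule for f = (f / g) * g, the quotient being already known to be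
  smooth.\<close>

lemma pd_divide:
  assumes "sm f" "sm g" "\<And>x y. x \<in> U \<Longrightarrow> y \<in> Y \<Longrightarrow> g x y \<noteq> 0"
  shows "pd e (\<lambda>x y. f x y / g x y) x y = (pd e f x y * g x y - f x y * pd e g x y) / (g x y)\<^sup>2"
proof -
  have g: "g x y \<noteq> 0" using assms(3) x y by blast
  have "pd e f x y = pd e (\<lambda>x y. f x y / g x y * g x y) x y"
  proof (rule pd_cong[OF _ x y])
    show "f x y = f x y / g x y * g x y" if "x \<in> U" "y \<in> Y" for x y
      using assms(3)[OF that] by simp
  qed
  also have "\<dots> = pd e (\<lambda>x y. f x y / g x y) x y * g x y + f x y / g x y * pd e g x y"
    by (intro pd_mult sm_divide assms)
  finally have e: "pd e f x y = pd e (\<lambda>x y. f x y / g x y) x y * g x y + f x y / g x y * pd e g x y" .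
  have "f x y / g x y * pd e g x y * g x y = f x y * pd e g x y" using g by simp
  then have "pd e f x y * g x y - f x y * pd e g x y = pd e (\<lambda>x y. f x y / g x y) x y * (g x y)\<^sup>2"
    unfolding e power2_eq_square distrib_right by simp
  then show ?thesis using g by (simp add: eq_divide_eq)
qed

lemma pd_ln:
  assumes "sm f" "\<And>x y. x \<in> U \<Longrightarrow> y \<in> Y \<Longrightarrow> f x y > 0"
  shows "pd e (\<lambda>x y. ln (f x y)) x y = pd e f x y / f x y"
proof -
  have "case_prod f (x, y) > 0" using assms(2) x y by simp
  from has_derivative_ln[OF this sm_has_derivative[OF assms(1) x y]]
  show ?thesis
    by (subst pd_eqI[where f' = "\<lambda>e. pd e f x y / f x y"])
       (simp_all add: case_prod_unfold divide_inverse)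
qed

lemma pd_expand:
  assumes "sm f"
  shows "pd (u, v) f x y = (\<Sum>i\<in>UNIV. u $ i * pd (ex i) f x y) + (\<Sum>i\<in>UNIV. v $ i * pd (ey i) f x y)"
proof -
  have l: "linear (\<lambda>e. pd e f x y)" using sm_has_derivative[OF assms x y] has_derivative_linear by blast
  have "(u, v) = (\<Sum>i\<in>UNIV. u $ i *\<^sub>R ex i) + (\<Sum>i\<in>UNIV. v $ i *\<^sub>R ey i)"
  proof -
    have "(\<Sum>i\<in>UNIV. w $ i *\<^sub>R axis i 1) = w" for w :: "real ^ 'n"
      using basis_expansion[of w] by (simp add: scalar_mult_eq_scaleR)
    then show ?thesis
      by (intro prod_eqI) (simp_all add: fst_sum snd_sum)
  qed
  then show ?thesis
    by (simp add: linear_add[OF l] linear_sum[OF l] linear_cmul[OF l] del: scaleR_Pair)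
qed

lemma fibre_has_derivative:
  assumes "sm f"
  shows "((\<lambda>y. f x y) has_derivative (\<lambda>v. (\<chi> i. pd (ey i) f x y) \<bullet> v)) (at y)"
proof -
  have "((\<lambda>y. (x, y)) has_derivative (\<lambda>v. (0, v))) (at y)"
    by (auto intro!: derivative_eq_intros)
  from has_derivative_compose[OF this sm_has_derivative[OF assms x y]]
  have "((\<lambda>y. f x y) has_derivative (\<lambda>v. pd (0, v) f x y)) (at y)" by simp
  then show ?thesis
  proof (rule has_derivative_eq_rhs, intro ext)
    show "pd (0, v) f x y = (\<chi> i. pd (ey i) f x y) \<bullet> v" for v
      by (subst pd_expand[OF assms]) (simp add: inner_vec_def mult.commute)
  qed
qed

end

lemma sm_slice: "sm f \<Longrightarrow> y \<in> Y \<Longrightarrow> smooth_on U (\<lambda>x. f x y)"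
  by (drule smooth_on_slice[OF open_UY open_U, of _ y]) simp_all

lemma sm_continuous_fst:
  assumes "sm f" "y \<in> Y"
  shows "continuous_on U (\<lambda>x. f x y)"
  using smooth_on_imp_continuous_on[OF sm_slice[OF assms]] .

end

subsection \<open>Polynomial and rational functions of the direction\<close>

lemma polynomial_in_y_cong:
  "polynomial_in_y U p \<Longrightarrow> (\<And>x y. x \<in> U \<Longrightarrow> p x y = q x y) \<Longrightarrow> polynomial_in_y U q"
  unfolding polynomial_in_y_def by simp

lemma polynomial_in_y_monomial:
  fixes C :: "real ^ 'n::finite \<Rightarrow> real"
  assumes "smooth_on U C"
  shows "polynomial_in_y U (\<lambda>x y. C x * (\<Prod>i\<in>UNIV. (y $ i) ^ \<alpha> i))"
  unfolding polynomial_in_y_def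
  by (rule exI[of _ "{\<alpha>}"], rule exI[of _ "\<lambda>_. C"]) (use assms in auto)

lemma polynomial_in_y_coeff:
  fixes C :: "real ^ 'n::finite \<Rightarrow> real"
  assumes "smooth_on U C"
  shows "polynomial_in_y U (\<lambda>x y. C x)"
  using polynomial_in_y_monomial[OF assms, of "\<lambda>_. 0"] by simp

lemma polynomial_in_y_coord: "polynomial_in_y U (\<lambda>x y. y $ (k :: 'n::finite))"
proof -
  have "(\<Prod>i\<in>UNIV. (y $ i) ^ (if i = k then 1 else 0)) = y $ k" for y :: "real ^ 'n"
    by (subst prod.remove[of _ k]) auto
  then show ?thesis
    using polynomial_in_y_monomial[OF smooth_on_const[of U 1], of "\<lambda>i. if i = k then 1 else 0"] by simp
qed

lemma polynomial_in_y_add: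
  assumes U: "open U" and "polynomial_in_y U p" "polynomial_in_y U q"
  shows "polynomial_in_y U (\<lambda>x y. p x y + q x y)"
proof -
  obtain I C where p: "finite I" "\<And>\<alpha>. \<alpha> \<in> I \<Longrightarrow> smooth_on U (C \<alpha>)"
    "\<And>x y. x \<in> U \<Longrightarrow> p x y = (\<Sum>\<alpha>\<in>I. C \<alpha> x * (\<Prod>i\<in>UNIV. (y $ i) ^ \<alpha> i))"
    using assms(2) unfolding polynomial_in_y_def by blast
  obtain J D where q: "finite J" "\<And>\<alpha>. \<alpha> \<in> J \<Longrightarrow> smooth_on U (D \<alpha>)"
    "\<And>x y. x \<in> U \<Longrightarrow> q x y = (\<Sum>\<alpha>\<in>J. D \<alpha> x * (\<Prod>i\<in>UNIV. (y $ i) ^ \<alpha> i))"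
    using assms(3) unfolding polynomial_in_y_def by blast
  \<comment> \<open>Extension by zero lets both sums run over the union of the two exponent
    sets.\<close>
  define C' where "C' \<alpha> = (if \<alpha> \<in> I then C \<alpha> else (\<lambda>_. 0))" for \<alpha>
  define D' where "D' \<alpha> = (if \<alpha> \<in> J then D \<alpha> else (\<lambda>_. 0))" for \<alpha>
  have "smooth_on U (\<lambda>x. C' \<alpha> x + D' \<alpha> x)" for \<alpha>
    using p(2) q(2) by (intro smooth_on_add U) (auto simp: C'_def D'_def)
  moreover have "p x y + q x y = (\<Sum>\<alpha>\<in>I \<union> J. (C' \<alpha> x + D' \<alpha> x) * (\<Prod>i\<in>UNIV. (y $ i) ^ \<alpha> i))"
    if "x \<in> U" for x y
  proof -
    have "p x y = (\<Sum>\<alpha>\<in>I \<union> J. C' \<alpha> x * (\<Prod>i\<in>UNIV. (y $ i) ^ \<alpha> i))"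
      unfolding p(3)[OF that] using p(1) q(1)
      by (intro sum.mono_neutral_cong_left) (auto simp: C'_def)
    moreover have "q x y = (\<Sum>\<alpha>\<in>I \<union> J. D' \<alpha> x * (\<Prod>i\<in>UNIV. (y $ i) ^ \<alpha> i))"
      unfolding q(3)[OF that] using p(1) q(1)
      by (intro sum.mono_neutral_cong_left) (auto simp: D'_def)
    ultimately show ?thesis by (simp add: sum.distrib distrib_right)
  qed
  moreover have "finite (I \<union> J)" using p(1) q(1) by simp
  ultimately show ?thesis
    unfolding polynomial_in_y_def
    by (intro exI[of _ "I \<union> J"] exI[of _ "\<lambda>\<alpha> x. C' \<alpha> x + D' \<alpha> x"]) simp
qed

lemma polynomial_in_y_sum:
  "open U \<Longrightarrow> (\<And>i. i \<in> I \<Longrightarrow> polynomial_in_y U (p i)) \<Longrightarrow> polynomial_in_y U (\<lambda>x y. \<Sum>i\<in>I. p i x y)"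
  by (induction I rule: infinite_finite_induct)
     (auto intro: polynomial_in_y_add polynomial_in_y_coeff)

lemma polynomial_in_y_mult:
  assumes U: "open U" and "polynomial_in_y U p" "polynomial_in_y U q"
  shows "polynomial_in_y U (\<lambda>x y. p x y * q x y)"
proof -
  obtain I C where p: "finite I" "\<And>\<alpha>. \<alpha> \<in> I \<Longrightarrow> smooth_on U (C \<alpha>)"
    "\<And>x y. x \<in> U \<Longrightarrow> p x y = (\<Sum>\<alpha>\<in>I. C \<alpha> x * (\<Prod>i\<in>UNIV. (y $ i) ^ \<alpha> i))"
    using assms(2) unfolding polynomial_in_y_def by blast
  obtain J D where q: "finite J" "\<And>\<alpha>. \<alpha> \<in> J \<Longrightarrow> smooth_on U (D \<alpha>)"
    "\<And>x y. x \<in> U \<Longrightarrow> q x y = (\<Sum>\<alpha>\<in>J. D \<alpha> x * (\<Prod>i\<in>UNIV. (y $ i) ^ \<alpha> i))"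
    using assms(3) unfolding polynomial_in_y_def by blast
  have "polynomial_in_y U (\<lambda>x y. \<Sum>\<alpha>\<in>I. \<Sum>\<beta>\<in>J. (C \<alpha> x * D \<beta> x) * (\<Prod>i\<in>UNIV. (y $ i) ^ (\<alpha> i + \<beta> i)))"
    using p(2) q(2)
    by (intro polynomial_in_y_sum U polynomial_in_y_monomial smooth_on_mult) auto
  then show ?thesis
    by (rule polynomial_in_y_cong)
       (simp add: p(3) q(3) sum_product power_add prod.distrib mult_ac)
qed

lemma polynomial_in_y_prod:
  "open U \<Longrightarrow> (\<And>i. i \<in> I \<Longrightarrow> polynomial_in_y U (p i)) \<Longrightarrow> polynomial_in_y U (\<lambda>x y. \<Prod>i\<in>I. p i x y)"
  by (induction I rule: infinite_finite_induct)
     (auto intro: polynomial_in_y_mult polynomial_in_y_coeff)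

text \<open>Smooth coefficients and coordinates generate all polynomials. The case
  \<open>cong\<close> reflects that \<open>polynomial_in_y\<close> fixes the values only over
  \<open>U\<close>.\<close>

lemma polynomial_in_y_induct [consumes 1, case_names coeff coord add mult cong]:
  fixes P :: "(real ^ 'n::finite \<Rightarrow> real ^ 'n \<Rightarrow> real) \<Rightarrow> bool"
  assumes p: "polynomial_in_y U p"
    and coeff: "\<And>C. smooth_on U C \<Longrightarrow> P (\<lambda>x y. C x)"
    and coord: "\<And>k. P (\<lambda>x y. y $ k)"
    and add: "\<And>p q. P p \<Longrightarrow> P q \<Longrightarrow> P (\<lambda>x y. p x y + q x y)"
    and mult: "\<And>p q. P p \<Longrightarrow> P q \<Longrightarrow> P (\<lambda>x y. p x y * q x y)"
    and cong: "\<And>p q. P p \<Longrightarrow> (\<And>x y. x \<in> U \<Longrightarrow> p x y = q x y) \<Longrightarrow> P q"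
  shows "P p"
proof -
  obtain I C where p: "finite I" "\<And>\<alpha>. \<alpha> \<in> I \<Longrightarrow> smooth_on U (C \<alpha>)"
    "\<And>x y. x \<in> U \<Longrightarrow> p x y = (\<Sum>\<alpha>\<in>I. C \<alpha> x * (\<Prod>i\<in>UNIV. (y $ i) ^ \<alpha> i))"
    using p unfolding polynomial_in_y_def by blast
  have const: "P (\<lambda>x y. c)" for c using coeff[of "\<lambda>_. c"] by simp
  have pow: "P (\<lambda>x y. (y $ k) ^ m)" for k m
    by (induction m) (auto intro: const mult coord)
  have mon: "P (\<lambda>x y. \<Prod>i\<in>J. (y $ i) ^ \<alpha> i)" for J :: "'n set" and \<alpha> :: "'n \<Rightarrow> nat"
    by (induction J rule: infinite_finite_induct) (auto intro: const mult pow)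
  have "P (\<lambda>x y. \<Sum>\<alpha>\<in>J. C \<alpha> x * (\<Prod>i\<in>UNIV. (y $ i) ^ \<alpha> i))"
    if "finite J" "\<And>\<alpha>. \<alpha> \<in> J \<Longrightarrow> smooth_on U (C \<alpha>)" for J
    using that by (induction J rule: finite_induct) (auto intro!: const add mult coeff mon)
  from cong[OF this[OF p(1,2)]] show ?thesis using p(3) by simp
qed

lemma (in domain2) polynomial_sm:
  assumes "polynomial_in_y U p"
  shows "sm p"
  using assms
proof (induction rule: polynomial_in_y_induct)
  case (coeff C)
  then show ?case by (rule sm_fst)
next
  case (coord k)
  then show ?case by (rule sm_coord)
next
  case (add p q)
  then show ?case by (rule sm_add)
next
  case (mult p q)
  then show ?case by (rule sm_mult)
next
  case (cong p q)
  show ?case by (rule sm_cong[OF _ cong.IH]) (use cong.hyps in blast)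
qed

text \<open>Membership of p itself is carried through the induction because the product rule
  involves the undifferentiated factors. Base directions are included: there the derivative falls on
  the smooth coefficients.\<close>

lemma polynomial_in_y_pd:
  fixes p :: "real ^ 'n::finite \<Rightarrow> real ^ 'n \<Rightarrow> real"
  assumes U: "open U" and "polynomial_in_y U p"
  shows "polynomial_in_y U (pd e p)"
proof -
  interpret domain2 U UNIV by unfold_locales (auto intro: U)
  have "polynomial_in_y U p \<and> polynomial_in_y U (pd e p)"
    using assms(2)
  proof (induction rule: polynomial_in_y_induct)
    case (coeff C)
    \<comment> \<open>The derivative of a function of x alone does not depend on y, so freezing y at
      0 exhibits it as a smooth coefficient.\<close>
    have "smooth_on U (\<lambda>x. pd e (\<lambda>x y. C x) x 0)"
      by (rule sm_slice[OF sm_pd[OF sm_fst[OF coeff]]]) simp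
    then have "polynomial_in_y U (\<lambda>x y. pd e (\<lambda>x y. C x) x 0)" by (rule polynomial_in_y_coeff)
    moreover have "(\<lambda>x y. pd e (\<lambda>x y. C x) x 0) = pd e (\<lambda>x y. C x)" by (simp add: pd_def fun_eq_iff)
    ultimately show ?case using polynomial_in_y_coeff[OF coeff] by simp
  next
    case (coord k)
    have "polynomial_in_y U (\<lambda>x y :: real ^ 'n. snd e $ k)"
      by (rule polynomial_in_y_coeff[OF smooth_on_const])
    then have "polynomial_in_y U (pd e (\<lambda>x y. y $ k))"
      by (rule polynomial_in_y_cong) (rule pd_coord[symmetric])
    then show ?case using polynomial_in_y_coord by blast
  next
    case (add p q)
    then have "polynomial_in_y U (\<lambda>x y. pd e p x y + pd e q x y)"
      using polynomial_in_y_add[OF U] by blast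
    then have "polynomial_in_y U (pd e (\<lambda>x y. p x y + q x y))"
      by (rule polynomial_in_y_cong) (simp add: pd_add polynomial_sm add)
    with add show ?case using polynomial_in_y_add[OF U] by blast
  next
    case (mult p q)
    then have "polynomial_in_y U (\<lambda>x y. pd e p x y * q x y + p x y * pd e q x y)"
      by (intro polynomial_in_y_add[OF U polynomial_in_y_mult[OF U] polynomial_in_y_mult[OF U]]) auto
    then have "polynomial_in_y U (pd e (\<lambda>x y. p x y * q x y))"
      by (rule polynomial_in_y_cong) (simp add: pd_mult polynomial_sm mult)
    with mult show ?case using polynomial_in_y_mult[OF U] by blast
  next
    case (cong p q)
    have "polynomial_in_y U (pd e q)"
      by (rule polynomial_in_y_cong[OF conjunct2[OF cong.IH]]) (rule pd_cong, use cong.hyps in auto)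
    moreover have "polynomial_in_y U q"
      by (rule polynomial_in_y_cong[OF conjunct1[OF cong.IH] cong.hyps])
    ultimately show ?case by simp
  qed
  then show ?thesis by simp
qed

locale slit = fixes U :: "(real ^ 'n::finite) set" assumes open_dom: "open U"

sublocale slit \<subseteq> domain2 U "- {0}"
  by unfold_locales (auto intro: open_dom)

context slit
begin

abbreviation rat :: "(real ^ 'n \<Rightarrow> real ^ 'n \<Rightarrow> real) \<Rightarrow> bool" where
  "rat \<equiv> rational_in_y U"

lemma rat_cong: "rat f \<Longrightarrow> (\<And>x y. x \<in> U \<Longrightarrow> y \<noteq> 0 \<Longrightarrow> f x y = g x y) \<Longrightarrow> rat g"
  unfolding rational_in_y_def by metis

lemma rat_divide_poly:
  assumes "polynomial_in_y U P" "polynomial_in_y U Q"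
    "\<And>x y. x \<in> U \<Longrightarrow> y \<noteq> 0 \<Longrightarrow> Q x y \<noteq> 0" "\<And>x y. x \<in> U \<Longrightarrow> y \<noteq> 0 \<Longrightarrow> f x y = P x y / Q x y"
  shows "rat f"
  using assms unfolding rational_in_y_def by blast

lemma rat_poly: "polynomial_in_y U P \<Longrightarrow> rat P"
  by (rule rat_divide_poly[of _ "\<lambda>_ _. 1"]) (auto intro: polynomial_in_y_coeff)

lemma rat_fst: "smooth_on U C \<Longrightarrow> rat (\<lambda>x y. C x)"
  by (intro rat_poly polynomial_in_y_coeff)

lemma rat_const: "rat (\<lambda>x y. c)"
  by (intro rat_fst) simp

lemma rat_coord: "rat (\<lambda>x y. y $ k)"
  by (intro rat_poly polynomial_in_y_coord)

lemma rat_add: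
  assumes "rat f" "rat g"
  shows "rat (\<lambda>x y. f x y + g x y)"
proof -
  obtain P Q where f: "polynomial_in_y U P" "polynomial_in_y U Q"
    "\<And>x y. x \<in> U \<Longrightarrow> y \<noteq> 0 \<Longrightarrow> Q x y \<noteq> 0 \<and> f x y = P x y / Q x y"
    using assms(1) unfolding rational_in_y_def by blast
  obtain R S where g: "polynomial_in_y U R" "polynomial_in_y U S"
    "\<And>x y. x \<in> U \<Longrightarrow> y \<noteq> 0 \<Longrightarrow> S x y \<noteq> 0 \<and> g x y = R x y / S x y"
    using assms(2) unfolding rational_in_y_def by blast
  show ?thesis
    by (rule rat_divide_poly[of "\<lambda>x y. P x y * S x y + R x y * Q x y" "\<lambda>x y. Q x y * S x y"])
       (use f g in \<open>auto simp: add_frac_eq polynomial_in_y_add polynomial_in_y_mult open_dom\<close>)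
qed

lemma rat_mult:
  assumes "rat f" "rat g"
  shows "rat (\<lambda>x y. f x y * g x y)"
proof -
  obtain P Q where f: "polynomial_in_y U P" "polynomial_in_y U Q"
    "\<And>x y. x \<in> U \<Longrightarrow> y \<noteq> 0 \<Longrightarrow> Q x y \<noteq> 0 \<and> f x y = P x y / Q x y"
    using assms(1) unfolding rational_in_y_def by blast
  obtain R S where g: "polynomial_in_y U R" "polynomial_in_y U S"
    "\<And>x y. x \<in> U \<Longrightarrow> y \<noteq> 0 \<Longrightarrow> S x y \<noteq> 0 \<and> g x y = R x y / S x y"
    using assms(2) unfolding rational_in_y_def by blast
  show ?thesis
    by (rule rat_divide_poly[of "\<lambda>x y. P x y * R x y" "\<lambda>x y. Q x y * S x y"])
       (use f g in \<open>auto simp: polynomial_in_y_mult open_dom\<close>)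
qed

lemma rat_inverse:
  assumes "rat f" and nz: "\<And>x y. x \<in> U \<Longrightarrow> y \<noteq> 0 \<Longrightarrow> f x y \<noteq> 0"
  shows "rat (\<lambda>x y. inverse (f x y))"
proof -
  obtain P Q where f: "polynomial_in_y U P" "polynomial_in_y U Q"
    "\<And>x y. x \<in> U \<Longrightarrow> y \<noteq> 0 \<Longrightarrow> Q x y \<noteq> 0 \<and> f x y = P x y / Q x y"
    using assms(1) unfolding rational_in_y_def by blast
  have "P x y \<noteq> 0" if "x \<in> U" "y \<noteq> 0" for x y using f(3)[OF that] nz[OF that] by auto
  then show ?thesis
    by (intro rat_divide_poly[OF f(2,1)]) (use f(3) in auto)
qed

lemma rat_divide:
  "rat f \<Longrightarrow> rat g \<Longrightarrow> (\<And>x y. x \<in> U \<Longrightarrow> y \<noteq> 0 \<Longrightarrow> g x y \<noteq> 0) \<Longrightarrow> rat (\<lambda>x y. f x y / g x y)"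
  unfolding divide_inverse by (intro rat_mult rat_inverse) auto

lemma rat_minus: "rat f \<Longrightarrow> rat (\<lambda>x y. - f x y)"
  using rat_mult[OF rat_const[of "-1"]] by simp

lemma rat_diff: "rat f \<Longrightarrow> rat g \<Longrightarrow> rat (\<lambda>x y. f x y - g x y)"
  using rat_add[OF _ rat_minus, of f g] by simp

lemma rat_sum: "(\<And>i. i \<in> I \<Longrightarrow> rat (f i)) \<Longrightarrow> rat (\<lambda>x y. \<Sum>i\<in>I. f i x y)"
  by (induction I rule: infinite_finite_induct) (auto intro: rat_const rat_add)

lemma rat_prod: "(\<And>i. i \<in> I \<Longrightarrow> rat (f i)) \<Longrightarrow> rat (\<lambda>x y. \<Prod>i\<in>I. f i x y)"
  by (induction I rule: infinite_finite_induct) (auto intro: rat_const rat_mult)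

lemma rat_sm:
  assumes "rat f"
  shows "sm f"
proof -
  obtain P Q where f: "polynomial_in_y U P" "polynomial_in_y U Q"
    "\<And>x y. x \<in> U \<Longrightarrow> y \<noteq> 0 \<Longrightarrow> Q x y \<noteq> 0 \<and> f x y = P x y / Q x y"
    using assms unfolding rational_in_y_def by blast
  have "sm (\<lambda>x y. P x y / Q x y)" using f by (intro sm_divide polynomial_sm) auto
  then show ?thesis by (rule sm_cong[rotated]) (use f(3) in auto)
qed

lemma rat_pd:
  assumes "rat f"
  shows "rat (pd e f)"
proof -
  obtain P Q where f: "polynomial_in_y U P" "polynomial_in_y U Q"
    "\<And>x y. x \<in> U \<Longrightarrow> y \<noteq> 0 \<Longrightarrow> Q x y \<noteq> 0 \<and> f x y = P x y / Q x y"
    using assms unfolding rational_in_y_def by blast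
  have eq: "pd e f x y = (pd e P x y * Q x y - P x y * pd e Q x y) / (Q x y)\<^sup>2"
    if "x \<in> U" "y \<noteq> 0" for x y
  proof -
    have "pd e f x y = pd e (\<lambda>x y. P x y / Q x y) x y"
      by (rule pd_cong) (use f(3) that in auto)
    also have "\<dots> = (pd e P x y * Q x y - P x y * pd e Q x y) / (Q x y)\<^sup>2"
      by (rule pd_divide) (use f that in \<open>auto intro: polynomial_sm\<close>)
    finally show ?thesis .
  qed
  have r: "rat (\<lambda>x y. (pd e P x y * Q x y - P x y * pd e Q x y) / (Q x y)\<^sup>2)"
    unfolding power2_eq_square
    by (intro rat_divide rat_diff rat_mult rat_poly polynomial_in_y_pd open_dom f) (use f(3) in auto)
  show ?thesis by (rule rat_cong[OF r]) (simp add: eq)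
qed

lemma rat_det:
  fixes M :: "real ^ 'n \<Rightarrow> real ^ 'n \<Rightarrow> real ^ 'm::finite ^ 'm"
  assumes "\<And>i j. rat (\<lambda>x y. M x y $ i $ j)"
  shows "rat (\<lambda>x y. det (M x y))"
  unfolding det_def by (intro rat_sum rat_mult rat_const rat_prod assms)

end

section \<open>Inverses and determinants of matrix functions\<close>

lemma matrix_inv_mult:
  fixes A :: "real ^ 'n::finite ^ 'n"
  assumes "det A \<noteq> 0"
  shows "A ** matrix_inv A = mat 1" "matrix_inv A ** A = mat 1"
proof -
  have "\<exists>B. A ** B = mat 1 \<and> B ** A = mat 1"
    using assms unfolding invertible_det_nz[symmetric] invertible_def .
  then show "A ** matrix_inv A = mat 1" "matrix_inv A ** A = mat 1"
    unfolding matrix_inv_def by (auto dest!: someI_ex)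
qed

text \<open>Written as quotients of determinants, the entries of the inverse are seen to be rational
  whenever those of the matrix are.\<close>

lemma matrix_inv_cramer:
  fixes A :: "real ^ 'n::finite ^ 'n"
  assumes "det A \<noteq> 0"
  shows "matrix_inv A $ i $ j = det (\<chi> k l. if l = i then (if k = j then 1 else 0) else A $ k $ l) / det A"
proof -
  have "A *v (matrix_inv A *v axis j 1) = axis j 1"
    using matrix_inv_mult(1)[OF assms] by (simp add: matrix_vector_mul_assoc)
  then have "matrix_inv A *v axis j 1 =
      (\<chi> k. det (\<chi> i l. if l = k then axis j 1 $ i else A $ i $ l) / det A)"
    using cramer[OF assms] by blast
  moreover have "(matrix_inv A *v axis j 1) $ i = matrix_inv A $ i $ j"
    by (simp add: matrix_vector_mult_basis column_def)
  ultimately have "matrix_inv A $ i $ j = det (\<chi> k l. if l = i then axis j 1 $ k else A $ k $ l) / det A"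
    by simp
  also have "(\<chi> k l. if l = i then axis j 1 $ k else A $ k $ l) =
      (\<chi> k l. if l = i then (if k = j then 1 else 0) else A $ k $ l)"
    by (simp add: axis_def vec_eq_iff)
  finally show ?thesis .
qed

lemma (in slit) rat_matrix_inv:
  fixes M :: "real ^ 'n \<Rightarrow> real ^ 'n \<Rightarrow> real ^ 'm::finite ^ 'm"
  assumes M: "\<And>i j. rat (\<lambda>x y. M x y $ i $ j)" and nz: "\<And>x y. x \<in> U \<Longrightarrow> y \<noteq> 0 \<Longrightarrow> det (M x y) \<noteq> 0"
  shows "rat (\<lambda>x y. matrix_inv (M x y) $ i $ j)"
proof -
  have 1: "rat (\<lambda>x y. det (M x y))" by (rule rat_det[OF M])
  have 2: "rat (\<lambda>x y. det (\<chi> k l. if l = i then (if k = j then 1 else 0) else M x y $ k $ l))"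
  proof (rule rat_det)
    show "rat (\<lambda>x y. (\<chi> k l. if l = i then (if k = j then 1 else 0) else M x y $ k $ l) $ k $ l)" for k l
      by (cases "l = i"; cases "k = j") (simp_all add: rat_const M)
  qed
  show ?thesis
    by (rule rat_cong[OF rat_divide[OF 2 1]]) (simp_all add: nz matrix_inv_cramer)
qed

context domain2
begin

lemma pd_prod:
  assumes "finite I" "x \<in> U" "y \<in> Y" "\<And>i. i \<in> I \<Longrightarrow> sm (f i)"
  shows "pd e (\<lambda>x y. \<Prod>i\<in>I. f i x y) x y = (\<Sum>i\<in>I. pd e (f i) x y * (\<Prod>j\<in>I - {i}. f j x y))"
  using assms(1,4)
proof (induction I rule: finite_induct)
  case empty
  then show ?case by (simp add: pd_const)
next
  case (insert a I)
  have "(\<Sum>i\<in>I. pd e (f i) x y * (\<Prod>j\<in>insert a I - {i}. f j x y)) =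
      f a x y * (\<Sum>i\<in>I. pd e (f i) x y * (\<Prod>j\<in>I - {i}. f j x y))"
    unfolding sum_distrib_left
  proof (rule sum.cong[OF refl])
    fix i assume "i \<in> I"
    then have "insert a I - {i} = insert a (I - {i})" using insert.hyps by auto
    then show "pd e (f i) x y * (\<Prod>j\<in>insert a I - {i}. f j x y) =
        f a x y * (pd e (f i) x y * (\<Prod>j\<in>I - {i}. f j x y))"
      using insert.hyps by simp
  qed
  moreover have "insert a I - {a} = I" using insert.hyps by auto
  ultimately show ?case
    using insert by (simp add: pd_mult[OF assms(2,3)] sm_prod)
qed

text \<open>Jacobi's formula. With A' = B A, where B = A' A^(-1), every determinant in which one row
  has been differentiated is a diagonal entry of B times det A, and the sum is a trace.\<close>

lemma pd_det:
  fixes M :: "real ^ 'n \<Rightarrow> real ^ 'n \<Rightarrow> real ^ 'm::finite ^ 'm"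
  assumes x: "x \<in> U" and y: "y \<in> Y" and M: "\<And>i j. sm (\<lambda>x y. M x y $ i $ j)" and nz: "det (M x y) \<noteq> 0"
  shows "pd e (\<lambda>x y. det (M x y)) x y =
    det (M x y) * (\<Sum>i\<in>UNIV. \<Sum>k\<in>UNIV. pd e (\<lambda>x y. M x y $ i $ k) x y * matrix_inv (M x y) $ k $ i)"
proof -
  let ?A = "M x y"
  define A' where "A' = (\<chi> i j. pd e (\<lambda>x y. M x y $ i $ j) x y)"
  define B where "B = A' ** matrix_inv ?A"
  have BA: "B ** ?A = A'" unfolding B_def
    using matrix_inv_mult(2)[OF nz] by (simp add: matrix_mul_assoc[symmetric])
  \<comment> \<open>Row i of A' is the combination of the rows of A with coefficients
    \<open>B $ i\<close>; in the determinant only the multiple of row i survives.\<close>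
  have row: "det (\<chi> k. if k = i then A' $ i else ?A $ k) = B $ i $ i * det ?A" for i
  proof -
    have "(\<chi> k. if k = i then A' $ i else ?A $ k) =
        (\<chi> k. if k = i then (\<Sum>j\<in>UNIV. (B $ i) $ j *s row j ?A) else row k ?A)"
      by (subst (1) BA[symmetric]) (auto simp: vec_eq_iff matrix_matrix_mult_def row_def)
    then show ?thesis using cramer_lemma_transpose[of i "B $ i" ?A] by simp
  qed
  have "pd e (\<lambda>x y. det (M x y)) x y =
      (\<Sum>p\<in>{p. p permutes UNIV}. of_int (sign p) * (\<Sum>i\<in>UNIV. A' $ i $ p i * (\<Prod>k\<in>UNIV - {i}. ?A $ k $ p k)))"
    unfolding det_def
    by (subst pd_sum[OF x y])
       (auto intro!: sm_mult sm_const sm_prod M sum.cong simp: pd_cmult[OF x y sm_prod[OF M]] pd_prod[OF _ x y M] A'_def)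
  also have "\<dots> = (\<Sum>i\<in>UNIV. \<Sum>p\<in>{p. p permutes UNIV}. of_int (sign p) * (A' $ i $ p i * (\<Prod>k\<in>UNIV - {i}. ?A $ k $ p k)))"
    unfolding sum_distrib_left by (rule sum.swap)
  also have "\<dots> = (\<Sum>i\<in>UNIV. det (\<chi> k. if k = i then A' $ i else ?A $ k))"
  proof -
    have "A' $ i $ p i * (\<Prod>k\<in>UNIV - {i}. ?A $ k $ p k) =
        (\<Prod>k\<in>UNIV. (\<chi> k. if k = i then A' $ i else ?A $ k) $ k $ p k)" for i and p :: "'m \<Rightarrow> 'm"
      by (subst prod.remove[of UNIV i]) (auto intro!: prod.cong)
    then show ?thesis unfolding det_def by simp
  qed
  also have "\<dots> = det ?A * (\<Sum>i\<in>UNIV. B $ i $ i)"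
    by (simp add: row sum_distrib_left mult.commute)
  finally show ?thesis
    by (simp add: B_def A'_def matrix_matrix_mult_def)
qed

end

subsection \<open>Linear systems with polynomial coefficients\<close>

text \<open>A bound on the fibre degree, phrased through derivatives so that it refers to no
  particular representation by coefficients and exponents.\<close>

fun nilpotent_pd :: "(real ^ 'n::finite) set \<Rightarrow> nat \<Rightarrow> (real ^ 'n \<Rightarrow> real ^ 'n \<Rightarrow> real) \<Rightarrow> bool" where
  "nilpotent_pd U 0 p \<longleftrightarrow> (\<forall>x\<in>U. \<forall>y. p x y = 0)"
| "nilpotent_pd U (Suc d) p \<longleftrightarrow> (\<forall>m. nilpotent_pd U d (pd (ey m) p))"

locale base_domain = fixes U :: "(real ^ 'n::finite) set" assumes open_base: "open U"

sublocale base_domain \<subseteq> domain2 U UNIV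
  by unfold_locales (auto intro: open_base)

context base_domain
begin

lemma nilpotent_pd_cong:
  "nilpotent_pd U d p \<Longrightarrow> (\<And>x y. x \<in> U \<Longrightarrow> p x y = q x y) \<Longrightarrow> nilpotent_pd U d q"
proof (induction d arbitrary: p q)
  case (Suc d)
  have "nilpotent_pd U d (pd (ey m) q)" for m
  proof (rule Suc.IH)
    show "nilpotent_pd U d (pd (ey m) p)" using Suc.prems(1) by simp
    show "pd (ey m) p x y = pd (ey m) q x y" if "x \<in> U" for x y
      by (rule pd_cong) (use Suc.prems(2) that in auto)
  qed
  then show ?case by simp
qed simp

lemma nilpotent_pd_Suc: "nilpotent_pd U d p \<Longrightarrow> nilpotent_pd U (Suc d) p"
proof (induction d arbitrary: p)
  case 0
  have "pd (ey m) p x y = 0" if "x \<in> U" for m x y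
  proof -
    have "pd (ey m) p x y = pd (ey m) (\<lambda>x y. 0) x y"
      by (rule pd_cong) (use 0 that in auto)
    then show ?thesis by (simp add: pd_const)
  qed
  then show ?case by simp
qed simp

lemma nilpotent_pd_mono: "d \<le> d' \<Longrightarrow> nilpotent_pd U d p \<Longrightarrow> nilpotent_pd U d' p"
  by (induction d' rule: dec_induct) (auto intro: nilpotent_pd_Suc simp del: nilpotent_pd.simps)

lemma nilpotent_pd_add:
  "sm p \<Longrightarrow> sm q \<Longrightarrow> nilpotent_pd U d p \<Longrightarrow> nilpotent_pd U d q \<Longrightarrow> nilpotent_pd U d (\<lambda>x y. p x y + q x y)"
proof (induction d arbitrary: p q)
  case (Suc d)
  have "nilpotent_pd U d (pd (ey m) (\<lambda>x y. p x y + q x y))" for m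
  proof (rule nilpotent_pd_cong)
    show "nilpotent_pd U d (\<lambda>x y. pd (ey m) p x y + pd (ey m) q x y)"
      by (rule Suc.IH) (use Suc.prems in \<open>simp_all add: sm_pd\<close>)
  qed (simp add: pd_add Suc.prems)
  then show ?case by simp
qed simp

text \<open>By induction on a + b: each term of the product rule lowers one of the two orders. The
  bound need not be sharp; its finiteness is what counts.\<close>

lemma nilpotent_pd_mult:
  "sm p \<Longrightarrow> sm q \<Longrightarrow> nilpotent_pd U a p \<Longrightarrow> nilpotent_pd U b q \<Longrightarrow>
   nilpotent_pd U (a + b) (\<lambda>x y. p x y * q x y)"
proof (induction "a + b" arbitrary: a b p q rule: less_induct)
  case less
  show ?case
  proof (cases "a = 0 \<or> b = 0")
    case True
    then have "nilpotent_pd U 0 (\<lambda>x y. p x y * q x y)" using less.prems by auto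
    then show ?thesis using nilpotent_pd_mono[of 0] by blast
  next
    case False
    then obtain a' b' where ab: "a = Suc a'" "b = Suc b'" by (metis not0_implies_Suc)
    have "nilpotent_pd U (a' + b) (pd (ey m) (\<lambda>x y. p x y * q x y))" for m
    proof (rule nilpotent_pd_cong)
      have 1: "nilpotent_pd U (a' + b) (\<lambda>x y. pd (ey m) p x y * q x y)"
        by (rule less.hyps) (use less.prems ab in \<open>simp_all add: sm_pd\<close>)
      have "nilpotent_pd U (a + b') (\<lambda>x y. p x y * pd (ey m) q x y)"
        by (rule less.hyps) (use less.prems ab in \<open>simp_all add: sm_pd\<close>)
      then have 2: "nilpotent_pd U (a' + b) (\<lambda>x y. p x y * pd (ey m) q x y)" by (simp add: ab)
      show "nilpotent_pd U (a' + b) (\<lambda>x y. pd (ey m) p x y * q x y + p x y * pd (ey m) q x y)"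
        by (rule nilpotent_pd_add[OF sm_mult sm_mult 1 2]) (simp_all add: sm_pd less.prems)
    qed (simp add: pd_mult less.prems)
    then show ?thesis by (simp add: ab)
  qed
qed

lemma polynomial_nilpotent_pd:
  assumes "polynomial_in_y U p"
  shows "\<exists>d. nilpotent_pd U d p"
proof -
  have "sm p \<and> (\<exists>d. nilpotent_pd U d p)"
    using assms
  proof (induction rule: polynomial_in_y_induct)
    case (coeff C)
    have "nilpotent_pd U 1 (\<lambda>x y. C x)" by (simp add: pd_ey_const)
    then show ?case using sm_fst[OF coeff] by blast
  next
    case (coord k)
    have "pd (ey m) (\<lambda>x y. y $ k) = (\<lambda>x y. axis m 1 $ k)" for m
      by (simp add: fun_eq_iff pd_coord)
    then have "nilpotent_pd U 2 (\<lambda>x y. y $ k)" by (simp add: numeral_2_eq_2 pd_const)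
    then show ?case using sm_coord by blast
  next
    case (add p q)
    then obtain a b where "nilpotent_pd U a p" "nilpotent_pd U b q" by blast
    then have "nilpotent_pd U (max a b) p" "nilpotent_pd U (max a b) q"
      by (auto intro: nilpotent_pd_mono[rotated])
    then show ?case using add nilpotent_pd_add sm_add by blast
  next
    case (mult p q)
    then show ?case using nilpotent_pd_mult sm_mult by blast
  next
    case (cong p q)
    obtain d where "nilpotent_pd U d p" using cong.IH by blast
    then have "nilpotent_pd U d q" by (rule nilpotent_pd_cong) (rule cong.hyps)
    moreover have "sm q" by (rule sm_cong[OF cong.hyps conjunct1[OF cong.IH]])
    ultimately show ?case by blast
  qed
  then show ?thesis by blast
qed

text \<open>The bound on the orders of the derivatives does not depend on the base point.\<close>

lemma nilpotent_pd_vanish: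
  assumes "nilpotent_pd U d q" "sm q" "x \<in> U" "\<And>ms. length ms \<le> d \<Longrightarrow> foldr (\<lambda>m. pd (ey m)) ms q x y0 = 0"
  shows "q x y = 0"
  using assms
proof (induction d arbitrary: q y)
  case (Suc d)
  have "pd (ey m) q x y = 0" for m y
  proof (rule Suc.IH)
    \<comment> \<open>\<open>foldr\<close> applies the last entry of the list first, so the
      derivative already taken is appended at the end.\<close>
    show "foldr (\<lambda>m. pd (ey m)) ms (pd (ey m) q) x y0 = 0" if "length ms \<le> d" for ms
      using Suc.prems(4)[of "ms @ [m]"] that by simp
  qed (use Suc.prems in \<open>simp_all add: sm_pd\<close>)
  then have "((\<lambda>y. q x y) has_derivative (\<lambda>v. 0)) (at y within UNIV)" for y
    using fibre_has_derivative[OF Suc.prems(3) UNIV_I Suc.prems(2), of y]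
    by (simp add: zero_vec_def[symmetric])
  then obtain c where "\<And>y. q x y = c"
    using has_derivative_zero_constant[of UNIV "\<lambda>y. q x y"] by auto
  then show ?case using Suc.prems(4)[of "[]"] by simp
qed simp

lemma sm_foldr_pd: "sm q \<Longrightarrow> sm (foldr (\<lambda>m. pd (ey m)) ms q)"
  by (induction ms) (simp_all add: sm_pd)

lemma foldr_pd_linear:
  assumes "\<And>l. sm (p l)" "x \<in> U"
  shows "foldr (\<lambda>m. pd (ey m)) ms (\<lambda>x y. \<Sum>l\<in>UNIV. h $ l * p l x y) x y =
    (\<Sum>l\<in>UNIV. h $ l * foldr (\<lambda>m. pd (ey m)) ms (p l) x y)"
  using assms(2)
proof (induction ms arbitrary: x y)
  case (Cons m ms)
  have "pd (ey m) (foldr (\<lambda>m. pd (ey m)) ms (\<lambda>x y. \<Sum>l\<in>UNIV. h $ l * p l x y)) x y =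
      pd (ey m) (\<lambda>x y. \<Sum>l\<in>UNIV. h $ l * foldr (\<lambda>m. pd (ey m)) ms (p l) x y) x y"
    by (rule pd_cong) (use Cons in auto)
  also have "\<dots> = (\<Sum>l\<in>UNIV. h $ l * pd (ey m) (foldr (\<lambda>m. pd (ey m)) ms (p l)) x y)"
    using Cons.prems by (simp add: pd_sum pd_cmult sm_mult sm_const sm_foldr_pd assms(1))
  finally show ?case by simp
qed simp

lemma polynomial_foldr_pd: "polynomial_in_y U p \<Longrightarrow> polynomial_in_y U (foldr (\<lambda>m. pd (ey m)) ms p)"
  by (induction ms) (simp_all add: polynomial_in_y_pd open_base)

end

context slit
begin

text \<open>Differentiating a relation \<open>\<Sum> P\<^sub>l \<Psi>\<^sub>l = R\<close> with rational \<open>R\<close> and rational fibre derivatives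
  of \<open>\<Psi>\<^sub>l\<close> produces further such relations. The normal equations of all of them are solved by
  Cramer's rule.\<close>

lemma rational_system_poly:
  fixes P :: "'t \<Rightarrow> 'n \<Rightarrow> real ^ 'n \<Rightarrow> real ^ 'n \<Rightarrow> real"
  assumes T: "finite T" and P: "\<And>t l. t \<in> T \<Longrightarrow> polynomial_in_y U (P t l)"
    and \<Psi>: "\<And>l. sm (\<Psi> l)" "\<And>l m. rat (pd (ey m) (\<Psi> l))"
    and R: "\<And>t. t \<in> T \<Longrightarrow> rat (\<lambda>x y. \<Sum>l\<in>UNIV. P t l x y * \<Psi> l x y)"
  obtains \<Delta> N where "rat \<Delta>" "\<And>l. rat (N l)"
    "\<And>x y l. x \<in> U \<Longrightarrow> y \<noteq> 0 \<Longrightarrow> \<Delta> x y * \<Psi> l x y = N l x y"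
    "\<And>x y. x \<in> U \<Longrightarrow> (\<And>h. (\<And>t y. t \<in> T \<Longrightarrow> (\<Sum>l\<in>UNIV. h $ l * P t l x y) = 0) \<Longrightarrow> h = 0) \<Longrightarrow>
       y \<noteq> 0 \<Longrightarrow> \<Delta> x y \<noteq> 0"
proof -
  interpret B: base_domain U by unfold_locales (rule open_dom)
  have "\<exists>d. \<forall>l. nilpotent_pd U d (P t l)" if "t \<in> T" for t
  proof -
    have "\<forall>l. \<exists>d. nilpotent_pd U d (P t l)" using B.polynomial_nilpotent_pd P that by blast
    then obtain d where d: "\<And>l. nilpotent_pd U (d l) (P t l)" by metis
    have "nilpotent_pd U (\<Sum>l\<in>UNIV. d l) (P t l)" for l
      by (rule B.nilpotent_pd_mono[OF _ d]) (simp add: member_le_sum)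
    then show ?thesis by blast
  qed
  then obtain d where d: "\<And>t l. t \<in> T \<Longrightarrow> nilpotent_pd U (d t) (P t l)" by metis
  define K where "K = (\<Sum>t\<in>T. d t)"
  have K: "nilpotent_pd U K (P t l)" if "t \<in> T" for t l
    by (rule B.nilpotent_pd_mono[OF _ d[OF that]]) (simp add: K_def member_le_sum T that)
  \<comment> \<open>One row for each equation and each iterated fibre derivative of order at most K,
    where K bounds the fibre degrees of all coefficients.\<close>
  define J where "J = T \<times> {ms :: 'n list. set ms \<subseteq> UNIV \<and> length ms \<le> K}"
  have J: "finite J" unfolding J_def by (intro finite_cartesian_product T finite_lists_length_le) simp
  define W where "W j l = foldr (\<lambda>m. pd (ey m)) (snd j) (P (fst j) l)" for j l
  have Wpoly: "polynomial_in_y U (W j l)" if "j \<in> J" for j l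
    using that P B.polynomial_foldr_pd by (auto simp: W_def J_def)
  define r where "r j = (\<lambda>x y. \<Sum>l\<in>UNIV. W j l x y * \<Psi> l x y)" for j
  have r: "rat (r j)" if "j \<in> J" for j
  proof -
    have "rat (\<lambda>x y. \<Sum>l\<in>UNIV. foldr (\<lambda>m. pd (ey m)) ms (P t l) x y * \<Psi> l x y)" if t: "t \<in> T" for t ms
    proof (induction ms)
      case Nil
      then show ?case using R[OF t] by simp
    next
      case (Cons m ms)
      let ?p = "\<lambda>l. foldr (\<lambda>m. pd (ey m)) ms (P t l)"
      have p: "polynomial_in_y U (?p l)" for l using P[OF t] by (rule B.polynomial_foldr_pd)
      have "rat (\<lambda>x y. pd (ey m) (\<lambda>x y. \<Sum>l\<in>UNIV. ?p l x y * \<Psi> l x y) x y -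
          (\<Sum>l\<in>UNIV. ?p l x y * pd (ey m) (\<Psi> l) x y))"
        by (intro rat_diff rat_pd Cons.IH rat_sum rat_mult rat_poly p \<Psi>)
      then show ?case
        by (rule rat_cong) (simp add: pd_sum pd_mult sm_mult polynomial_sm[OF p] \<Psi>(1) sum.distrib)
    qed
    then show ?thesis using that by (auto simp: J_def r_def W_def)
  qed
  \<comment> \<open>The Gram matrix of the rows: square however many equations there are, and
    singular exactly where some h \<noteq> 0 annihilates every row.\<close>
  define M where "M x y = (\<chi> k l. \<Sum>j\<in>J. W j k x y * W j l x y)" for x y
  define b where "b x y = (\<chi> k. \<Sum>j\<in>J. W j k x y * r j x y)" for x y
  have Mb: "M x y *v (\<chi> l. \<Psi> l x y) = b x y" for x y
  proof -
    have "(\<Sum>l\<in>UNIV. (\<Sum>j\<in>J. W j k x y * W j l x y) * \<Psi> l x y) = (\<Sum>j\<in>J. W j k x y * r j x y)" for k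
      unfolding r_def sum_distrib_left sum_distrib_right
      by (subst sum.swap) (simp add: mult.assoc)
    then show ?thesis by (simp add: vec_eq_iff M_def b_def matrix_vector_mult_def)
  qed
  define N where "N l x y = det (\<chi> i j. if j = l then b x y $ i else M x y $ i $ j)" for l x y
  have Mr: "rat (\<lambda>x y. M x y $ i $ j)" for i j
    by (simp add: M_def) (intro rat_sum rat_mult rat_poly Wpoly)
  have br: "rat (\<lambda>x y. b x y $ i)" for i
    by (simp add: b_def) (intro rat_sum rat_mult rat_poly Wpoly r)
  show ?thesis
  proof
    show "rat (\<lambda>x y. det (M x y))" by (rule rat_det[OF Mr])
    show "rat (N l)" for l unfolding N_def
    proof (rule rat_det)
      show "rat (\<lambda>x y. (\<chi> i j. if j = l then b x y $ i else M x y $ i $ j) $ i $ j)" for i j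
        by (cases "j = l") (simp_all add: Mr br)
    qed
    show "det (M x y) * \<Psi> l x y = N l x y" for x y l
      using cramer_lemma[of l "M x y" "\<chi> l. \<Psi> l x y"] unfolding Mb N_def by (simp add: mult.commute)
    show "det (M x y) \<noteq> 0" if x: "x \<in> U" and "y \<noteq> 0"
      and h0: "\<And>h. (\<And>t y. t \<in> T \<Longrightarrow> (\<Sum>l\<in>UNIV. h $ l * P t l x y) = 0) \<Longrightarrow> h = 0" for x y
    proof
      assume "det (M x y) = 0"
      then obtain h where h: "h \<noteq> 0" "M x y *v h = 0"
        using invertible_det_nz[of "M x y"] matrix_left_invertible_ker[of "M x y"]
        by (auto simp: invertible_left_inverse)
      have "(\<Sum>j\<in>J. (\<Sum>l\<in>UNIV. h $ l * W j l x y)\<^sup>2) = h \<bullet> (M x y *v h)"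
      proof -
        have "h \<bullet> (M x y *v h) = (\<Sum>k\<in>UNIV. \<Sum>l\<in>UNIV. \<Sum>j\<in>J. h $ k * W j k x y * (h $ l * W j l x y))"
          by (simp add: inner_vec_def matrix_vector_mult_def M_def sum_distrib_left sum_distrib_right mult_ac)
        also have "\<dots> = (\<Sum>k\<in>UNIV. \<Sum>j\<in>J. \<Sum>l\<in>UNIV. h $ k * W j k x y * (h $ l * W j l x y))"
          by (intro sum.cong refl sum.swap)
        also have "\<dots> = (\<Sum>j\<in>J. \<Sum>k\<in>UNIV. \<Sum>l\<in>UNIV. h $ k * W j k x y * (h $ l * W j l x y))"
          by (rule sum.swap)
        finally show ?thesis by (simp add: power2_eq_square sum_product)
      qed
      then have "(\<Sum>j\<in>J. (\<Sum>l\<in>UNIV. h $ l * W j l x y)\<^sup>2) = 0" using h(2) by simp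
      then have W0: "(\<Sum>l\<in>UNIV. h $ l * W j l x y) = 0" if "j \<in> J" for j
        using that J by (subst (asm) sum_nonneg_eq_0_iff) auto
      have "(\<Sum>l\<in>UNIV. h $ l * P t l x y') = 0" if t: "t \<in> T" for t y'
      proof -
        have sm: "B.sm (P t l)" for l by (rule B.polynomial_sm[OF P[OF t]])
        have n: "nilpotent_pd U K (\<lambda>x y. \<Sum>l\<in>L. h $ l * P t l x y) \<and> B.sm (\<lambda>x y. \<Sum>l\<in>L. h $ l * P t l x y)"
          if "finite L" for L using that
        proof (induction L rule: finite_induct)
          case empty
          have "nilpotent_pd U 0 (\<lambda>x y. \<Sum>l\<in>{}. h $ l * P t l x y)" by simp
          then have "nilpotent_pd U K (\<lambda>x y. \<Sum>l\<in>{}. h $ l * P t l x y)"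
            by (rule B.nilpotent_pd_mono[rotated]) simp
          then show ?case using B.sm_const[of 0] by simp
        next
          case (insert a L)
          have "nilpotent_pd U (0 + K) (\<lambda>x y. h $ a * P t a x y)"
          proof (cases "K = 0")
            case True
            then show ?thesis using K[OF t, of a] by simp
          next
            case False
            have "nilpotent_pd U k (\<lambda>x y. h $ a * p x y)" if "B.sm p" "nilpotent_pd U k p" for k p
              using that
            proof (induction k arbitrary: p)
              case (Suc k)
              have "nilpotent_pd U k (pd (ey m) (\<lambda>x y. h $ a * p x y))" for m
              proof (rule B.nilpotent_pd_cong)
                show "nilpotent_pd U k (\<lambda>x y. h $ a * pd (ey m) p x y)"
                  by (rule Suc.IH) (use Suc.prems in \<open>simp_all add: B.sm_pd\<close>)
              qed (simp add: B.pd_cmult Suc.prems)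
              then show ?case by simp
            qed simp
            from this[OF sm K[OF t]] show ?thesis by simp
          qed
          then have "nilpotent_pd U K (\<lambda>x y. h $ a * P t a x y + (\<Sum>l\<in>L. h $ l * P t l x y))"
            using insert.IH by (intro B.nilpotent_pd_add B.sm_mult B.sm_const sm) auto
          moreover have "B.sm (\<lambda>x y. h $ a * P t a x y + (\<Sum>l\<in>L. h $ l * P t l x y))"
            using insert.IH by (intro B.sm_add B.sm_mult B.sm_const sm) auto
          ultimately show ?case using insert.hyps by simp
        qed
        show ?thesis
        \<comment> \<open>The derivatives up to order K at the single direction y determine the
          combination on the whole fibre, so a singular matrix at one y contradicts the independence
          assumed along the fibre.\<close>
        proof (rule B.nilpotent_pd_vanish[where q = "\<lambda>x y. \<Sum>l\<in>UNIV. h $ l * P t l x y" and d = K and ?y0.0 = y])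
          show "foldr (\<lambda>m. pd (ey m)) ms (\<lambda>x y. \<Sum>l\<in>UNIV. h $ l * P t l x y) x y = 0" if "length ms \<le> K" for ms
            using W0[of "(t, ms)"] t that x by (simp add: B.foldr_pd_linear[OF sm] W_def J_def)
        qed (use n[of UNIV] x in auto)
      qed
      then have "h = 0" using h0 by blast
      with h(1) show False by simp
    qed
  qed
qed

text \<open>Each equation is multiplied by the product of all its denominators. One factor without
  zeros per equation, common to all l, preserves which constant combinations of the coefficients
  vanish.\<close>

lemma rational_system:
  fixes C :: "'t \<Rightarrow> 'n \<Rightarrow> real ^ 'n \<Rightarrow> real ^ 'n \<Rightarrow> real"
  assumes T: "finite T" and C: "\<And>t l. t \<in> T \<Longrightarrow> rat (C t l)"
    and \<Psi>: "\<And>l. sm (\<Psi> l)" "\<And>l m. rat (pd (ey m) (\<Psi> l))"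
    and R: "\<And>t. t \<in> T \<Longrightarrow> rat (\<lambda>x y. \<Sum>l\<in>UNIV. C t l x y * \<Psi> l x y)"
  obtains \<Delta> N where "rat \<Delta>" "\<And>l. rat (N l)"
    "\<And>x y l. x \<in> U \<Longrightarrow> y \<noteq> 0 \<Longrightarrow> \<Delta> x y * \<Psi> l x y = N l x y"
    "\<And>x y. x \<in> U \<Longrightarrow> (\<And>h. (\<And>t y. t \<in> T \<Longrightarrow> y \<noteq> 0 \<Longrightarrow> (\<Sum>l\<in>UNIV. h $ l * C t l x y) = 0) \<Longrightarrow> h = 0) \<Longrightarrow>
       y \<noteq> 0 \<Longrightarrow> \<Delta> x y \<noteq> 0"
proof -
  have "\<forall>t l. \<exists>P Q. t \<in> T \<longrightarrow> polynomial_in_y U P \<and> polynomial_in_y U Q \<and>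
      (\<forall>x\<in>U. \<forall>y. y \<noteq> 0 \<longrightarrow> Q x y \<noteq> 0 \<and> C t l x y = P x y / Q x y)"
    using C unfolding rational_in_y_def by blast
  then obtain P Q where PQ: "\<And>t l. t \<in> T \<Longrightarrow> polynomial_in_y U (P t l)"
    "\<And>t l. t \<in> T \<Longrightarrow> polynomial_in_y U (Q t l)"
    "\<And>t l x y. t \<in> T \<Longrightarrow> x \<in> U \<Longrightarrow> y \<noteq> 0 \<Longrightarrow> Q t l x y \<noteq> 0 \<and> C t l x y = P t l x y / Q t l x y"
    by metis
  define P' where "P' t l x y = P t l x y * (\<Prod>k\<in>UNIV - {l}. Q t k x y)" for t l x y
  have P'C: "P' t l x y = (\<Prod>k\<in>UNIV. Q t k x y) * C t l x y" if "t \<in> T" "x \<in> U" "y \<noteq> 0" for t l x y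
    using PQ(3)[OF that] by (simp add: P'_def prod.remove[of UNIV l])
  have nz: "(\<Prod>k\<in>UNIV. Q t k x y) \<noteq> 0" if "t \<in> T" "x \<in> U" "y \<noteq> 0" for t x y
    using PQ(3)[OF that] by simp
  have P': "polynomial_in_y U (P' t l)" if "t \<in> T" for t l
    unfolding P'_def by (intro polynomial_in_y_mult polynomial_in_y_prod open_dom PQ that)
  have R': "rat (\<lambda>x y. \<Sum>l\<in>UNIV. P' t l x y * \<Psi> l x y)" if "t \<in> T" for t
  proof -
    have "rat (\<lambda>x y. (\<Prod>k\<in>UNIV. Q t k x y) * (\<Sum>l\<in>UNIV. C t l x y * \<Psi> l x y))"
      by (intro rat_mult rat_prod rat_poly PQ R that)
    then show ?thesis by (rule rat_cong) (simp add: P'C[OF that] sum_distrib_left mult_ac)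
  qed
  show ?thesis
  proof (rule rational_system_poly[OF T P' \<Psi> R'])
    fix \<Delta> N assume 1: "rat \<Delta>" "\<And>l. rat (N l)"
      "\<And>x y l. x \<in> U \<Longrightarrow> y \<noteq> 0 \<Longrightarrow> \<Delta> x y * \<Psi> l x y = N l x y"
    assume nzD: "\<And>x y. x \<in> U \<Longrightarrow> (\<And>h. (\<And>t y. t \<in> T \<Longrightarrow> (\<Sum>l\<in>UNIV. h $ l * P' t l x y) = 0) \<Longrightarrow> h = 0) \<Longrightarrow>
       y \<noteq> 0 \<Longrightarrow> \<Delta> x y \<noteq> 0"
  have nz': "\<Delta> x y \<noteq> 0" if x: "x \<in> U"
    and h: "\<And>h. (\<And>t y. t \<in> T \<Longrightarrow> y \<noteq> 0 \<Longrightarrow> (\<Sum>l\<in>UNIV. h $ l * C t l x y) = 0) \<Longrightarrow> h = 0" and y: "y \<noteq> 0" for x y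
  proof (rule nzD[OF x _ y], rule h)
    fix h t and y :: "real ^ 'n" assume 0: "\<And>t y. t \<in> T \<Longrightarrow> (\<Sum>l\<in>UNIV. h $ l * P' t l x y) = 0" and t: "t \<in> T" and y: "y \<noteq> 0"
    have "(\<Prod>k\<in>UNIV. Q t k x y) * (\<Sum>l\<in>UNIV. h $ l * C t l x y) = (\<Sum>l\<in>UNIV. h $ l * P' t l x y)"
      by (simp add: P'C[OF t x y] sum_distrib_left mult_ac)
    then show "(\<Sum>l\<in>UNIV. h $ l * C t l x y) = 0" using 0[OF t] nz[OF t x y] by simp
  qed
    show ?thesis by (rule that[OF 1]) (use nz' in blast)+
  qed
qed

end

subsection \<open>Rationality from restrictions to lines\<close>

text \<open>Let a prime p divide d exactly k times and n exactly m < k times. Then n / d has a pole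
  of order k - m at p, and its derivative has one of order k - m + 1, as the characteristic is zero
  and p does not divide its own derivative. The hypothesis says that q clears the poles of the
  derivative, so it clears those of n / d. The polynomials n and d may have common factors.\<close>

lemma dvd_of_rational_derivative:
  fixes n d q r :: "real poly"
  assumes d: "d \<noteq> 0" and q: "q \<noteq> 0"
    and eq: "(pderiv n * d - n * pderiv d) * q = r * d\<^sup>2"
  shows "d dvd n * q"
proof (cases "n = 0")
  case False
  show ?thesis
  proof (rule multiplicity_le_imp_dvd[OF d])
    fix p :: "real poly" assume p: "prime p"
    then have pe: "prime_elem p" by simp
    define m where "m = multiplicity p n"
    define k where "k = multiplicity p d"
    have pu: "\<not> is_unit p" using p by (simp add: not_prime_unit)
    obtain f where f: "n = p ^ m * f" "\<not> p dvd f"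
      using multiplicity_decompose'[OF False pu] unfolding m_def by metis
    obtain e where e: "d = p ^ k * e" "\<not> p dvd e"
      using multiplicity_decompose'[OF d pu] unfolding k_def by metis
    have mq: "multiplicity p (n * q) = m + multiplicity p q"
      using False q pe by (simp add: prime_elem_multiplicity_mult_distrib m_def)
    show "multiplicity p d \<le> multiplicity p (n * q)"
    proof (cases "k \<le> m")
      case True
      then show ?thesis using mq by (simp add: k_def)
    next
      case km: False
      have p0: "p \<noteq> 0" using p by auto
      have dp: "degree p > 0" using pu p0 by (simp add: is_unit_iff_degree)
      then have p'0: "pderiv p \<noteq> 0" by (simp add: pderiv_eq_0_iff)
      have p': "\<not> p dvd pderiv p"
        using dvd_imp_degree_le[OF _ p'0, of p] degree_pderiv[of p] dp by force
      \<comment> \<open>The extra factor p avoids the exponent j - 1, which would be truncated at j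
        = 0.\<close>
      have pp: "p * pderiv (p ^ j) = of_nat j * p ^ j * pderiv p" for j
      proof (induction j)
        case (Suc j)
        have "p * pderiv (p ^ Suc j) = p * (p * pderiv (p ^ j)) + p * p ^ j * pderiv p"
          by (simp add: pderiv_mult algebra_simps)
        also have "\<dots> = of_nat (Suc j) * p ^ Suc j * pderiv p"
          unfolding Suc.IH by (simp add: algebra_simps)
        finally show ?case .
      qed simp
      \<comment> \<open>What is left of p times the numerator of the derivative once p^(m + k) is
        taken out. The first summand is divisible by p; the second is not, because m \<noteq>
        k.\<close>
      define B where "B = p * (pderiv f * e - f * pderiv e) + (of_nat m - of_nat k) * (pderiv p * (f * e))"
      have "p * (pderiv n * d - n * pderiv d) =
          (p * pderiv (p ^ m)) * f * d + p ^ m * p * pderiv f * d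
          - n * (p * pderiv (p ^ k)) * e - n * p ^ k * p * pderiv e"
        unfolding f(1) e(1) by (simp add: pderiv_mult algebra_simps)
      also have "\<dots> = p ^ (m + k) * B"
        unfolding pp B_def f(1) e(1) by (simp add: algebra_simps power_add)
      finally have pB: "p * (pderiv n * d - n * pderiv d) = p ^ (m + k) * B" .
      have B: "\<not> p dvd B"
      proof
        assume "p dvd B"
        then have "p dvd (of_nat m - of_nat k) * (pderiv p * (f * e))"
          unfolding B_def by (metis dvd_add_right_iff dvd_triv_left)
        then have "p dvd of_nat m - of_nat k"
          using pe p' f(2) e(2) by (simp add: prime_elem_dvd_mult_iff)
        moreover have "(of_nat m - of_nat k :: real poly) = [: real m - real k :]"
          by (simp add: of_nat_poly)
        moreover have "is_unit [: real m - real k :]" using km by (simp add: is_unit_const_poly_iff dvd_field_iff)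
        ultimately show False using pu dvd_trans by metis
      qed
      then have B0: "B \<noteq> 0" by auto
      have "p ^ (m + k) * B * q = p * (r * d\<^sup>2)"
        using eq unfolding pB[symmetric] by (simp add: mult.assoc)
      also have "\<dots> = p ^ (2 * k + 1) * (r * e\<^sup>2)"
        unfolding e(1) power2_eq_square mult_2 power_add by (simp add: mult_ac)
      finally have "p ^ (2 * k + 1) dvd p ^ (m + k) * B * q" by simp
      then have "2 * k + 1 \<le> multiplicity p (p ^ (m + k) * B * q)"
        using p0 B0 q pu by (intro multiplicity_geI) auto
      also have "\<dots> = m + k + multiplicity p q"
        using p0 B0 q pe pu B
        by (simp add: prime_elem_multiplicity_mult_distrib multiplicity_same_power not_dvd_imp_multiplicity_0)
      finally show ?thesis using mq by (simp add: k_def)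
    qed
  qed
qed simp

text \<open>The K + 1 nodes start at 1: a vector with a coordinate at a node is then nonzero, which
  keeps the interpolation inside the punctured fibre.\<close>

definition lagrange_basis :: "nat \<Rightarrow> nat \<Rightarrow> real poly" where
  "lagrange_basis K k = (\<Prod>j\<in>{1..Suc K} - {k}. smult (1 / (real k - real j)) [:- real j, 1:])"

lemma lagrange_interpolation:
  assumes "degree u \<le> K"
  shows "poly u t = (\<Sum>k\<in>{1..Suc K}. poly u (real k) * poly (lagrange_basis K k) t)"
proof -
  define P where "P = (\<Sum>k\<in>{1..Suc K}. smult (poly u (real k)) (lagrange_basis K k))"
  have L: "poly (lagrange_basis K k) (real i) = (if i = k then 1 else 0)"
    if "k \<in> {1..Suc K}" "i \<in> {1..Suc K}" for k i
  proof (cases "i = k")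
    case True
    have "poly (smult (1 / (real k - real j)) [:- real j, 1:]) (real k) = 1" if "j \<noteq> k" for j
      using that by (simp add: diff_divide_distrib[symmetric])
    then show ?thesis using True by (simp add: lagrange_basis_def poly_prod)
  next
    case False
    then show ?thesis using that by (auto simp: lagrange_basis_def poly_prod)
  qed
  have "degree (lagrange_basis K k) \<le> K" if "k \<in> {1..Suc K}" for k
  proof -
    have "degree (lagrange_basis K k) \<le> (\<Sum>j\<in>{1..Suc K} - {k}. degree (smult (1 / (real k - real j)) [:- real j, 1:]))"
      unfolding lagrange_basis_def by (rule order_trans[OF degree_prod_sum_le]) simp_all
    also have "\<dots> \<le> (\<Sum>j\<in>{1..Suc K} - {k}. 1)" by (intro sum_mono) simp
    also have "\<dots> = K" using that by simp
    finally show ?thesis .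
  qed
  then have "degree P \<le> K"
    unfolding P_def by (intro degree_sum_le order_trans[OF degree_smult_le]) auto
  have "u = P"
  proof (rule poly_eqI_degree)
    fix z assume "z \<in> real ` {1..Suc K}"
    then obtain i where i: "z = real i" "i \<in> {1..Suc K}" by blast
    have "poly P z = (\<Sum>k\<in>{1..Suc K}. poly u (real k) * (if i = k then 1 else 0))"
      unfolding P_def poly_sum i(1) using i(2) by (intro sum.cong) (auto simp: L)
    also have "\<dots> = poly u (real i)"
      using i(2) by (simp add: if_distrib[of "\<lambda>x. _ * x"] cong: if_cong del: sum.cl_ivl_Suc)
    finally show "poly u z = poly P z" using i by simp
  next
    have "card (real ` {1..Suc K}) = Suc K" by (subst card_image) (auto simp: inj_on_def)
    then show "degree u < card (real ` {1..Suc K})" "degree P < card (real ` {1..Suc K})"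
      using assms \<open>degree P \<le> K\<close> by simp_all
  qed
  then have "poly u t = poly P t" by simp
  also have "\<dots> = (\<Sum>k\<in>{1..Suc K}. poly u (real k) * poly (lagrange_basis K k) t)"
    by (simp only: P_def poly_sum poly_smult)
  finally show ?thesis .
qed

definition upd :: "real ^ 'n \<Rightarrow> 'n::finite \<Rightarrow> real \<Rightarrow> real ^ 'n" where
  "upd y i t = (\<chi> j. if j = i then t else y $ j)"

lemma upd_line: "upd y i t = upd y i 0 + t *\<^sub>R axis i 1"
  by (simp add: vec_eq_iff upd_def axis_def)

text \<open>The coordinates are interpolated one after another, each along a line parallel to its
  axis. The difficulty is that f is controlled only on lines that avoid the origin.\<close>

lemma multivariate_interpolation:
  fixes f :: "real ^ 'n::finite \<Rightarrow> real"
  assumes line: "\<And>y i t. \<exists>j. j \<noteq> i \<and> y $ j \<noteq> 0 \<Longrightarrow>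
      f (upd y i t) = (\<Sum>k\<in>{1..Suc K}. f (upd y i (real k)) * poly (lagrange_basis K k) t)"
    and n: "CARD('n) \<ge> 2" and y: "y \<noteq> 0"
  shows "f y = (\<Sum>\<kappa>\<in>PiE UNIV (\<lambda>_. {1..Suc K}). f (\<chi> i. real (\<kappa> i)) *
    (\<Prod>i\<in>UNIV. poly (lagrange_basis K (\<kappa> i)) (y $ i)))"
proof -
  note [simp del] = sum.cl_ivl_Suc
  let ?N = "{1..Suc K}"
  let ?z = "\<lambda>J \<kappa>. (\<chi> j. if j \<in> J then real (\<kappa> j) else y $ j)"
  let ?C = "\<lambda>J. f y = (\<Sum>\<kappa>\<in>PiE J (\<lambda>_. ?N). f (?z J \<kappa>) * (\<Prod>i\<in>J. poly (lagrange_basis K (\<kappa> i)) (y $ i)))"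
  have step: "?C (insert a J)"
    if J: "finite J" "a \<notin> J" and C: "?C J"
      and nz: "\<And>\<kappa>. \<kappa> \<in> PiE J (\<lambda>_. ?N) \<Longrightarrow> \<exists>j. j \<noteq> a \<and> ?z J \<kappa> $ j \<noteq> 0" for a J
  proof -
    let ?g = "\<lambda>k \<kappa>. f (upd (?z J \<kappa>) a (real k)) * poly (lagrange_basis K k) (y $ a) *
        (\<Prod>i\<in>J. poly (lagrange_basis K (\<kappa> i)) (y $ i))"
    have "f (?z J \<kappa>) = (\<Sum>k\<in>?N. f (upd (?z J \<kappa>) a (real k)) * poly (lagrange_basis K k) (y $ a))"
      if "\<kappa> \<in> PiE J (\<lambda>_. ?N)" for \<kappa>
    proof -
      have "upd (?z J \<kappa>) a (y $ a) = ?z J \<kappa>" using J by (auto simp: upd_def vec_eq_iff)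
      with line[OF nz[OF that], of "y $ a"] show ?thesis by simp
    qed
    then have "f y = (\<Sum>\<kappa>\<in>PiE J (\<lambda>_. ?N). \<Sum>k\<in>?N. ?g k \<kappa>)"
      using C by (simp add: sum_distrib_right)
    also have "\<dots> = (\<Sum>k\<in>?N. \<Sum>\<kappa>\<in>PiE J (\<lambda>_. ?N). ?g k \<kappa>)" by (rule sum.swap)
    also have "\<dots> = (\<Sum>(k, \<kappa>)\<in>?N \<times> PiE J (\<lambda>_. ?N). ?g k \<kappa>)" by (rule sum.cartesian_product)
    also have "\<dots> = (\<Sum>(k, \<kappa>)\<in>?N \<times> PiE J (\<lambda>_. ?N). f (?z (insert a J) (\<kappa>(a := k))) *
        (\<Prod>i\<in>insert a J. poly (lagrange_basis K ((\<kappa>(a := k)) i)) (y $ i)))"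
    proof (rule sum.cong[OF refl], clarify)
      fix k \<kappa>
      have "upd (?z J \<kappa>) a (real k) = ?z (insert a J) (\<kappa>(a := k))"
        using J by (auto simp: upd_def vec_eq_iff)
      moreover have "(\<Prod>i\<in>J. poly (lagrange_basis K ((\<kappa>(a := k)) i)) (y $ i)) =
          (\<Prod>i\<in>J. poly (lagrange_basis K (\<kappa> i)) (y $ i))"
        using J by (intro prod.cong) auto
      ultimately show "?g k \<kappa> = f (?z (insert a J) (\<kappa>(a := k))) *
          (\<Prod>i\<in>insert a J. poly (lagrange_basis K ((\<kappa>(a := k)) i)) (y $ i))"
        using J by simp
    qed
    also have "\<dots> = (\<Sum>\<kappa>\<in>(\<lambda>(k, \<kappa>). \<kappa>(a := k)) ` (?N \<times> PiE J (\<lambda>_. ?N)). f (?z (insert a J) \<kappa>) *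
        (\<Prod>i\<in>insert a J. poly (lagrange_basis K (\<kappa> i)) (y $ i)))"
      using inj_combinator[OF J(2), of "\<lambda>_. ?N"] by (subst sum.reindex) (auto simp: case_prod_unfold)
    finally show ?thesis by (simp only: PiE_insert_eq)
  qed
  \<comment> \<open>A nonzero coordinate is kept for the end: it holds all earlier lines away from
    the origin, and on the last line the other coordinates, of which there is at least one, sit at
    positive nodes.\<close>
  obtain a where a: "y $ a \<noteq> 0" using y by (auto simp: vec_eq_iff)
  have "?C J" if "finite J" "a \<notin> J" for J
    using that
  proof (induction J rule: finite_induct)
    case empty
    then show ?case by simp
  next
    case (insert b J)
    then show ?case using a by (intro step) auto
  qed
  from this[of "UNIV - {a}"] have C: "?C (UNIV - {a})" by simp
  have CU: "?C (insert a (UNIV - {a}))"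
  proof (rule step[OF _ _ C])
    fix \<kappa> assume \<kappa>: "\<kappa> \<in> PiE (UNIV - {a}) (\<lambda>_. ?N)"
    have "UNIV \<noteq> {a}" using n by (metis One_nat_def card.empty card.insert empty_iff finite.emptyI not_less_eq_eq numeral_2_eq_2 order_refl)
    then obtain j where "j \<noteq> a" by auto
    moreover have "\<kappa> j \<ge> 1" using \<kappa> \<open>j \<noteq> a\<close> by (auto simp: PiE_def Pi_def)
    ultimately show "\<exists>j. j \<noteq> a \<and> ?z (UNIV - {a}) \<kappa> $ j \<noteq> 0"
      by (intro exI[of _ j]) simp
  qed simp_all
  have UN: "insert a (UNIV - {a}) = UNIV" by auto
  show ?thesis using CU unfolding UN by (simp only: UNIV_I if_True)
qed

text \<open>What matters is that one degree bound serves all base points and all lines, so that it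
  survives a limit in the base point.\<close>

lemma polynomial_on_lines:
  assumes "polynomial_in_y U p"
  shows "\<exists>K. \<forall>x\<in>U. \<forall>y i. \<exists>u. degree u \<le> K \<and> (\<forall>t. p x (upd y i t) = poly u t)"
  using assms
proof (induction rule: polynomial_in_y_induct)
  case (coeff C)
  show ?case by (rule exI[of _ 0], intro ballI allI, rule_tac x = "[:C x:]" in exI) simp
next
  case (coord k)
  show ?case
  proof (rule exI[of _ 1], intro ballI allI)
    fix x and y :: "real ^ 'a" and i
    show "\<exists>u. degree u \<le> 1 \<and> (\<forall>t. upd y i t $ k = poly u t)"
      by (cases "i = k") (auto simp: upd_def intro: exI[of _ "[:0, 1:]"] exI[of _ "[:y $ k:]"])
  qed
next
  case (add p q)
  then obtain K L where KL:
    "\<And>x y i. x \<in> U \<Longrightarrow> \<exists>u. degree u \<le> K \<and> (\<forall>t. p x (upd y i t) = poly u t)"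
    "\<And>x y i. x \<in> U \<Longrightarrow> \<exists>u. degree u \<le> L \<and> (\<forall>t. q x (upd y i t) = poly u t)" by metis
  show ?case
  proof (rule exI[of _ "max K L"], intro ballI allI)
    fix x y i assume x: "x \<in> U"
    obtain u v where "degree u \<le> K" "\<And>t. p x (upd y i t) = poly u t"
      "degree v \<le> L" "\<And>t. q x (upd y i t) = poly v t" using KL[OF x, of y i] by metis
    then show "\<exists>u. degree u \<le> max K L \<and> (\<forall>t. p x (upd y i t) + q x (upd y i t) = poly u t)"
      by (intro exI[of _ "u + v"] conjI degree_add_le) auto
  qed
next
  case (mult p q)
  then obtain K L where KL:
    "\<And>x y i. x \<in> U \<Longrightarrow> \<exists>u. degree u \<le> K \<and> (\<forall>t. p x (upd y i t) = poly u t)"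
    "\<And>x y i. x \<in> U \<Longrightarrow> \<exists>u. degree u \<le> L \<and> (\<forall>t. q x (upd y i t) = poly u t)" by metis
  show ?case
  proof (rule exI[of _ "K + L"], intro ballI allI)
    fix x y i assume x: "x \<in> U"
    obtain u v where "degree u \<le> K" "\<And>t. p x (upd y i t) = poly u t"
      "degree v \<le> L" "\<And>t. q x (upd y i t) = poly v t" using KL[OF x, of y i] by metis
    then show "\<exists>u. degree u \<le> K + L \<and> (\<forall>t. p x (upd y i t) * q x (upd y i t) = poly u t)"
      by (intro exI[of _ "u * v"] conjI order_trans[OF degree_mult_le]) auto
  qed
next
  case (cong p q)
  then show ?case by metis
qed

lemma polynomial_in_y_poly_coord: "open U \<Longrightarrow> polynomial_in_y U (\<lambda>x y. poly u (y $ (i :: 'n::finite)))"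
proof (induction u)
  case 0
  then show ?case using polynomial_in_y_coeff[OF smooth_on_const[of U 0]] by simp
next
  case (pCons a u)
  then show ?case
    by (simp add: polynomial_in_y_add polynomial_in_y_mult polynomial_in_y_coord
        polynomial_in_y_coeff)
qed

context slit
begin

text \<open>On the lines parallel to the axes, \<open>Q \<Psi>\<close> is a polynomial of bounded degree: this is a closed
  condition on the base point, and it is checked on a dense set.\<close>

lemma rat_of_rational_derivative:
  assumes \<Psi>: "sm \<Psi>" "\<And>m. rat (pd (ey m) \<Psi>)"
    and \<Delta>: "rat \<Delta>" "rat N" "\<And>x y. x \<in> U \<Longrightarrow> y \<noteq> 0 \<Longrightarrow> \<Delta> x y * \<Psi> x y = N x y"
    and V: "V \<subseteq> U" "\<And>x y. x \<in> V \<Longrightarrow> y \<noteq> 0 \<Longrightarrow> \<Delta> x y \<noteq> 0"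
    and W: "W \<subseteq> U" "\<And>x y z. x \<in> W \<Longrightarrow> y \<noteq> 0 \<Longrightarrow> z \<noteq> 0 \<Longrightarrow> \<Psi> x y = \<Psi> x z"
    and dense: "U \<subseteq> closure (V \<union> W)" and n: "CARD('n) \<ge> 2"
  shows "rat \<Psi>"
proof -
  obtain A1 A2 where A: "polynomial_in_y U A1" "polynomial_in_y U A2"
    "\<And>x y. x \<in> U \<Longrightarrow> y \<noteq> 0 \<Longrightarrow> A2 x y \<noteq> 0 \<and> \<Delta> x y = A1 x y / A2 x y"
    using \<Delta>(1) unfolding rational_in_y_def by blast
  obtain B1 B2 where B: "polynomial_in_y U B1" "polynomial_in_y U B2"
    "\<And>x y. x \<in> U \<Longrightarrow> y \<noteq> 0 \<Longrightarrow> B2 x y \<noteq> 0 \<and> N x y = B1 x y / B2 x y"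
    using \<Delta>(2) unfolding rational_in_y_def by blast
  define a where "a x y = A1 x y * B2 x y" for x y
  define b where "b x y = B1 x y * A2 x y" for x y
  have ab: "a x y * \<Psi> x y = b x y" if "x \<in> U" "y \<noteq> 0" for x y
    using \<Delta>(3)[OF that] A(3)[OF that] B(3)[OF that] by (simp add: a_def b_def field_simps)
  have a0: "a x y \<noteq> 0" if "x \<in> V" "y \<noteq> 0" for x y
    using V that A(3)[of x y] B(3)[of x y] by (auto simp: a_def)
  have pa: "polynomial_in_y U a" "polynomial_in_y U b"
    unfolding a_def b_def using A B open_dom by (auto intro: polynomial_in_y_mult)
  have "\<forall>m. \<exists>R Q. polynomial_in_y U R \<and> polynomial_in_y U Q \<and>
      (\<forall>x\<in>U. \<forall>y. y \<noteq> 0 \<longrightarrow> Q x y \<noteq> 0 \<and> pd (ey m) \<Psi> x y = R x y / Q x y)"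
    using \<Psi>(2) unfolding rational_in_y_def by blast
  then obtain R0 Q0 where RQ: "\<And>m. polynomial_in_y U (R0 m)" "\<And>m. polynomial_in_y U (Q0 m)"
    "\<And>m x y. x \<in> U \<Longrightarrow> y \<noteq> 0 \<Longrightarrow> Q0 m x y \<noteq> 0 \<and> pd (ey m) \<Psi> x y = R0 m x y / Q0 m x y"
    by metis
  \<comment> \<open>A common denominator of all fibre derivatives of \<Psi>. It has no zeros,
    whereas a may vanish at base points outside V. The aim is to show that Q \<Psi> is a polynomial
    in y.\<close>
  define Q where "Q x y = (\<Prod>m\<in>UNIV. Q0 m x y)" for x y
  define R where "R m x y = R0 m x y * (\<Prod>k\<in>UNIV - {m}. Q0 k x y)" for m x y
  have Q0: "Q x y \<noteq> 0" if "x \<in> U" "y \<noteq> 0" for x y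
    using RQ(3)[OF that] by (simp add: Q_def)
  have QR: "Q x y * pd (ey m) \<Psi> x y = R m x y" if "x \<in> U" "y \<noteq> 0" for m x y
    using RQ(3)[OF that, of m] by (simp add: Q_def R_def prod.remove[of UNIV m])
  have pQ: "polynomial_in_y U Q" "\<And>m. polynomial_in_y U (R m)"
    unfolding Q_def R_def by (intro polynomial_in_y_mult polynomial_in_y_prod RQ open_dom)+
  obtain Ka where Ka: "\<And>x y i. x \<in> U \<Longrightarrow> \<exists>u. degree u \<le> Ka \<and> (\<forall>t. a x (upd y i t) = poly u t)"
    using polynomial_on_lines[OF pa(1)] by blast
  obtain Kb where Kb: "\<And>x y i. x \<in> U \<Longrightarrow> \<exists>u. degree u \<le> Kb \<and> (\<forall>t. b x (upd y i t) = poly u t)"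
    using polynomial_on_lines[OF pa(2)] by blast
  obtain KQ where KQ: "\<And>x y i. x \<in> U \<Longrightarrow> \<exists>u. degree u \<le> KQ \<and> (\<forall>t. Q x (upd y i t) = poly u t)"
    using polynomial_on_lines[OF pQ(1)] by blast
  have KR: "\<exists>u. \<forall>t. R m x (upd y i t) = poly u t" if "x \<in> U" for m x y i
    using polynomial_on_lines[OF pQ(2)[of m]] that by blast
  \<comment> \<open>On a line Q \<Psi> will be the quotient of nn * q by d, so its degree is bounded
    by that of nn * q, whatever d is.\<close>
  define K where "K = Kb + KQ"
  define F where "F x y = Q x y * \<Psi> x y" for x y
  have line1: "\<exists>u. degree u \<le> K \<and> (\<forall>t. F x (upd y i t) = poly u t)"
    if x: "x \<in> V \<union> W" and y: "\<exists>j. j \<noteq> i \<and> y $ j \<noteq> 0" for x y i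
  proof -
    have xU: "x \<in> U" using x V W by blast
    have y0: "upd y i t \<noteq> 0" for t using y by (auto simp: upd_def vec_eq_iff)
    obtain q where q: "degree q \<le> KQ" "\<And>t. Q x (upd y i t) = poly q t" using KQ[OF xU] by blast
    show ?thesis
    proof (cases "x \<in> W")
      case True
      then have "F x (upd y i t) = poly (smult (\<Psi> x (upd y i 0)) q) t" for t
        using W(2)[OF True y0 y0, of t 0] by (simp add: F_def q)
      moreover have "degree (smult (\<Psi> x (upd y i 0)) q) \<le> K"
        using degree_smult_le[of "\<Psi> x (upd y i 0)" q] q(1) by (simp add: K_def)
      ultimately show ?thesis by blast
    next
      case False
      then have xV: "x \<in> V" using x by simp
      obtain d where d: "\<And>t. a x (upd y i t) = poly d t" using Ka[OF xU] by blast
      obtain nn where nn: "degree nn \<le> Kb" "\<And>t. b x (upd y i t) = poly nn t" using Kb[OF xU] by blast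
      obtain r where r: "\<And>t. R i x (upd y i t) = poly r t" using KR[OF xU] by blast
      have d0: "poly d t \<noteq> 0" for t using a0[OF xV y0] d by metis
      have q0: "poly q t \<noteq> 0" for t using Q0[OF xU y0] q by metis
      have psi: "\<Psi> x (upd y i t) = poly nn t / poly d t" for t
        using ab[OF xU y0, of t] d0[of t] by (simp add: d nn(2) field_simps)
      have D1: "((\<lambda>t. \<Psi> x (upd y i t)) has_real_derivative poly r t / poly q t) (at t)" for t
      proof -
        have "((\<lambda>t. upd y i t) has_derivative (\<lambda>s. s *\<^sub>R axis i 1)) (at t)"
        proof (rule has_derivative_transform_within_open[OF _ open_UNIV UNIV_I upd_line[symmetric]])
          show "((\<lambda>t. upd y i 0 + t *\<^sub>R axis i 1) has_derivative (\<lambda>s. s *\<^sub>R axis i 1)) (at t)"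
            by (auto intro!: derivative_eq_intros)
        qed
        moreover have "((\<lambda>y. \<Psi> x y) has_derivative (\<lambda>v. (\<chi> m. pd (ey m) \<Psi> x (upd y i t)) \<bullet> v)) (at (upd y i t))"
          by (rule fibre_has_derivative[OF xU _ \<Psi>(1)]) (simp add: y0)
        ultimately have "((\<lambda>t. \<Psi> x (upd y i t)) has_derivative
            (\<lambda>s. (\<chi> m. pd (ey m) \<Psi> x (upd y i t)) \<bullet> (s *\<^sub>R axis i 1))) (at t)"
          by (rule has_derivative_compose)
        moreover have "pd (ey i) \<Psi> x (upd y i t) = poly r t / poly q t"
          using QR[OF xU y0, of t i] q0[of t] by (simp add: q r field_simps)
        ultimately show ?thesis
          by (simp add: has_field_derivative_def inner_axis mult.commute[of _ "poly r t / poly q t"]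
              del: times_divide_eq_left times_divide_eq_right)
      qed
      have "((\<lambda>t. poly nn t / poly d t) has_real_derivative
          (poly (pderiv nn) t * poly d t - poly nn t * poly (pderiv d) t) / (poly d t * poly d t)) (at t)" for t
        by (intro DERIV_divide poly_DERIV d0)
      then have E: "poly r t / poly q t =
          (poly (pderiv nn) t * poly d t - poly nn t * poly (pderiv d) t) / (poly d t * poly d t)" for t
        using DERIV_unique[OF D1[of t]] unfolding psi by blast
      have "poly ((pderiv nn * d - nn * pderiv d) * q) t = poly (r * d\<^sup>2) t" for t
        using E[of t] d0[of t] q0[of t] by (simp add: field_simps power2_eq_square)
      then have "(pderiv nn * d - nn * pderiv d) * q = r * d\<^sup>2"
        unfolding poly_eq_poly_eq_iff[symmetric] by (rule ext)
      moreover have "d \<noteq> 0" "q \<noteq> 0" using d0 q0 by auto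
      ultimately obtain u where u: "nn * q = d * u" using dvd_of_rational_derivative by blast
      have "degree u \<le> K"
      proof (cases "u = 0")
        case False
        then have "degree d + degree u = degree (nn * q)" using u \<open>d \<noteq> 0\<close> by (simp add: degree_mult_eq)
        also have "\<dots> \<le> degree nn + degree q" by (rule degree_mult_le)
        finally show ?thesis using nn(1) q(1) by (simp add: K_def)
      qed simp
      moreover have "F x (upd y i t) = poly u t" for t
      proof -
        have "poly nn t * poly q t = poly d t * poly u t" using u by (metis poly_mult)
        then show ?thesis using d0[of t] by (simp add: F_def psi q field_simps)
      qed
      ultimately show ?thesis by blast
    qed
  qed
  have Fsm: "sm F" unfolding F_def by (intro sm_mult polynomial_sm pQ \<Psi>)
  have line: "F x (upd y i t) = (\<Sum>k\<in>{1..Suc K}. F x (upd y i (real k)) * poly (lagrange_basis K k) t)"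
    if x: "x \<in> U" and y: "\<exists>j. j \<noteq> i \<and> y $ j \<noteq> 0" for x y i t
  proof (rule ccontr)
    have y0: "upd y i t \<noteq> 0" for t using y by (auto simp: upd_def vec_eq_iff)
    \<comment> \<open>For fixed y, i and t the interpolation identity is one continuous equation in
      x; the set where it fails is open and would meet the dense set on which it is already
      known.\<close>
    define G where "G x = F x (upd y i t) - (\<Sum>k\<in>{1..Suc K}. F x (upd y i (real k)) * poly (lagrange_basis K k) t)" for x
    assume "\<not> ?thesis"
    then have "G x \<noteq> 0" by (simp add: G_def)
    have "continuous_on U G"
      unfolding G_def using y0
      by (intro continuous_on_diff continuous_on_sum continuous_on_mult continuous_on_const sm_continuous_fst[OF Fsm]) auto
    then have op: "open (G -` (- {0}) \<inter> U)"
      by (simp add: continuous_on_open_vimage[OF open_dom] open_Compl)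
    have "x \<in> closure (V \<union> W)" using dense x by blast
    then have "(G -` (- {0}) \<inter> U) \<inter> closure (V \<union> W) \<noteq> {}" using \<open>G x \<noteq> 0\<close> x by blast
    then have "(G -` (- {0}) \<inter> U) \<inter> (V \<union> W) \<noteq> {}"
      using open_Int_closure_eq_empty[OF op] by blast
    then obtain x' where x': "x' \<in> V \<union> W" "G x' \<noteq> 0" by blast
    obtain u where "degree u \<le> K" "\<And>t. F x' (upd y i t) = poly u t" using line1[OF x'(1) y] by blast
    then have "G x' = 0" using lagrange_interpolation[of u K t] by (simp add: G_def)
    with x'(2) show False by simp
  qed
  \<comment> \<open>The nodal values of F are smooth in x, so the interpolant has smooth
    coefficients. The polynomials found separately over each x would not show this.\<close>
  define H where "H x y = (\<Sum>\<kappa>\<in>PiE UNIV (\<lambda>_. {1..Suc K}). F x (\<chi> i. real (\<kappa> i)) *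
    (\<Prod>i\<in>UNIV. poly (lagrange_basis K (\<kappa> i)) (y $ i)))" for x and y :: "real ^ 'n"
  have FH: "F x y = H x y" if "x \<in> U" "y \<noteq> 0" for x y
    unfolding H_def by (rule multivariate_interpolation[OF line[OF that(1)] n that(2)])
  have "polynomial_in_y U H"
    unfolding H_def
  proof (intro polynomial_in_y_sum polynomial_in_y_mult polynomial_in_y_prod open_dom polynomial_in_y_poly_coord)
    fix \<kappa> :: "'n \<Rightarrow> nat" assume "\<kappa> \<in> PiE UNIV (\<lambda>_. {1..Suc K})"
    then have "(\<chi> i. real (\<kappa> i)) \<noteq> 0" by (fastforce simp: vec_eq_iff PiE_def Pi_def)
    then show "polynomial_in_y U (\<lambda>x y. F x (\<chi> i. real (\<kappa> i)))"
      by (intro polynomial_in_y_coeff sm_slice[OF Fsm]) simp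
  qed
  then show ?thesis
    by (rule rat_divide_poly[OF _ pQ(1) Q0]) (use FH Q0 in \<open>auto simp: F_def field_simps\<close>)
qed

end

subsection \<open>Minkowski norms\<close>

text \<open>The Legendre map \<open>p\<close> of a Minkowski norm \<open>N\<close> is the gradient of \<open>N\<^sup>2/2\<close>, and \<open>G\<close> is its Jacobian.
  In the application \<open>D\<close> is \<open>ln det G\<close>.\<close>

locale minkowski =
  fixes N :: "real ^ 'n::finite \<Rightarrow> real" and p :: "real ^ 'n \<Rightarrow> real ^ 'n"
    and G :: "real ^ 'n \<Rightarrow> real ^ 'n ^ 'n"
    and D :: "real ^ 'n \<Rightarrow> real" and d :: "real ^ 'n \<Rightarrow> real ^ 'n"
  assumes N_pos: "y \<noteq> 0 \<Longrightarrow> N y > 0"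
    and N_scale: "y \<noteq> 0 \<Longrightarrow> t > 0 \<Longrightarrow> N (t *\<^sub>R y) = t * N y"
    and N_deriv: "y \<noteq> 0 \<Longrightarrow> (N has_derivative (\<lambda>v. (p y \<bullet> v) / N y)) (at y)"
    and p_deriv: "y \<noteq> 0 \<Longrightarrow> (p has_derivative (\<lambda>v. G y *v v)) (at y)"
    and p_scale: "y \<noteq> 0 \<Longrightarrow> t > 0 \<Longrightarrow> p (t *\<^sub>R y) = t *\<^sub>R p y"
    and p_self: "y \<noteq> 0 \<Longrightarrow> p y \<bullet> y = (N y)\<^sup>2"
    and G_self: "y \<noteq> 0 \<Longrightarrow> G y *v y = p y"
    and G_posdef: "y \<noteq> 0 \<Longrightarrow> sym_posdef (G y)"
    and D_deriv: "y \<noteq> 0 \<Longrightarrow> (D has_derivative (\<lambda>v. d y \<bullet> v)) (at y)"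
    and D_scale: "y \<noteq> 0 \<Longrightarrow> t > 0 \<Longrightarrow> D (t *\<^sub>R y) = D y"
    and d_self: "y \<noteq> 0 \<Longrightarrow> d y \<bullet> y = 0"
begin

lemma G_sym: "y \<noteq> 0 \<Longrightarrow> u \<bullet> (G y *v v) = (G y *v u) \<bullet> v"
  using G_posdef[of y] unfolding sym_posdef_def
  by (metis dot_lmul_matrix inner_commute matrix_transpose_mul transpose_matrix_vector)

lemma G_pos: "y \<noteq> 0 \<Longrightarrow> v \<noteq> 0 \<Longrightarrow> v \<bullet> (G y *v v) > 0"
  using G_posdef[of y] unfolding sym_posdef_def by blast

lemma G_det: "y \<noteq> 0 \<Longrightarrow> det (G y) \<noteq> 0"
  using G_pos[of y] invertible_det_nz[of "G y"] matrix_left_invertible_ker[of "G y"]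
  by (auto simp: invertible_left_inverse) (metis inner_zero_right less_irrefl)

lemma G_inv: "y \<noteq> 0 \<Longrightarrow> G y *v (matrix_inv (G y) *v v) = v"
  using matrix_inv_mult(1)[OF G_det] by (simp add: matrix_vector_mul_assoc)

lemma p_nonzero: "y \<noteq> 0 \<Longrightarrow> p y \<noteq> 0"
  using p_self[of y] N_pos[of y] by auto

text \<open>Strict convexity of N^2 / 2: along the segment from y to z the function p \<bullet> (z -
  y) has the positive derivative (z - y) \<bullet> G (z - y).\<close>

lemma p_strict_mono:
  assumes y: "y \<noteq> 0" and z: "z \<noteq> 0" and yz: "y \<noteq> z"
  shows "(p z - p y) \<bullet> (z - y) > 0"
proof (cases "\<exists>t. 0 \<le> t \<and> t \<le> 1 \<and> y + t *\<^sub>R (z - y) = 0")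
  case True
  then obtain t where t: "0 \<le> t" "t \<le> 1" "y + t *\<^sub>R (z - y) = 0" by blast
  have "t \<noteq> 0" using t(3) y by auto
  have "t \<noteq> 1" using t(3) z by auto
  \<comment> \<open>Here the segment meets the origin, where no derivative of p is available. But
    then z is a negative multiple of y, and \<open>p_self\<close> gives the inequality
    directly.\<close>
  define \<mu> where "\<mu> = (1 - t) / t"
  have \<mu>: "\<mu> > 0" using t \<open>t \<noteq> 0\<close> \<open>t \<noteq> 1\<close> by (simp add: \<mu>_def)
  have "t *\<^sub>R z + (1 - t) *\<^sub>R y = 0" using t(3) by (simp add: algebra_simps)
  then have tz: "t *\<^sub>R z = - ((1 - t) *\<^sub>R y)" by (simp add: eq_neg_iff_add_eq_0)
  have "z = (1 / t) *\<^sub>R (t *\<^sub>R z)" using \<open>t \<noteq> 0\<close> by simp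
  then have zy: "z = - \<mu> *\<^sub>R y" unfolding tz by (simp add: \<mu>_def)
  have yz: "y = - (1/\<mu>) *\<^sub>R z" using \<mu> by (simp add: zy)
  have "p z \<bullet> y = - (1/\<mu>) * (p z \<bullet> z)" by (subst yz) (simp only: inner_scaleR_right)
  moreover have "p y \<bullet> z = - \<mu> * (p y \<bullet> y)" by (simp only: zy inner_scaleR_right)
  moreover have "p z \<bullet> z > 0" "p y \<bullet> y > 0" using p_self[OF y] p_self[OF z] N_pos[OF y] N_pos[OF z] by simp_all
  moreover from this have "(1/\<mu>) * (p z \<bullet> z) > 0" "\<mu> * (p y \<bullet> y) > 0" using \<mu> by simp_all
  ultimately show ?thesis by (simp add: inner_diff_left inner_diff_right)
next
  case False
  have D: "((\<lambda>t. p (y + t *\<^sub>R (z - y)) \<bullet> (z - y)) has_real_derivative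
      (G (y + t *\<^sub>R (z - y)) *v (z - y)) \<bullet> (z - y)) (at t)" if "0 \<le> t" "t \<le> 1" for t
  proof -
    have "y + t *\<^sub>R (z - y) \<noteq> 0" using False that by blast
    then have "(p has_derivative (\<lambda>v. G (y + t *\<^sub>R (z - y)) *v v)) (at (y + t *\<^sub>R (z - y)))" by (rule p_deriv)
    moreover have "((\<lambda>t. y + t *\<^sub>R (z - y)) has_derivative (\<lambda>s. s *\<^sub>R (z - y))) (at t)"
      by (auto intro!: derivative_eq_intros)
    ultimately have "((\<lambda>t. p (y + t *\<^sub>R (z - y))) has_derivative
        (\<lambda>s. G (y + t *\<^sub>R (z - y)) *v (s *\<^sub>R (z - y)))) (at t)"
      using has_derivative_compose[of "\<lambda>t. y + t *\<^sub>R (z - y)"] by blast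
    then have "((\<lambda>t. p (y + t *\<^sub>R (z - y)) \<bullet> (z - y)) has_derivative
        (\<lambda>s. (G (y + t *\<^sub>R (z - y)) *v (s *\<^sub>R (z - y))) \<bullet> (z - y))) (at t)"
      by (rule has_derivative_inner_left)
    then show ?thesis
      unfolding has_field_derivative_def
      by (simp add: matrix_vector_mult_scaleR mult_commute_abs)
  qed
  have "p (y + 0 *\<^sub>R (z - y)) \<bullet> (z - y) < p (y + 1 *\<^sub>R (z - y)) \<bullet> (z - y)"
  proof (rule DERIV_pos_imp_increasing[of 0 1])
    fix t :: real assume t: "0 \<le> t" "t \<le> 1"
    have "y + t *\<^sub>R (z - y) \<noteq> 0" using False t by blast
    then have "(G (y + t *\<^sub>R (z - y)) *v (z - y)) \<bullet> (z - y) > 0"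
      using G_pos[of _ "z - y"] yz by (simp add: inner_commute)
    then show "\<exists>D. ((\<lambda>t. p (y + t *\<^sub>R (z - y)) \<bullet> (z - y)) has_real_derivative D) (at t) \<and> D > 0"
      using D[OF t] by blast
  qed simp
  then show ?thesis by (simp add: inner_diff_left)
qed

lemma p_inj: "y \<noteq> 0 \<Longrightarrow> z \<noteq> 0 \<Longrightarrow> p y = p z \<Longrightarrow> y = z"
  using p_strict_mono[of y z] by force

lemma at_max:
  assumes f: "(f has_derivative f') (at (y :: real ^ 'n))" and "y \<noteq> 0"
    and le: "\<And>z. z \<noteq> 0 \<Longrightarrow> f z \<le> (f y :: real)"
  shows "f' = (\<lambda>v. 0)"
  by (rule differential_zero_maxmin[of y "- {0}" f])
     (use assms in \<open>auto simp: open_Compl\<close>)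

text \<open>By scale invariance it is enough to maximise over the compact set in which the closed
  cone C meets the unit sphere.\<close>

lemma zero_homogeneous_max:
  fixes f :: "real ^ 'n \<Rightarrow> real"
  assumes c: "continuous_on (- {0}) f" and s: "\<And>y t. y \<noteq> 0 \<Longrightarrow> t > 0 \<Longrightarrow> f (t *\<^sub>R y) = f y"
    and C: "closed C" "\<exists>y\<in>C. y \<noteq> 0" "\<And>y t. y \<in> C \<Longrightarrow> t > 0 \<Longrightarrow> t *\<^sub>R y \<in> C"
  obtains y where "y \<noteq> 0" "y \<in> C" "\<And>z. z \<noteq> 0 \<Longrightarrow> z \<in> C \<Longrightarrow> f z \<le> f y"
proof -
  have n: "z /\<^sub>R norm z \<in> sphere 0 1 \<inter> C" "f (z /\<^sub>R norm z) = f z" if "z \<noteq> 0" "z \<in> C" for z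
    using that C(3)[of z "inverse (norm z)"] s[of z "inverse (norm z)"] by auto
  have "compact (sphere 0 1 \<inter> C)" by (intro compact_Int_closed C) simp
  moreover have "sphere 0 1 \<inter> C \<noteq> {}" using C(2) n by blast
  moreover have "continuous_on (sphere 0 1 \<inter> C) f" by (rule continuous_on_subset[OF c]) auto
  ultimately obtain y where y: "y \<in> sphere 0 1 \<inter> C" "\<And>z. z \<in> sphere 0 1 \<inter> C \<Longrightarrow> f z \<le> f y"
    using continuous_attains_sup by metis
  show ?thesis
  proof (rule that[of y])
    show "y \<noteq> 0" "y \<in> C" using y(1) by auto
    show "f z \<le> f y" if "z \<noteq> 0" "z \<in> C" for z
      using y(2)[OF n(1)[OF that]] n(2)[OF that] by simp
  qed
qed

lemma N_cont: "continuous_on (- {0}) N"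
  using N_deriv by (intro continuous_at_imp_continuous_on) (auto intro: has_derivative_continuous)

lemma D_cont: "continuous_on (- {0}) D"
  using D_deriv by (intro continuous_at_imp_continuous_on) (auto intro: has_derivative_continuous)

lemma ratio_deriv:
  assumes "y \<noteq> 0"
  shows "((\<lambda>z. (h \<bullet> z) / N z) has_derivative
    (\<lambda>v. ((h \<bullet> v) * (N y)\<^sup>2 - (h \<bullet> y) * (p y \<bullet> v)) / (N y) ^ 3)) (at y)"
proof -
  have "((\<lambda>z. (h \<bullet> z) / N z) has_derivative
    (\<lambda>v. ((h \<bullet> v) * N y - (h \<bullet> y) * ((p y \<bullet> v) / N y)) / (N y * N y))) (at y)"
    using N_pos[OF assms]
    by (intro has_derivative_divide' N_deriv assms has_derivative_inner_right has_derivative_ident) auto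
  then show ?thesis
    by (rule has_derivative_eq_rhs)
       (use N_pos[OF assms] in \<open>simp add: fun_eq_iff field_simps power2_eq_square power3_eq_cube\<close>)
qed

text \<open>The function h \<bullet> y / N y has a maximum, and at a critical point h is a multiple
  of p y. The multiple is positive because the value at y = h already is, so a rescaled y has p y =
  h.\<close>

lemma legendre_surj:
  assumes h: "h \<noteq> 0"
  obtains y where "y \<noteq> 0" "p y = h"
proof -
  have "continuous_on (- {0}) (\<lambda>z. (h \<bullet> z) / N z)"
    using N_pos by (intro continuous_intros N_cont) force
  moreover have "(h \<bullet> (t *\<^sub>R y)) / N (t *\<^sub>R y) = (h \<bullet> y) / N y" if "y \<noteq> 0" "t > 0" for y t
    using that by (simp add: N_scale)
  ultimately obtain y where y: "y \<noteq> 0" "\<And>z. z \<noteq> 0 \<Longrightarrow> (h \<bullet> z) / N z \<le> (h \<bullet> y) / N y"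
    by (rule zero_homogeneous_max[of "\<lambda>z. (h \<bullet> z) / N z" UNIV]) (use h in auto)
  have Ny: "N y > 0" by (rule N_pos[OF y(1)])
  have "(h \<bullet> h) / N h > 0" using h N_pos by simp
  then have hy: "h \<bullet> y > 0" using y(2)[OF h] Ny by (metis less_le_trans zero_less_divide_iff not_less_iff_gr_or_eq)
  have "(\<lambda>v. ((h \<bullet> v) * (N y)\<^sup>2 - (h \<bullet> y) * (p y \<bullet> v)) / (N y) ^ 3) = (\<lambda>v. 0)"
    by (rule at_max[OF ratio_deriv[OF y(1)] y])
  then have "(h \<bullet> v) * (N y)\<^sup>2 - (h \<bullet> y) * (p y \<bullet> v) = 0" for v
    using Ny by (auto simp: fun_eq_iff)
  then have "((N y)\<^sup>2 *\<^sub>R h - (h \<bullet> y) *\<^sub>R p y) \<bullet> v = 0" for v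
    by (simp add: inner_diff_left mult.commute)
  then have "(N y)\<^sup>2 *\<^sub>R h = (h \<bullet> y) *\<^sub>R p y" using inner_eq_zero_iff by (metis eq_iff_diff_eq_0)
  then have "h = ((h \<bullet> y) / (N y)\<^sup>2) *\<^sub>R p y"
    using Ny by (metis (no_types, lifting) divide_inverse_commute less_irrefl power_not_zero real_vector_affinity_eq
        scaleR_scaleR scaleR_one left_inverse)
  then have "p (((h \<bullet> y) / (N y)\<^sup>2) *\<^sub>R y) = h" using p_scale[OF y(1)] hy Ny by simp
  moreover have "((h \<bullet> y) / (N y)\<^sup>2) *\<^sub>R y \<noteq> 0" using y(1) hy Ny by simp
  ultimately show ?thesis using that by blast
qed

text \<open>Moving along the Legendre preimage of a subspace is possible by the inverse function theorem.\<close>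

lemma critical_on_subspace:
  assumes P: "subspace P" and y: "y \<noteq> 0" "p y \<in> P"
    and max: "\<And>z. z \<noteq> 0 \<Longrightarrow> p z \<in> P \<Longrightarrow> D z \<le> D y"
    and k: "G y *v k \<in> P"
  shows "d y \<bullet> k = 0"
proof -
  let ?S = "- {0 :: real ^ 'n}"
  define g where "g = inv_into ?S p"
  have inj: "inj_on p ?S" using p_inj by (auto simp: inj_on_def)
  have cp: "continuous_on ?S p"
    using p_deriv by (intro continuous_at_imp_continuous_on) (auto intro: has_derivative_continuous)
  have S: "open ?S" by (simp add: open_Compl)
  have gp: "g (p x) = x" if "x \<in> ?S" for x unfolding g_def by (rule inv_into_f_f[OF inj that])
  \<comment> \<open>Invariance of domain makes the image open, so that p y + t q has a preimage for
    all small t.\<close>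
  have op: "open (p ` ?S)" by (rule invariance_of_domain[OF cp S inj])
  have gd: "(g has_derivative (\<lambda>v. matrix_inv (G y) *v v)) (at (p y))"
    by (rule has_derivative_inverse_strong[OF S _ cp gp p_deriv])
       (use y G_inv in \<open>auto simp: fun_eq_iff\<close>)
  define q where "q = G y *v k"
  have gk: "matrix_inv (G y) *v q = k"
    using matrix_inv_mult(2)[OF G_det[OF y(1)]] by (simp add: q_def matrix_vector_mul_assoc)
  define \<gamma> where "\<gamma> t = D (g (p y + t *\<^sub>R q))" for t :: real
  have "((\<lambda>t. p y + t *\<^sub>R q) has_derivative (\<lambda>s. s *\<^sub>R q)) (at 0)"
    by (auto intro!: derivative_eq_intros)
  moreover have "(g has_derivative (\<lambda>v. matrix_inv (G y) *v v)) (at (p y + 0 *\<^sub>R q))" using gd by simp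
  ultimately have "((\<lambda>t. g (p y + t *\<^sub>R q)) has_derivative (\<lambda>s. matrix_inv (G y) *v (s *\<^sub>R q))) (at 0)"
    using has_derivative_compose[of "\<lambda>t. p y + t *\<^sub>R q"] by blast
  moreover have "(D has_derivative (\<lambda>v. d y \<bullet> v)) (at (g (p y + 0 *\<^sub>R q)))"
    using D_deriv[OF y(1)] gp y(1) by simp
  ultimately have "(\<gamma> has_derivative (\<lambda>s. d y \<bullet> (matrix_inv (G y) *v (s *\<^sub>R q)))) (at 0)"
    unfolding \<gamma>_def using has_derivative_compose[of "\<lambda>t. g (p y + t *\<^sub>R q)"] by blast
  then have \<gamma>: "(\<gamma> has_real_derivative d y \<bullet> k) (at 0)"
    by (simp add: has_field_derivative_def matrix_vector_mult_scaleR gk mult_commute_abs)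
  have "((\<lambda>t. p y + t *\<^sub>R q) \<longlongrightarrow> p y + 0 *\<^sub>R q) (nhds (0 :: real))"
    using isCont_def continuous_at tendsto_at_iff_tendsto_nhds[of "\<lambda>t :: real. p y + t *\<^sub>R q" 0]
    by (auto intro!: tendsto_eq_intros)
  then have "\<forall>\<^sub>F t in nhds (0 :: real). p y + t *\<^sub>R q \<in> p ` ?S"
    by (rule topological_tendstoD[OF _ op]) (use y in auto)
  then obtain \<epsilon> where \<epsilon>: "\<epsilon> > 0" "\<And>t :: real. dist t 0 < \<epsilon> \<Longrightarrow> p y + t *\<^sub>R q \<in> p ` ?S"
    unfolding eventually_nhds_metric by blast
  show ?thesis
  proof (rule DERIV_local_max[OF \<gamma> \<epsilon>(1)], intro allI impI)
    fix t :: real assume "\<bar>0 - t\<bar> < \<epsilon>"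
    then have "p y + t *\<^sub>R q \<in> p ` ?S" using \<epsilon>(2)[of t] by (simp add: dist_real_def)
    then obtain z where "p y + t *\<^sub>R q = p z" "z \<in> ?S" by (rule imageE)
    then have z: "z \<noteq> 0" "p z = p y + t *\<^sub>R q" by simp_all
    have "p z \<in> P" unfolding z(2) q_def by (intro subspace_add subspace_scale P y k)
    then have "D z \<le> D y" by (rule max[OF z(1)])
    moreover have "g (p y + t *\<^sub>R q) = z" using gp[of z] z by simp
    moreover have "g (p y) = y" using gp[of y] y by simp
    ultimately show "\<gamma> t \<le> \<gamma> 0" by (simp add: \<gamma>_def)
  qed
qed

text \<open>Critical points of \<open>h \<bullet> y / N - K (D - c)\<^sup>2\<close> lie on the two rays on which \<open>p\<close> is proportional
  to \<open>h\<close>; letting \<open>K\<close> grow, \<open>D\<close> takes at most the two values it has there.\<close>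

lemma constant_if_derivative_zero_in_direction:
  assumes n: "CARD('n) \<ge> 2" and h: "h \<noteq> 0"
    and crit: "\<And>y k. y \<noteq> 0 \<Longrightarrow> G y *v k = h \<Longrightarrow> d y \<bullet> k = 0"
    and y: "y \<noteq> 0" and z: "z \<noteq> 0"
  shows "D y = D z"
proof -
  obtain y1 where y1: "y1 \<noteq> 0" "p y1 = h" by (rule legendre_surj[OF h])
  obtain y2 where y2: "y2 \<noteq> 0" "p y2 = - h" by (rule legendre_surj[of "- h"]) (use h in auto)
  have two: "D y \<in> {D y1, D y2}" if y: "y \<noteq> 0" for y
  proof (rule ccontr)
    assume neq: "\<not> ?thesis"
    define c where "c = D y"
    define \<mu> where "\<mu> = min ((D y1 - c)\<^sup>2) ((D y2 - c)\<^sup>2)"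
    have \<mu>: "\<mu> > 0" using neq by (auto simp: \<mu>_def c_def)
    define u where "u z = (h \<bullet> z) / N z" for z
    have u_cont: "continuous_on (- {0}) u"
      unfolding u_def using N_pos by (intro continuous_intros N_cont) force
    have u_scale: "u (t *\<^sub>R y) = u y" if "y \<noteq> 0" "t > 0" for y t
      using that by (simp add: N_scale u_def)
    obtain B where B: "\<And>z. z \<noteq> 0 \<Longrightarrow> \<bar>u z\<bar> \<le> B"
    proof -
      obtain w where "w \<noteq> 0" "\<And>z. z \<noteq> 0 \<Longrightarrow> z \<in> UNIV \<Longrightarrow> \<bar>u z\<bar> \<le> \<bar>u w\<bar>"
        by (rule zero_homogeneous_max[of "\<lambda>z. \<bar>u z\<bar>" UNIV])
           (use h u_scale u_cont in \<open>auto intro: continuous_on_rabs\<close>)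
      then show ?thesis using that by auto
    qed
    \<comment> \<open>Since u is bounded by B, it gains at most 2 B between two points. The penalty
      K \<mu> = 2 B + 1 exceeds this, so no maximiser can have D at one of the two ray
      values.\<close>
    define K where "K = (2 * B + 1) / \<mu>"
    define f where "f z = u z - K * (D z - c)\<^sup>2" for z
    obtain w where w: "w \<noteq> 0" "\<And>z. z \<noteq> 0 \<Longrightarrow> z \<in> UNIV \<Longrightarrow> f z \<le> f w"
      by (rule zero_homogeneous_max[of f UNIV])
         (use h u_scale u_cont D_scale D_cont in \<open>auto simp: f_def intro!: continuous_intros\<close>)
    have Nw: "N w > 0" by (rule N_pos[OF w(1)])
    have "((\<lambda>z. K * (D z - c)\<^sup>2) has_derivative (\<lambda>v. K * (2 * (D w - c) * (d w \<bullet> v)))) (at w)"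
      using D_deriv[OF w(1)] by (auto intro!: derivative_eq_intros simp: fun_eq_iff algebra_simps)
    from has_derivative_diff[OF ratio_deriv[OF w(1), of h] this]
    have "(f has_derivative (\<lambda>v. ((h \<bullet> v) * (N w)\<^sup>2 - (h \<bullet> w) * (p w \<bullet> v)) / (N w) ^ 3 -
        K * (2 * (D w - c) * (d w \<bullet> v)))) (at w)"
      unfolding f_def u_def .
    from at_max[OF this w(1)] have
      z0: "((h \<bullet> v) * (N w)\<^sup>2 - (h \<bullet> w) * (p w \<bullet> v)) / (N w) ^ 3 - K * (2 * (D w - c) * (d w \<bullet> v)) = 0" for v
      using w(2) by (auto simp: fun_eq_iff)
    define k where "k = matrix_inv (G w) *v h"
    have Gk: "G w *v k = h" unfolding k_def by (rule G_inv[OF w(1)])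
    have pk: "p w \<bullet> k = h \<bullet> w"
      using G_sym[OF w(1), of w k] G_self[OF w(1)] Gk by (simp add: inner_commute)
    \<comment> \<open>In the direction k the D term of the critical equation drops out by
      \<open>crit\<close>. What remains is equality in the Cauchy-Schwarz inequality for h and p w
      with respect to the inverse of G w, hence h is a multiple of p w.\<close>
    have eq: "(h \<bullet> k) * (N w)\<^sup>2 = (h \<bullet> w)\<^sup>2"
      using z0[of k] crit[OF w(1) Gk] Nw by (simp add: pk power2_eq_square)
    define v where "v = (N w)\<^sup>2 *\<^sub>R k - (h \<bullet> w) *\<^sub>R w"
    have Gv: "G w *v v = (N w)\<^sup>2 *\<^sub>R h - (h \<bullet> w) *\<^sub>R p w"
      by (simp add: v_def matrix_vector_mult_diff_distrib matrix_vector_mult_scaleR Gk G_self[OF w(1)])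
    have "v \<bullet> (G w *v v) = (N w)\<^sup>2 * ((h \<bullet> k) * (N w)\<^sup>2 - (h \<bullet> w)\<^sup>2)"
      unfolding Gv using pk p_self[OF w(1)]
      by (simp add: v_def inner_diff_left inner_diff_right inner_commute power2_eq_square algebra_simps)
    then have "v = 0" using eq G_pos[OF w(1), of v] by force
    then have hw: "(N w)\<^sup>2 *\<^sub>R h = (h \<bullet> w) *\<^sub>R p w" using Gv by simp
    define \<tau> where "\<tau> = (h \<bullet> w) / (N w)\<^sup>2"
    have h\<tau>: "h = \<tau> *\<^sub>R p w"
    proof -
      have "h = inverse ((N w)\<^sup>2) *\<^sub>R ((N w)\<^sup>2 *\<^sub>R h)" using Nw by simp
      also have "\<dots> = \<tau> *\<^sub>R p w" unfolding hw \<tau>_def by (simp add: divide_inverse mult.commute)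
      finally show ?thesis .
    qed
    have "D w \<in> {D y1, D y2}"
    proof (cases "\<tau> > 0")
      case True
      then have "p (\<tau> *\<^sub>R w) = p y1" using p_scale[OF w(1)] y1 h\<tau> by simp
      then have "\<tau> *\<^sub>R w = y1" using p_inj[of "\<tau> *\<^sub>R w" y1] True w(1) y1 by simp
      then show ?thesis using D_scale[OF w(1) True] by simp
    next
      case False
      moreover have "\<tau> \<noteq> 0" using h\<tau> h by auto
      ultimately have neg: "- \<tau> > 0" by simp
      then have "p (- \<tau> *\<^sub>R w) = p y2" using p_scale[OF w(1) neg] y2 h\<tau> by simp
      then have "- \<tau> *\<^sub>R w = y2" using p_inj[of "- \<tau> *\<^sub>R w" y2] neg w(1) y2 by simp
      then show ?thesis using D_scale[OF w(1) neg] by simp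
    qed
    then have le: "\<mu> \<le> (D w - c)\<^sup>2" by (auto simp: \<mu>_def)
    have "B \<ge> 0" using B[OF y] by (meson abs_ge_zero order_trans)
    then have "K \<ge> 0" using \<mu> by (simp add: K_def)
    with le have "K * \<mu> \<le> K * (D w - c)\<^sup>2" by (rule mult_left_mono)
    moreover have "K * \<mu> = 2 * B + 1" using \<mu> by (simp add: K_def)
    ultimately have "2 * B + 1 \<le> K * (D w - c)\<^sup>2" by simp
    moreover have "f y \<le> f w" using w(2) y by simp
    moreover have "f y = u y" by (simp add: f_def c_def)
    ultimately have "u y \<le> u w - (2 * B + 1)" using f_def[of w] by linarith
    then show False using B[OF y] B[OF w(1)] by linarith
  qed
  \<comment> \<open>The punctured space is connected from dimension two on, so a continuous function
    with at most two values on it is constant.\<close>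
  have conn: "connected (- {0 :: real ^ 'n})"
    using connected_punctured_universe[of "0 :: real ^ 'n"] n by simp
  have "D ` (- {0}) \<subseteq> {D y1, D y2}" using two by blast
  then have fin: "finite (D ` (- {0}))" using finite_subset by blast
  have "connected (D ` (- {0}))" by (rule connected_continuous_image[OF D_cont conn])
  then obtain c where "D ` (- {0}) = {c}"
    using connected_finite_iff_sing[of "D ` (- {0})"] fin y by auto
  then have "D y = c" "D z = c" using y z by auto
  then show ?thesis by simp
qed

text \<open>X is orthogonal to p because D is constant along rays. If w is a multiple of h, this
  orthogonality forces w = 0, and the previous lemma applies. Otherwise D is maximised over the y
  with p y in the plane of h and w: at a maximum y0 both h and w annihilate X, so w annihilates y0,
  and every position of p y0 in the plane is excluded.\<close>

lemma constant_if_contraction_linear: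
  assumes n: "CARD('n) \<ge> 2" and h: "h \<noteq> 0"
    and X: "\<And>y. y \<noteq> 0 \<Longrightarrow> G y *v X y = (N y)\<^sup>2 *\<^sub>R d y"
    and X_diff: "\<And>y. y \<noteq> 0 \<Longrightarrow> X differentiable at y"
    and lin: "\<And>y. y \<noteq> 0 \<Longrightarrow> h \<bullet> X y = 2 * (w \<bullet> y)"
    and y: "y \<noteq> 0" and z: "z \<noteq> 0"
  shows "D y = D z"
proof -
  have pX: "p y \<bullet> X y = 0" if "y \<noteq> 0" for y
    using G_sym[OF that, of y "X y"] X[OF that] d_self[OF that] G_self[OF that]
    by (simp add: inner_commute)
  have kX: "(N y)\<^sup>2 * (d y \<bullet> k) = (G y *v k) \<bullet> X y" if "y \<noteq> 0" for y k
  proof -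
    have "(N y)\<^sup>2 * (d y \<bullet> k) = k \<bullet> (G y *v X y)" using X[OF that] by (simp add: inner_commute)
    then show ?thesis using G_sym[OF that] by simp
  qed
  obtain y1 where y1: "y1 \<noteq> 0" "p y1 = h" by (rule legendre_surj[OF h])
  \<comment> \<open>Where p y is a multiple of h, the orthogonality of p y and X y makes h \<bullet>
    X y vanish.\<close>
  have w1: "w \<bullet> y = 0" if "y \<noteq> 0" "p y = t *\<^sub>R h" "t \<noteq> 0" for y t
    using pX[OF that(1)] lin[OF that(1)] that by simp
  show ?thesis
  proof (cases "w \<in> span {h}")
    case True
    then obtain \<mu> where \<mu>: "w = \<mu> *\<^sub>R h" by (auto simp: span_singleton)
    have "w \<bullet> y1 = 0" using w1[of y1 1] y1 by simp
    then have "\<mu> = 0" using \<mu> y1 p_self[of y1] N_pos[of y1] by (auto simp: inner_commute)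
    then have w0: "w = 0" using \<mu> by simp
    show ?thesis
    proof (rule constant_if_derivative_zero_in_direction[OF n h _ y z])
      fix y k assume "y \<noteq> 0" "G y *v k = h"
      then show "d y \<bullet> k = 0" using kX[of y k] lin[of y] w0 N_pos[of y] by simp
    qed
  next
    case False
    define P where "P = span {h, w}"
    have P: "subspace P" "h \<in> P" "w \<in> P" unfolding P_def by (auto intro: span_base)
    have pc: "continuous_on (- {0}) p"
      using p_deriv by (intro continuous_at_imp_continuous_on) (auto intro: has_derivative_continuous)
    have "closed P" using P(1) by (rule closed_subspace)
    define C where "C = insert 0 {y. y \<noteq> 0 \<and> p y \<in> P}"
    have "closed C"
    proof -
      have "closedin (top_of_set (- {0})) (- {0} \<inter> p -` P)"
        by (rule continuous_closedin_preimage[OF pc \<open>closed P\<close>])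
      then obtain T where T: "closed T" "- {0} \<inter> p -` P = - {0} \<inter> T"
        by (auto simp: closedin_closed)
      have "C = insert 0 T" using T(2) by (auto simp: C_def)
      then show ?thesis using T(1) by simp
    qed
    obtain y0 where y0: "y0 \<noteq> 0" "y0 \<in> C" "\<And>z. z \<noteq> 0 \<Longrightarrow> z \<in> C \<Longrightarrow> D z \<le> D y0"
    proof (rule zero_homogeneous_max[OF D_cont D_scale \<open>closed C\<close>])
      show "\<exists>y\<in>C. y \<noteq> 0" using y1 P by (auto simp: C_def)
      show "t *\<^sub>R y \<in> C" if "y \<in> C" "t > 0" for y t
        using that P(1) by (auto simp: C_def p_scale subspace_scale)
    qed auto
    have py0: "p y0 \<in> P" using y0 by (simp add: C_def)
    have max: "D z \<le> D y0" if "z \<noteq> 0" "p z \<in> P" for z using y0(3) that by (simp add: C_def)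
    have crit: "d y0 \<bullet> k = 0" if "G y0 *v k \<in> P" for k
      by (rule critical_on_subspace[OF P(1) y0(1) py0 max that])
    obtain s t where st: "p y0 = t *\<^sub>R h + s *\<^sub>R w"
      using py0 unfolding P_def span_insert span_singleton
      by (auto simp: algebra_simps)
    define k where "k = matrix_inv (G y0) *v h"
    define l where "l = matrix_inv (G y0) *v w"
    have Gk: "G y0 *v k = h" "G y0 *v l = w" unfolding k_def l_def by (rule G_inv[OF y0(1)])+
    have Ny0: "N y0 > 0" by (rule N_pos[OF y0(1)])
    have hX: "h \<bullet> X y0 = 0" using kX[OF y0(1), of k] crit[of k] Gk P by simp
    have wX: "w \<bullet> X y0 = 0" using kX[OF y0(1), of l] crit[of l] Gk P by simp
    have wy0: "w \<bullet> y0 = 0" using lin[OF y0(1)] hX by simp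
    have "False"
    proof (cases "s = 0")
      case True
      then have t: "p y0 = t *\<^sub>R h" "t \<noteq> 0" using st p_nonzero[OF y0(1)] by auto
      \<comment> \<open>With p y0 a multiple of h, the relations p \<bullet> X = 0 and h \<bullet> X
        = 2 (w \<bullet> y) are differentiated at y0 in the direction l, where G l = w. Together
        they give w \<bullet> l = 0, against positive definiteness.\<close>
      obtain X' where X': "(X has_derivative X') (at y0)" using X_diff[OF y0(1)] differentiable_def by blast
      have "((\<lambda>y. p y \<bullet> X y) has_derivative (\<lambda>v. p y0 \<bullet> X' v + (G y0 *v v) \<bullet> X y0)) (at y0)"
        by (rule has_derivative_inner[OF p_deriv[OF y0(1)] X'])
      moreover have "((\<lambda>y. p y \<bullet> X y) has_derivative (\<lambda>v. 0)) (at y0)"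
        by (rule has_derivative_transform_within_open[of "\<lambda>_. 0" _ _ _ "- {0}"])
           (use y0(1) pX in \<open>auto simp: open_Compl\<close>)
      ultimately have 1: "p y0 \<bullet> X' l + w \<bullet> X y0 = 0"
        using has_derivative_unique Gk(2) by (metis (no_types, lifting))
      have "((\<lambda>y. h \<bullet> X y) has_derivative (\<lambda>v. h \<bullet> X' v)) (at y0)"
        by (rule has_derivative_inner_right[OF X'])
      moreover have "((\<lambda>y. h \<bullet> X y) has_derivative (\<lambda>v. 2 * (w \<bullet> v))) (at y0)"
        by (rule has_derivative_transform_within_open[of "\<lambda>y. 2 * (w \<bullet> y)" _ _ _ "- {0}"])
           (use y0(1) lin in \<open>auto simp: open_Compl intro!: derivative_eq_intros\<close>)
      ultimately have 2: "h \<bullet> X' l = 2 * (w \<bullet> l)"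
        using has_derivative_unique by (metis (no_types, lifting))
      have "w \<bullet> l = 0" using 1 2 wX t by simp
      then have "l \<bullet> (G y0 *v l) = 0" using Gk by (simp add: inner_commute)
      then have "l = 0" using G_pos[OF y0(1), of l] by force
      then have "w = 0" using Gk by simp
      then show False using False by (simp add: span_zero)
    next
      case s: False
      show False
      proof (cases "t = 0")
        case True
        then have "p y0 \<bullet> y0 = 0" using st wy0 by simp
        then show False using p_self[OF y0(1)] Ny0 by simp
      next
        case t: False
        \<comment> \<open>The difference p y0 - p z1 is s w, and w is orthogonal to both y0 and z1:
          this contradicts the strict monotonicity of p.\<close>
        obtain z1 where z1: "z1 \<noteq> 0" "p z1 = t *\<^sub>R h" by (rule legendre_surj[of "t *\<^sub>R h"]) (use h t in auto)
        have wz1: "w \<bullet> z1 = 0" by (rule w1[OF z1 t])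
        have "z1 \<noteq> y0"
        proof
          assume "z1 = y0"
          then have "s *\<^sub>R w = 0" using z1 st by simp
          then have "w = 0" using s by simp
          then show False using \<open>w \<notin> span {h}\<close> by (simp add: span_zero)
        qed
        then have "(p y0 - p z1) \<bullet> (y0 - z1) > 0" by (rule p_strict_mono[OF z1(1) y0(1)])
        then show False using st z1(2) wy0 wz1 by (simp add: inner_diff_right)
      qed
    qed
    then show ?thesis ..
  qed
qed

end

subsection \<open>Almost rational Finsler metrics in a chart\<close>

lemma sum_swap3: "(\<Sum>r\<in>R. \<Sum>s\<in>S. \<Sum>m\<in>M. f r s m) = (\<Sum>m\<in>M. \<Sum>r\<in>R. \<Sum>s\<in>S. f r s m)"
proof -
  have "(\<Sum>r\<in>R. \<Sum>s\<in>S. \<Sum>m\<in>M. f r s m) = (\<Sum>r\<in>R. \<Sum>m\<in>M. \<Sum>s\<in>S. f r s m)"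
    by (intro sum.cong refl sum.swap)
  also have "\<dots> = (\<Sum>m\<in>M. \<Sum>r\<in>R. \<Sum>s\<in>S. f r s m)" by (rule sum.swap)
  finally show ?thesis .
qed

lemma sum_delta_left:
  "(\<Sum>s\<in>(UNIV :: 'n::finite set). (if s = l then 1 else 0) * (f s :: real)) = f l"
  "(\<Sum>s\<in>(UNIV :: 'n::finite set). (if l = s then 1 else 0) * (f s :: real)) = f l"
  by (simp_all add: if_distrib[of "\<lambda>x. x * _"] cong: if_cong)

lemma det_scaleR: "det (c *\<^sub>R M) = c ^ CARD('n) * det (M :: real ^ 'n::finite ^ 'n)"
  by (simp add: det_def prod.distrib sum_distrib_left mult_ac)

lemma matrix_inv_eqI:
  fixes M :: "real ^ 'n::finite ^ 'n"
  assumes "M ** M' = mat 1"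
  shows "matrix_inv M = M'"
proof -
  have "det M * det M' = 1" using assms by (metis det_I det_mul)
  then have "det M \<noteq> 0" by auto
  have "matrix_inv M = matrix_inv M ** (M ** M')" using assms by simp
  also have "\<dots> = M'" using matrix_inv_mult(2)[OF \<open>det M \<noteq> 0\<close>] by (simp add: matrix_mul_assoc)
  finally show ?thesis .
qed

lemma has_derivative_vecI:
  fixes f :: "'a::real_normed_vector \<Rightarrow> real ^ 'n::finite"
  assumes "\<And>i. ((\<lambda>y. f y $ i) has_derivative (\<lambda>v. f' v $ i)) (at y)"
  shows "(f has_derivative f') (at y)"
  using assms unfolding has_derivative_componentwise_within[of f] Basis_vec_def
  by (auto simp: inner_axis)

lemma (in slit) euler:
  assumes f: "sm f" and x: "x \<in> U" and y: "y \<noteq> 0"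
    and hom: "\<And>t. t > 0 \<Longrightarrow> f x (t *\<^sub>R y) = t ^ k * f x y"
  shows "(\<Sum>j\<in>UNIV. y $ j * pd (ey j) f x y) = of_nat k * f x y"
proof -
  have "((\<lambda>t. t *\<^sub>R y) has_derivative (\<lambda>s. s *\<^sub>R y)) (at (1::real))"
    by (auto intro!: derivative_eq_intros)
  moreover have "((\<lambda>y. f x y) has_derivative (\<lambda>v. (\<chi> i. pd (ey i) f x y) \<bullet> v)) (at (1 *\<^sub>R y))"
    using fibre_has_derivative[OF x _ f] y by simp
  ultimately have "((\<lambda>t. f x (t *\<^sub>R y)) has_derivative (\<lambda>s. (\<chi> i. pd (ey i) f x y) \<bullet> (s *\<^sub>R y))) (at 1)"
    by (rule has_derivative_compose)
  then have 1: "((\<lambda>t. f x (t *\<^sub>R y)) has_real_derivative (\<chi> i. pd (ey i) f x y) \<bullet> y) (at 1)"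
    by (simp add: has_field_derivative_def mult_commute_abs)
  have "((\<lambda>t. t ^ k * f x y) has_real_derivative of_nat k * f x y) (at 1)"
    by (auto intro!: derivative_eq_intros)
  then have "((\<lambda>t. f x (t *\<^sub>R y)) has_real_derivative of_nat k * f x y) (at 1)"
    by (rule has_field_derivative_transform_within_open[of _ _ _ "{0<..}"]) (auto simp: hom)
  with 1 have "(\<chi> i. pd (ey i) f x y) \<bullet> y = of_nat k * f x y" by (rule DERIV_unique)
  then show ?thesis by (simp add: inner_vec_def mult.commute)
qed

locale AR_chart = slit U for U :: "(real ^ 'n::finite) set" +
  fixes F \<eta> :: "real ^ 'n \<Rightarrow> real ^ 'n \<Rightarrow> real" and a :: "real ^ 'n \<Rightarrow> real ^ 'n \<Rightarrow> real ^ 'n ^ 'n"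
    and \<sigma> :: "real ^ 'n \<Rightarrow> real"
  assumes F_sm: "sm F" and F_nonneg: "x \<in> U \<Longrightarrow> y \<noteq> 0 \<Longrightarrow> F x y \<ge> 0"
    and F_scale: "x \<in> U \<Longrightarrow> y \<noteq> 0 \<Longrightarrow> t > 0 \<Longrightarrow> F x (t *\<^sub>R y) = t * F x y"
    and g_posdef: "x \<in> U \<Longrightarrow> y \<noteq> 0 \<Longrightarrow> sym_posdef (metric_tensor F x y)"
    and \<eta>_sm: "sm \<eta>" and \<eta>_nonneg: "x \<in> U \<Longrightarrow> y \<noteq> 0 \<Longrightarrow> \<eta> x y \<ge> 0"
    and g_eq: "x \<in> U \<Longrightarrow> y \<noteq> 0 \<Longrightarrow> metric_tensor F x y = \<eta> x y *\<^sub>R a x y"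
    and a_posdef: "x \<in> U \<Longrightarrow> y \<noteq> 0 \<Longrightarrow> sym_posdef (a x y)"
    and g_scale: "x \<in> U \<Longrightarrow> y \<noteq> 0 \<Longrightarrow> t > 0 \<Longrightarrow>
      \<eta> x (t *\<^sub>R y) * a x (t *\<^sub>R y) $ i $ j = \<eta> x y * a x y $ i $ j"
    and a_rat: "rat (\<lambda>x y. a x y $ i $ j)"
    and \<sigma>_sm: "smooth_on U \<sigma>" and \<sigma>_pos: "x \<in> U \<Longrightarrow> \<sigma> x > 0"
begin

abbreviation dx :: "'n \<Rightarrow> (real ^ 'n \<Rightarrow> real ^ 'n \<Rightarrow> real) \<Rightarrow> real ^ 'n \<Rightarrow> real ^ 'n \<Rightarrow> real" where
  "dx i \<equiv> pd (ex i)"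
abbreviation dy :: "'n \<Rightarrow> (real ^ 'n \<Rightarrow> real ^ 'n \<Rightarrow> real) \<Rightarrow> real ^ 'n \<Rightarrow> real ^ 'n \<Rightarrow> real" where
  "dy i \<equiv> pd (ey i)"

definition L2 where "L2 = (\<lambda>x y. (F x y)\<^sup>2)"
definition L where "L = (\<lambda>x y. ln (\<eta> x y))"
definition ca where "ca i j = (\<lambda>x y. a x y $ i $ j)"
definition b where "b i j = (\<lambda>x y. matrix_inv (a x y) $ i $ j)"
definition Q where "Q = (\<lambda>x y. \<Sum>r\<in>UNIV. \<Sum>s\<in>UNIV. y $ r * y $ s * ca r s x y)"

lemma det_a: "x \<in> U \<Longrightarrow> y \<noteq> 0 \<Longrightarrow> det (a x y) \<noteq> 0"
proof
  assume xy: "x \<in> U" "y \<noteq> 0" and "det (a x y) = 0"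
  then obtain h where "h \<noteq> 0" "a x y *v h = 0"
    using invertible_det_nz[of "a x y"] matrix_left_invertible_ker[of "a x y"]
    by (auto simp: invertible_left_inverse)
  with a_posdef[OF xy] show False unfolding sym_posdef_def by (metis inner_zero_right less_irrefl)
qed

lemma a_sym: "x \<in> U \<Longrightarrow> y \<noteq> 0 \<Longrightarrow> ca i j x y = ca j i x y"
  using a_posdef[of x y] unfolding sym_posdef_def ca_def transpose_def by (metis vec_lambda_beta)

lemma ab: "x \<in> U \<Longrightarrow> y \<noteq> 0 \<Longrightarrow> (\<Sum>k\<in>UNIV. ca i k x y * b k j x y) = (if i = j then 1 else 0)"
  using matrix_inv_mult(1)[OF det_a[of x y]]
  by (simp add: ca_def b_def vec_eq_iff matrix_matrix_mult_def mat_def)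

lemma ba: "x \<in> U \<Longrightarrow> y \<noteq> 0 \<Longrightarrow> (\<Sum>k\<in>UNIV. b i k x y * ca k j x y) = (if i = j then 1 else 0)"
  using matrix_inv_mult(2)[OF det_a[of x y]]
  by (simp add: ca_def b_def vec_eq_iff matrix_matrix_mult_def mat_def)

lemma b_sym:
  assumes xy: "x \<in> U" "y \<noteq> 0"
  shows "b i j x y = b j i x y"
proof -
  have "a x y ** transpose (matrix_inv (a x y)) = transpose (matrix_inv (a x y) ** a x y)"
    using a_posdef[OF xy] by (simp add: matrix_transpose_mul sym_posdef_def)
  also have "\<dots> = mat 1" by (simp add: matrix_inv_mult(2)[OF det_a[OF xy]])
  finally have "matrix_inv (a x y) = transpose (matrix_inv (a x y))" by (rule matrix_inv_eqI)
  then show ?thesis unfolding b_def transpose_def by (metis vec_lambda_beta)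
qed

lemma \<eta>_pos: "x \<in> U \<Longrightarrow> y \<noteq> 0 \<Longrightarrow> \<eta> x y > 0"
proof -
  assume xy: "x \<in> U" "y \<noteq> 0"
  have "\<eta> x y \<noteq> 0"
  proof
    assume "\<eta> x y = 0"
    then have "metric_tensor F x y = 0" using g_eq[OF xy] by simp
    then have "y \<bullet> (0 *v y) > 0"
      using g_posdef[OF xy] xy(2) unfolding sym_posdef_def by metis
    then show False by simp
  qed
  then show ?thesis using \<eta>_nonneg[OF xy] by simp
qed

lemma ca_rat: "rat (ca i j)" unfolding ca_def by (rule a_rat)
lemma b_rat: "rat (b i j)" unfolding b_def by (rule rat_matrix_inv[OF a_rat]) (rule det_a)
lemma ca_sm: "sm (ca i j)" by (rule rat_sm[OF ca_rat])
lemma b_sm: "sm (b i j)" by (rule rat_sm[OF b_rat])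
lemma L_sm: "sm L" unfolding L_def by (rule sm_ln[OF \<eta>_sm]) (simp add: \<eta>_pos)
lemma L2_sm: "sm L2" unfolding L2_def power2_eq_square by (rule sm_mult[OF F_sm F_sm])
lemma Q_rat: "rat Q" unfolding Q_def by (intro rat_sum rat_mult rat_coord ca_rat)
lemma Q_sm: "sm Q" by (rule rat_sm[OF Q_rat])

lemmas base_sm = ca_sm b_sm L_sm L2_sm Q_sm \<eta>_sm sm_pd sm_coord sm_const sm_mult sm_add sm_diff sm_sum

lemma pd_L: "x \<in> U \<Longrightarrow> y \<noteq> 0 \<Longrightarrow> pd e L x y = pd e \<eta> x y / \<eta> x y"
  unfolding L_def by (rule pd_ln) (auto intro: \<eta>_sm \<eta>_pos)

section \<open>Euler's relation and the fibre derivatives of the metric\<close>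

lemma dy_dy_L2: "x \<in> U \<Longrightarrow> y \<noteq> 0 \<Longrightarrow> dy i (dy j L2) x y = 2 * (\<eta> x y * ca i j x y)"
proof -
  assume xy: "x \<in> U" "y \<noteq> 0"
  have "metric_tensor F x y $ i $ j = 1/2 * dy i (dy j L2) x y"
    by (simp add: metric_tensor_def Dy_pd L2_def)
  then show ?thesis using g_eq[OF xy] by (simp add: ca_def)
qed

lemma dy_coord: "dy m (\<lambda>x y. y $ k) x y = (if m = k then 1 else 0)"
  by (simp add: pd_coord axis_def)

lemma dx_coord: "dx m (\<lambda>x y. y $ k) x y = 0"
  by (simp add: pd_coord)

text \<open>Differentiating Euler's relation of degree two for F^2 once along the fibre expresses
  its gradient by the Hessian applied to y.\<close>

lemma dy_L2:
  assumes x: "x \<in> U" and y: "y \<noteq> 0"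
  shows "dy i L2 x y = 2 * (\<Sum>j\<in>UNIV. \<eta> x y * ca i j x y * y $ j)"
proof -
  have "dy i (\<lambda>x y. \<Sum>j\<in>UNIV. y $ j * dy j L2 x y) x y = dy i (\<lambda>x y. 2 * L2 x y) x y"
  proof (rule pd_cong)
    fix x y assume "x \<in> U" "y \<in> - {0 :: real ^ 'n}"
    then show "(\<Sum>j\<in>UNIV. y $ j * dy j L2 x y) = 2 * L2 x y"
      using euler[OF L2_sm, of x y 2] by (simp add: L2_def F_scale power_mult_distrib)
  qed (use x y in auto)
  moreover have "dy i (\<lambda>x y. 2 * L2 x y) x y = 2 * dy i L2 x y"
    using x y by (simp add: pd_cmult L2_sm)
  moreover have "dy i (\<lambda>x y. \<Sum>j\<in>UNIV. y $ j * dy j L2 x y) x y =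
      (\<Sum>j\<in>UNIV. (if i = j then 1 else 0) * dy j L2 x y + y $ j * dy i (dy j L2) x y)"
    using x y by (simp add: pd_sum pd_mult base_sm dy_coord)
  moreover have "\<dots> = dy i L2 x y + (\<Sum>j\<in>UNIV. y $ j * (2 * (\<eta> x y * ca i j x y)))"
    by (simp only: sum.distrib sum_delta_left dy_dy_L2[OF x y])
  ultimately show ?thesis by (simp add: sum_distrib_left mult_ac)
qed

lemma L2_eq:
  assumes x: "x \<in> U" and y: "y \<noteq> 0"
  shows "L2 x y = \<eta> x y * Q x y"
proof -
  have "2 * L2 x y = (\<Sum>j\<in>UNIV. y $ j * dy j L2 x y)"
    using euler[OF L2_sm x y, of 2] x y by (simp add: L2_def F_scale power_mult_distrib)
  also have "\<dots> = 2 * (\<eta> x y * Q x y)"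
    using x y by (simp add: dy_L2 Q_def sum_distrib_left mult_ac)
  finally show ?thesis by simp
qed

lemma Q_inner: "Q x y = y \<bullet> (a x y *v y)"
  by (simp add: Q_def ca_def inner_vec_def matrix_vector_mult_def sum_distrib_left mult_ac)

lemma Q_pos: "x \<in> U \<Longrightarrow> y \<noteq> 0 \<Longrightarrow> Q x y > 0"
  using a_posdef[of x y] unfolding Q_inner sym_posdef_def by blast

lemma pd_Q:
  assumes x: "x \<in> U" and y: "y \<noteq> 0"
  shows "dy m Q x y = 2 * (\<Sum>s\<in>UNIV. ca m s x y * y $ s) +
    (\<Sum>r\<in>UNIV. \<Sum>s\<in>UNIV. y $ r * y $ s * dy m (ca r s) x y)"
proof -
  have "dy m Q x y = (\<Sum>r\<in>UNIV. \<Sum>s\<in>UNIV. (if m = r then 1 else 0) * (y $ s * ca r s x y) +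
      (if m = s then 1 else 0) * (y $ r * ca r s x y) + y $ r * y $ s * dy m (ca r s) x y)"
    unfolding Q_def using x y
    by (simp add: pd_sum pd_mult base_sm dy_coord algebra_simps del: mult_cancel_left1)
  also have "\<dots> = (\<Sum>s\<in>UNIV. y $ s * ca m s x y) + (\<Sum>r\<in>UNIV. y $ r * ca r m x y) +
    (\<Sum>r\<in>UNIV. \<Sum>s\<in>UNIV. y $ r * y $ s * dy m (ca r s) x y)"
    by (simp only: sum.distrib sum_delta_left sum_distrib_left[symmetric])
  finally show ?thesis
    using x y by (simp add: a_sym[of x y _ m] mult.commute)
qed

text \<open>Compare \<open>dy_L2\<close> with the product rule for F^2 = \<eta> Q: the terms 2 a_mj
  y^j cancel, and only the derivatives of a remain.\<close>

lemma Q_dy_L: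
  assumes x: "x \<in> U" and y: "y \<noteq> 0"
  shows "Q x y * dy m L x y = - (\<Sum>r\<in>UNIV. \<Sum>s\<in>UNIV. y $ r * y $ s * dy m (ca r s) x y)"
proof -
  have "dy m L2 x y = dy m (\<lambda>x y. \<eta> x y * Q x y) x y"
    by (rule pd_cong) (use x y L2_eq in auto)
  also have "\<dots> = dy m \<eta> x y * Q x y + \<eta> x y * dy m Q x y"
    using x y by (simp add: pd_mult base_sm)
  finally have "\<eta> x y * (2 * (\<Sum>j\<in>UNIV. ca m j x y * y $ j)) = \<eta> x y * (dy m L x y * Q x y + dy m Q x y)"
    using x y \<eta>_pos[OF x y] by (simp add: dy_L2 pd_L sum_distrib_left mult_ac distrib_left)
  then have "2 * (\<Sum>j\<in>UNIV. ca m j x y * y $ j) = dy m L x y * Q x y + dy m Q x y"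
    using \<eta>_pos[OF x y] by simp
  then show ?thesis using pd_Q[OF x y] by (simp add: mult.commute)
qed

lemma dy_L_rat: "rat (dy m L)"
proof -
  have "rat (\<lambda>x y. - (\<Sum>r\<in>UNIV. \<Sum>s\<in>UNIV. y $ r * y $ s * dy m (ca r s) x y) / Q x y)"
    by (intro rat_divide rat_minus rat_sum rat_mult rat_coord rat_pd ca_rat Q_rat)
       (use Q_pos in force)
  then show ?thesis
  proof (rule rat_cong)
    fix x y :: "real ^ 'n" assume xy: "x \<in> U" "y \<noteq> 0"
    show "- (\<Sum>r\<in>UNIV. \<Sum>s\<in>UNIV. y $ r * y $ s * dy m (ca r s) x y) / Q x y = dy m L x y"
      using Q_dy_L[OF xy, of m] Q_pos[OF xy] by (simp add: field_simps)
  qed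
qed

lemma dy_dx_L_rat: "rat (dy m (dx l L))"
  by (rule rat_cong[OF rat_pd[OF dy_L_rat[of m], of "ex l"] pd_commute[OF L_sm]]) auto

text \<open>Total symmetry of the Cartan tensor, the third fibre derivative of F^2, written in terms
  of a and L after division by \<eta>.\<close>

lemma dy_metric_sym:
  assumes x: "x \<in> U" and y: "y \<noteq> 0"
  shows "dy m (ca k s) x y = dy s (ca k m) x y + dy s L x y * ca k m x y - dy m L x y * ca k s x y"
proof -
  have g: "dy m (dy k (dy s L2)) x y = 2 * (dy m \<eta> x y * ca k s x y + \<eta> x y * dy m (ca k s) x y)" for m k s
  proof -
    have "dy m (dy k (dy s L2)) x y = dy m (\<lambda>x y. 2 * (\<eta> x y * ca k s x y)) x y"
      by (rule pd_cong) (use x y dy_dy_L2 in auto)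
    then show ?thesis using x y by (simp add: pd_cmult pd_mult base_sm)
  qed
  have "dy m (dy k (dy s L2)) x y = dy m (dy s (dy k L2)) x y"
    by (rule pd_cong[OF pd_commute[OF L2_sm]]) (use x y in auto)
  also have "\<dots> = dy s (dy m (dy k L2)) x y"
    by (rule pd_commute[OF sm_pd[OF L2_sm]]) (use x y in auto)
  also have "\<dots> = dy s (dy k (dy m L2)) x y"
    by (rule pd_cong[OF pd_commute[OF L2_sm]]) (use x y in auto)
  finally have "dy m \<eta> x y * ca k s x y + \<eta> x y * dy m (ca k s) x y =
      dy s \<eta> x y * ca k m x y + \<eta> x y * dy s (ca k m) x y" by (simp add: g)
  moreover have "dy m \<eta> x y = \<eta> x y * dy m L x y" for m
    using \<eta>_pos[OF x y] by (simp add: pd_L[OF x y])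
  ultimately have "\<eta> x y * (dy m L x y * ca k s x y + dy m (ca k s) x y) =
      \<eta> x y * (dy s L x y * ca k m x y + dy s (ca k m) x y)" by (simp add: algebra_simps)
  then show ?thesis using \<eta>_pos[OF x y] by simp
qed

section \<open>Spray, Barthel connection and the formula for S\<close>

lemma spray_coeff_eq:
  assumes x: "x \<in> U" and y: "y \<noteq> 0"
  shows "spray_coeff F i x y =
    1/2 * (y $ i * (\<Sum>k\<in>UNIV. y $ k * dx k L x y))
    - 1/4 * (Q x y * (\<Sum>l\<in>UNIV. b i l x y * dx l L x y))
    + 1/4 * (\<Sum>l\<in>UNIV. b i l x y * (\<Sum>k\<in>UNIV. \<Sum>s\<in>UNIV. (2 * dx k (ca l s) x y - dx l (ca k s) x y) * (y $ k * y $ s)))"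
proof -
  have \<eta>: "\<eta> x y > 0" by (rule \<eta>_pos[OF x y])
  \<comment> \<open>The factor 1 / \<eta> of the inverse metric will cancel the \<eta> in all
    derivatives of F^2 = \<eta> Q; only derivatives of L = ln \<eta> are left over.\<close>
  have inv: "matrix_inv (metric_tensor F x y) $ i $ l = b i l x y / \<eta> x y" for l
  proof -
    have "(\<eta> x y *\<^sub>R a x y) ** (inverse (\<eta> x y) *\<^sub>R matrix_inv (a x y)) = mat 1"
    proof -
      have "(\<eta> x y *\<^sub>R a x y) ** (inverse (\<eta> x y) *\<^sub>R matrix_inv (a x y)) = a x y ** matrix_inv (a x y)"
      proof -
        have "\<eta> x y * u * (inverse (\<eta> x y) * v) = u * v" for u v using \<eta> by simp
        note e = this
        show ?thesis
          by (simp only: vec_eq_iff matrix_matrix_mult_def vec_lambda_beta vector_scaleR_component real_scaleR_def e simp_thms)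
      qed
      then show ?thesis by (simp only: matrix_inv_mult(1)[OF det_a[OF x y]])
    qed
    then have "matrix_inv (metric_tensor F x y) = inverse (\<eta> x y) *\<^sub>R matrix_inv (a x y)"
      unfolding g_eq[OF x y] by (rule matrix_inv_eqI)
    then show ?thesis by (simp add: b_def divide_inverse)
  qed
  have pd_\<eta>: "pd e \<eta> x y = \<eta> x y * pd e L x y" for e
    using \<eta> by (simp add: pd_L[OF x y])
  have dyx: "dy r (dx k L2) x y =
      2 * (\<Sum>s\<in>UNIV. \<eta> x y * (dx k L x y * ca r s x y + dx k (ca r s) x y) * y $ s)" for r k
  proof -
    have "dy r (dx k L2) x y = dx k (dy r L2) x y" by (rule pd_commute[OF L2_sm]) (use x y in auto)
    also have "\<dots> = dx k (\<lambda>x y. 2 * (\<Sum>s\<in>UNIV. \<eta> x y * ca r s x y * y $ s)) x y"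
      by (rule pd_cong) (use x y dy_L2 in auto)
    also have "\<dots> = 2 * (\<Sum>s\<in>UNIV. (dx k \<eta> x y * ca r s x y + \<eta> x y * dx k (ca r s) x y) * y $ s)"
      using x y by (simp add: pd_cmult pd_sum pd_mult base_sm dx_coord)
    finally show ?thesis by (simp add: pd_\<eta> algebra_simps)
  qed
  have dxL: "dx r L2 x y = \<eta> x y * (dx r L x y * Q x y + (\<Sum>k\<in>UNIV. \<Sum>s\<in>UNIV. dx r (ca k s) x y * (y $ k * y $ s)))" for r
  proof -
    have "dx r L2 x y = dx r (\<lambda>x y. \<eta> x y * Q x y) x y"
      by (rule pd_cong) (use x y L2_eq in auto)
    also have "\<dots> = dx r \<eta> x y * Q x y + \<eta> x y * dx r Q x y" using x y by (simp add: pd_mult base_sm)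
    also have "dx r Q x y = (\<Sum>k\<in>UNIV. \<Sum>s\<in>UNIV. dx r (ca k s) x y * (y $ k * y $ s))"
      unfolding Q_def using x y by (simp add: pd_sum pd_mult base_sm dx_coord mult_ac)
    finally show ?thesis by (simp add: pd_\<eta> algebra_simps)
  qed
  define W where "W = (\<Sum>k\<in>UNIV. y $ k * dx k L x y)"
  define P where "P l = (\<Sum>k\<in>UNIV. \<Sum>s\<in>UNIV. (2 * dx k (ca l s) x y - dx l (ca k s) x y) * (y $ k * y $ s))" for l
  have inner: "(\<Sum>k\<in>UNIV. y $ k * dy l (dx k L2) x y) - dx l L2 x y =
      \<eta> x y * (2 * W * (\<Sum>s\<in>UNIV. ca l s x y * y $ s) - dx l L x y * Q x y + P l)" for l
  proof -
    have "(\<Sum>k\<in>UNIV. y $ k * dy l (dx k L2) x y) =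
        \<eta> x y * (2 * (\<Sum>k\<in>UNIV. \<Sum>s\<in>UNIV. (y $ k * dx k L x y) * (ca l s x y * y $ s)) +
          (\<Sum>k\<in>UNIV. \<Sum>s\<in>UNIV. (2 * dx k (ca l s) x y) * (y $ k * y $ s)))"
      unfolding dyx by (simp add: sum_distrib_left sum.distrib distrib_left distrib_right mult_ac)
    also have "(\<Sum>k\<in>UNIV. \<Sum>s\<in>UNIV. (y $ k * dx k L x y) * (ca l s x y * y $ s)) = W * (\<Sum>s\<in>UNIV. ca l s x y * y $ s)"
      by (simp add: W_def sum_product)
    finally show ?thesis
      unfolding dxL P_def by (simp add: left_diff_distrib sum_subtractf algebra_simps)
  qed
  have "spray_coeff F i x y = 1/4 * (\<Sum>l\<in>UNIV. b i l x y / \<eta> x y *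
      ((\<Sum>k\<in>UNIV. y $ k * dy l (dx k L2) x y) - dx l L2 x y))"
    unfolding spray_coeff_def inv Dx_pd Dy_pd L2_def[symmetric] ..
  also have "\<dots> = 1/4 * (\<Sum>l\<in>UNIV. 2 * W * (\<Sum>s\<in>UNIV. b i l x y * ca l s x y * y $ s)
      - Q x y * (b i l x y * dx l L x y) + b i l x y * P l)"
    unfolding inner using \<eta> by (simp add: algebra_simps sum_distrib_left)
  also have "\<dots> = 1/4 * (2 * W * (\<Sum>l\<in>UNIV. \<Sum>s\<in>UNIV. b i l x y * ca l s x y * y $ s)
      - Q x y * (\<Sum>l\<in>UNIV. b i l x y * dx l L x y) + (\<Sum>l\<in>UNIV. b i l x y * P l))"
    by (simp only: sum.distrib sum_subtractf sum_distrib_left)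
  also have "(\<Sum>l\<in>UNIV. \<Sum>s\<in>UNIV. b i l x y * ca l s x y * y $ s) = y $ i"
  proof -
    have "(\<Sum>l\<in>UNIV. \<Sum>s\<in>UNIV. b i l x y * ca l s x y * y $ s) =
        (\<Sum>s\<in>UNIV. (\<Sum>l\<in>UNIV. b i l x y * ca l s x y) * y $ s)"
      by (subst sum.swap) (simp add: sum_distrib_right)
    also have "\<dots> = y $ i" unfolding ba[OF x y] by (simp only: sum_delta_left)
    finally show ?thesis .
  qed
  finally show ?thesis by (simp add: W_def P_def algebra_simps)
qed

text \<open>W is the derivative of L along y, V the base gradient of L raised with the inverse of a,
  and P twice the first-kind Christoffel symbols of a contracted with y in two slots. The spray is
  built from these three.\<close>

definition W where "W = (\<lambda>x y. \<Sum>k\<in>UNIV. y $ k * dx k L x y)"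
definition V where "V i = (\<lambda>x y. \<Sum>l\<in>UNIV. b i l x y * dx l L x y)"
definition P where "P l = (\<lambda>x y. \<Sum>k\<in>UNIV. \<Sum>s\<in>UNIV.
  (2 * dx k (ca l s) x y - dx l (ca k s) x y) * (y $ k * y $ s))"

lemma W_sm: "sm W" unfolding W_def by (simp add: base_sm)
lemma V_sm: "sm (V i)" unfolding V_def by (simp add: base_sm)
lemma P_sm: "sm (P l)" unfolding P_def by (simp add: base_sm)

lemma dy_W:
  assumes xy: "x \<in> U" "y \<noteq> 0"
  shows "dy m W x y = dx m L x y + (\<Sum>k\<in>UNIV. y $ k * dy m (dx k L) x y)"
proof -
  have "dy m W x y = (\<Sum>k\<in>UNIV. (if m = k then 1 else 0) * dx k L x y + y $ k * dy m (dx k L) x y)"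
    unfolding W_def using xy by (simp add: pd_sum pd_mult base_sm dy_coord)
  then show ?thesis by (simp only: sum.distrib sum_delta_left)
qed

lemma dy_V:
  assumes xy: "x \<in> U" "y \<noteq> 0"
  shows "dy m (V i) x y = (\<Sum>l\<in>UNIV. dy m (b i l) x y * dx l L x y + b i l x y * dy m (dx l L) x y)"
  unfolding V_def using xy by (simp add: pd_sum pd_mult base_sm)

lemma dy_P:
  assumes xy: "x \<in> U" "y \<noteq> 0"
  shows "dy m (P l) x y =
    (\<Sum>k\<in>UNIV. \<Sum>s\<in>UNIV. (2 * dy m (dx k (ca l s)) x y - dy m (dx l (ca k s)) x y) * (y $ k * y $ s))
    + (\<Sum>s\<in>UNIV. (2 * dx m (ca l s) x y - dx l (ca m s) x y) * y $ s)
    + (\<Sum>k\<in>UNIV. (2 * dx k (ca l m) x y - dx l (ca k m) x y) * y $ k)"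
proof -
  have "dy m (P l) x y = (\<Sum>k\<in>UNIV. \<Sum>s\<in>UNIV.
      (2 * dy m (dx k (ca l s)) x y - dy m (dx l (ca k s)) x y) * (y $ k * y $ s)
      + (if m = k then 1 else 0) * ((2 * dx k (ca l s) x y - dx l (ca k s) x y) * y $ s)
      + (if m = s then 1 else 0) * ((2 * dx k (ca l s) x y - dx l (ca k s) x y) * y $ k))"
    unfolding P_def using xy
    by (simp add: pd_sum pd_mult pd_diff pd_cmult base_sm pd_const dy_coord algebra_simps)
  then show ?thesis
    by (simp only: sum.distrib sum_delta_left sum_distrib_left[symmetric])
qed

lemma dy_spray:
  assumes x: "x \<in> U" and y: "y \<noteq> 0"
  shows "barthel F m m x y =
    1/2 * (W x y + y $ m * dy m W x y) - 1/4 * (dy m Q x y * V m x y + Q x y * dy m (V m) x y)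
    + 1/4 * (\<Sum>l\<in>UNIV. dy m (b m l) x y * P l x y + b m l x y * dy m (P l) x y)"
proof -
  have "barthel F m m x y = dy m (\<lambda>x y. 1/2 * (y $ m * W x y) - 1/4 * (Q x y * V m x y)
      + 1/4 * (\<Sum>l\<in>UNIV. b m l x y * P l x y)) x y"
    unfolding barthel_def Dy_pd
    by (rule pd_cong) (use x y spray_coeff_eq in \<open>auto simp: W_def V_def P_def\<close>)
  also have "\<dots> = 1/2 * dy m (\<lambda>x y. y $ m * W x y) x y - 1/4 * dy m (\<lambda>x y. Q x y * V m x y) x y
      + 1/4 * dy m (\<lambda>x y. \<Sum>l\<in>UNIV. b m l x y * P l x y) x y"
    using x y by (simp only: pd_add pd_diff pd_cmult base_sm W_sm V_sm P_sm Compl_iff singleton_iff not_False_eq_True)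
  also have "\<dots> = 1/2 * (W x y + y $ m * dy m W x y) - 1/4 * (dy m Q x y * V m x y + Q x y * dy m (V m) x y)
      + 1/4 * (\<Sum>l\<in>UNIV. dy m (b m l) x y * P l x y + b m l x y * dy m (P l) x y)"
    using x y by (simp add: pd_sum pd_mult base_sm W_sm V_sm P_sm dy_coord)
  finally show ?thesis .
qed

text \<open>The vector c^l of the overview in the shape that the theorem displays;
  \<open>cc_eq_D\<close> supplies the shape involving D.\<close>

definition cc where "cc l = (\<lambda>x y. real CARD('n) * y $ l
  - 1/2 * (\<Sum>r\<in>UNIV. \<Sum>s\<in>UNIV. \<Sum>m\<in>UNIV. y $ r * y $ s *
      (b m l x y * dy m (ca r s) x y + ca r s x y * dy m (b m l) x y)))"

lemma cc_eq:
  "cc l x y = real CARD('n) * y $ l - 1/2 * (\<Sum>m\<in>UNIV.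
    b m l x y * (\<Sum>r\<in>UNIV. \<Sum>s\<in>UNIV. y $ r * y $ s * dy m (ca r s) x y) + Q x y * dy m (b m l) x y)"
  unfolding cc_def Q_def
  by (subst sum_swap3) (simp add: sum.distrib sum_distrib_left sum_distrib_right distrib_left mult_ac)

lemma dx_sym: "x \<in> U \<Longrightarrow> y \<noteq> 0 \<Longrightarrow> pd e (ca i j) x y = pd e (ca j i) x y"
  by (rule pd_cong) (auto simp: a_sym)

text \<open>The trace of \<open>dy_spray\<close>: the equations \<open>1\<close>, \<open>2\<close>
  and \<open>3\<close> collect its W, V and P terms.\<close>

lemma S_curvature_eq:
  assumes x: "x \<in> U" and y: "y \<noteq> 0"
  shows "S_curvature F \<sigma> x y =
    1/2 * (\<Sum>l\<in>UNIV. cc l x y * dx l L x y)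
    + 1/2 * (\<Sum>m\<in>UNIV. \<Sum>l\<in>UNIV.
         (y $ m * y $ l - 1/2 * (\<Sum>r\<in>UNIV. \<Sum>s\<in>UNIV. y $ r * y $ s * ca r s x y * b m l x y))
         * dy m (dx l L) x y)
    + 1/2 * (\<Sum>k\<in>UNIV. \<Sum>m\<in>UNIV. \<Sum>l\<in>UNIV. y $ k * b m l x y *
         (dx m (ca l k) x y + dx k (ca l m) x y - dx l (ca m k) x y))
    + 1/2 * (\<Sum>k\<in>UNIV. \<Sum>s\<in>UNIV. \<Sum>m\<in>UNIV. \<Sum>l\<in>UNIV. y $ k * y $ s *
         (dy m (b m l) x y * (dx k (ca l s) x y - 1/2 * dx l (ca k s) x y)
          + b m l x y * (dy m (dx k (ca l s)) x y - 1/2 * dy m (dx l (ca k s)) x y)))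
    - (\<Sum>m\<in>UNIV. y $ m * pderiv_at m (\<lambda>x. ln (\<sigma> x)) x)"
proof -
  define Lx where "Lx l = dx l L x y" for l
  define Lxy where "Lxy m l = dy m (dx l L) x y" for m l
  define A where "A m = (\<Sum>r\<in>UNIV. \<Sum>s\<in>UNIV. y $ r * y $ s * dy m (ca r s) x y)" for m
  define n where "n = real CARD('n)"
  have W: "W x y = (\<Sum>l\<in>UNIV. y $ l * Lx l)" by (simp add: W_def Lx_def)
  have 1: "(\<Sum>m\<in>UNIV. 1/2 * (W x y + y $ m * dy m W x y)) =
      1/2 * (n * W x y + W x y + (\<Sum>m\<in>UNIV. \<Sum>l\<in>UNIV. y $ m * y $ l * Lxy m l))"
    unfolding dy_W[OF x y]
    by (simp add: sum.distrib sum_distrib_left[symmetric] distrib_left W n_def Lx_def[symmetric] Lxy_def[symmetric])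
       (simp add: sum_distrib_left sum_divide_distrib mult_ac)
  \<comment> \<open>Lowering with a and raising with its inverse cancel. The resulting W offsets the
    surplus W in \<open>1\<close>, which leaves n y^l as the linear part of c^l.\<close>
  have aV: "(\<Sum>m\<in>UNIV. (\<Sum>s\<in>UNIV. ca m s x y * y $ s) * V m x y) = W x y"
  proof -
    have "(\<Sum>m\<in>UNIV. (\<Sum>s\<in>UNIV. ca m s x y * y $ s) * V m x y) =
        (\<Sum>m\<in>UNIV. \<Sum>s\<in>UNIV. \<Sum>l\<in>UNIV. ca s m x y * b m l x y * (y $ s * Lx l))"
      unfolding V_def Lx_def sum_product by (simp add: a_sym[OF x y] mult_ac)
    also have "\<dots> = (\<Sum>s\<in>UNIV. \<Sum>l\<in>UNIV. (\<Sum>m\<in>UNIV. ca s m x y * b m l x y) * (y $ s * Lx l))"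
      unfolding sum_distrib_right by (rule sum_swap3[symmetric])
    also have "\<dots> = (\<Sum>s\<in>UNIV. y $ s * Lx s)"
      unfolding ab[OF x y] by (simp only: sum_delta_left)
    finally show ?thesis using W by simp
  qed
  have 2: "(\<Sum>m\<in>UNIV. 1/4 * (dy m Q x y * V m x y + Q x y * dy m (V m) x y)) =
      1/2 * W x y + 1/4 * (\<Sum>l\<in>UNIV. (\<Sum>m\<in>UNIV. b m l x y * A m + Q x y * dy m (b m l) x y) * Lx l)
      + 1/4 * (\<Sum>m\<in>UNIV. \<Sum>l\<in>UNIV. Q x y * b m l x y * Lxy m l)"
  proof -
    have "(\<Sum>m\<in>UNIV. 1/4 * (dy m Q x y * V m x y + Q x y * dy m (V m) x y)) =
        (\<Sum>m\<in>UNIV. 1/2 * ((\<Sum>s\<in>UNIV. ca m s x y * y $ s) * V m x y)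
          + (\<Sum>l\<in>UNIV. 1/4 * ((b m l x y * A m + Q x y * dy m (b m l) x y) * Lx l))
          + (\<Sum>l\<in>UNIV. 1/4 * (Q x y * b m l x y * Lxy m l)))"
      unfolding pd_Q[OF x y] dy_V[OF x y]
      unfolding V_def A_def[symmetric] Lx_def[symmetric] Lxy_def[symmetric]
      by (simp add: sum.distrib sum_distrib_left algebra_simps)
    also have "\<dots> = 1/2 * (\<Sum>m\<in>UNIV. (\<Sum>s\<in>UNIV. ca m s x y * y $ s) * V m x y)
        + 1/4 * (\<Sum>m\<in>UNIV. \<Sum>l\<in>UNIV. (b m l x y * A m + Q x y * dy m (b m l) x y) * Lx l)
        + 1/4 * (\<Sum>m\<in>UNIV. \<Sum>l\<in>UNIV. Q x y * b m l x y * Lxy m l)"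
      by (simp only: sum.distrib sum_distrib_left)
    also have "(\<Sum>m\<in>UNIV. \<Sum>l\<in>UNIV. (b m l x y * A m + Q x y * dy m (b m l) x y) * Lx l) =
        (\<Sum>l\<in>UNIV. (\<Sum>m\<in>UNIV. b m l x y * A m + Q x y * dy m (b m l) x y) * Lx l)"
      by (subst sum.swap) (simp only: sum_distrib_right)
    finally show ?thesis unfolding aV .
  qed
  have 3: "(\<Sum>m\<in>UNIV. 1/4 * (\<Sum>l\<in>UNIV. dy m (b m l) x y * P l x y + b m l x y * dy m (P l) x y)) =
      1/2 * (\<Sum>k\<in>UNIV. \<Sum>m\<in>UNIV. \<Sum>l\<in>UNIV. y $ k * b m l x y *
         (dx m (ca l k) x y + dx k (ca l m) x y - dx l (ca m k) x y))
    + 1/2 * (\<Sum>k\<in>UNIV. \<Sum>s\<in>UNIV. \<Sum>m\<in>UNIV. \<Sum>l\<in>UNIV. y $ k * y $ s *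
         (dy m (b m l) x y * (dx k (ca l s) x y - 1/2 * dx l (ca k s) x y)
          + b m l x y * (dy m (dx k (ca l s)) x y - 1/2 * dy m (dx l (ca k s)) x y)))"
  proof -
    let ?T = "\<lambda>k m l. y $ k * b m l x y * (dx m (ca l k) x y + dx k (ca l m) x y - dx l (ca m k) x y)"
    let ?R = "\<lambda>k s m l. y $ k * y $ s *
         (dy m (b m l) x y * (dx k (ca l s) x y - 1/2 * dx l (ca k s) x y)
          + b m l x y * (dy m (dx k (ca l s)) x y - 1/2 * dy m (dx l (ca k s)) x y))"
    have e: "1/4 * (dy m (b m l) x y * P l x y + b m l x y * dy m (P l) x y) =
        1/2 * (\<Sum>k\<in>UNIV. ?T k m l) + 1/2 * (\<Sum>k\<in>UNIV. \<Sum>s\<in>UNIV. ?R k s m l)" for m l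
    proof -
      \<comment> \<open>The two sums come from differentiating the two factors y^k and y^s in P.
        Each contributes -\<partial>_l a_mk, which fixes the coefficient -1 of this term.\<close>
      have T: "b m l x y * (\<Sum>s\<in>UNIV. (2 * dx m (ca l s) x y - dx l (ca m s) x y) * y $ s)
          + b m l x y * (\<Sum>k\<in>UNIV. (2 * dx k (ca l m) x y - dx l (ca k m) x y) * y $ k) = 2 * (\<Sum>k\<in>UNIV. ?T k m l)"
        unfolding dx_sym[OF x y, of _ _ m]
        by (simp add: sum_distrib_left sum.distrib[symmetric] dx_sym[OF x y, of _ m] algebra_simps)
      have R: "dy m (b m l) x y * P l x y + b m l x y *
          (\<Sum>k\<in>UNIV. \<Sum>s\<in>UNIV. (2 * dy m (dx k (ca l s)) x y - dy m (dx l (ca k s)) x y) * (y $ k * y $ s))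
          = 2 * (\<Sum>k\<in>UNIV. \<Sum>s\<in>UNIV. ?R k s m l)"
        unfolding P_def by (simp add: sum_distrib_left sum.distrib[symmetric] algebra_simps)
      show ?thesis using T R unfolding dy_P[OF x y] by (simp add: distrib_left)
    qed
    have "(\<Sum>m\<in>UNIV. 1/4 * (\<Sum>l\<in>UNIV. dy m (b m l) x y * P l x y + b m l x y * dy m (P l) x y)) =
        (\<Sum>m\<in>UNIV. \<Sum>l\<in>UNIV. 1/4 * (dy m (b m l) x y * P l x y + b m l x y * dy m (P l) x y))"
      by (simp only: sum_distrib_left)
    also have "\<dots> = (\<Sum>m\<in>UNIV. \<Sum>l\<in>UNIV. 1/2 * (\<Sum>k\<in>UNIV. ?T k m l) + 1/2 * (\<Sum>k\<in>UNIV. \<Sum>s\<in>UNIV. ?R k s m l))"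
      by (simp only: e)
    also have "\<dots> = 1/2 * (\<Sum>m\<in>UNIV. \<Sum>l\<in>UNIV. \<Sum>k\<in>UNIV. ?T k m l)
        + 1/2 * (\<Sum>m\<in>UNIV. \<Sum>l\<in>UNIV. \<Sum>k\<in>UNIV. \<Sum>s\<in>UNIV. ?R k s m l)"
      by (simp only: sum.distrib sum_distrib_left[symmetric])
    also have "(\<Sum>m\<in>UNIV. \<Sum>l\<in>UNIV. \<Sum>k\<in>UNIV. ?T k m l) = (\<Sum>k\<in>UNIV. \<Sum>m\<in>UNIV. \<Sum>l\<in>UNIV. ?T k m l)"
      by (rule sum_swap3)
    also have "(\<Sum>m\<in>UNIV. \<Sum>l\<in>UNIV. \<Sum>k\<in>UNIV. \<Sum>s\<in>UNIV. ?R k s m l) =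
        (\<Sum>k\<in>UNIV. \<Sum>m\<in>UNIV. \<Sum>l\<in>UNIV. \<Sum>s\<in>UNIV. ?R k s m l)"
      by (rule sum_swap3)
    also have "\<dots> = (\<Sum>k\<in>UNIV. \<Sum>s\<in>UNIV. \<Sum>m\<in>UNIV. \<Sum>l\<in>UNIV. ?R k s m l)"
      by (intro sum.cong refl sum_swap3)
    finally show ?thesis .
  qed
  have 4: "(\<Sum>r\<in>UNIV. \<Sum>s\<in>UNIV. y $ r * y $ s * ca r s x y * b m l x y) = Q x y * b m l x y" for m l
    by (simp add: Q_def sum_distrib_right)
  have 5: "1/2 * (\<Sum>l\<in>UNIV. cc l x y * Lx l) = 1/2 * (n * W x y) -
      1/4 * (\<Sum>l\<in>UNIV. (\<Sum>m\<in>UNIV. b m l x y * A m + Q x y * dy m (b m l) x y) * Lx l)"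
  proof -
    have "cc l x y * Lx l = n * (y $ l * Lx l) -
        1/2 * ((\<Sum>m\<in>UNIV. b m l x y * A m + Q x y * dy m (b m l) x y) * Lx l)" for l
      unfolding cc_eq A_def n_def by (simp only: left_diff_distrib mult.assoc)
    then show ?thesis
      by (simp only: sum_subtractf sum_distrib_left[symmetric] W) simp
  qed
  have 6: "1/2 * (\<Sum>m\<in>UNIV. \<Sum>l\<in>UNIV. (y $ m * y $ l - 1/2 * (Q x y * b m l x y)) * Lxy m l) =
      1/2 * (\<Sum>m\<in>UNIV. \<Sum>l\<in>UNIV. y $ m * y $ l * Lxy m l) -
      1/4 * (\<Sum>m\<in>UNIV. \<Sum>l\<in>UNIV. Q x y * b m l x y * Lxy m l)"
    by (simp add: left_diff_distrib sum_subtractf right_diff_distrib sum_divide_distrib[symmetric])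
  have "(\<Sum>m\<in>UNIV. barthel F m m x y) =
      (\<Sum>m\<in>UNIV. 1/2 * (W x y + y $ m * dy m W x y))
      - (\<Sum>m\<in>UNIV. 1/4 * (dy m Q x y * V m x y + Q x y * dy m (V m) x y))
      + (\<Sum>m\<in>UNIV. 1/4 * (\<Sum>l\<in>UNIV. dy m (b m l) x y * P l x y + b m l x y * dy m (P l) x y))"
    unfolding dy_spray[OF x y] by (simp only: sum.distrib sum_subtractf)
  then show ?thesis
    unfolding S_curvature_def 4 Lx_def[symmetric] Lxy_def[symmetric] 5 6 1 2 3 by (simp add: add_divide_distrib)
qed

section \<open>Rationality of S reduced to a contraction\<close>

lemma cc_rat: "rat (cc l)"
  unfolding cc_def by (intro rat_diff rat_mult rat_const rat_coord rat_sum rat_add rat_pd b_rat ca_rat)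

lemma \<sigma>_rat: "rat (\<lambda>x y. pderiv_at m (\<lambda>x. ln (\<sigma> x)) x)"
proof -
  have "smooth_on U (\<lambda>x. ln (\<sigma> x))" by (rule smooth_on_ln[OF open_dom \<sigma>_sm \<sigma>_pos])
  from rat_pd[OF rat_fst[OF this], of "ex m"] show ?thesis
    by (rule rat_cong) (rule pd_ex_const)
qed

text \<open>Apart from the contraction, L enters only through \<open>dy m (dx l L)\<close>, which is
  rational whether or not \<open>dx l L\<close> is.\<close>

lemma S_rest_rat: "rat (\<lambda>x y. S_curvature F \<sigma> x y - 1/2 * (\<Sum>l\<in>UNIV. cc l x y * dx l L x y))"
proof (rule rat_cong)
  show "rat (\<lambda>x y. 1/2 * (\<Sum>m\<in>UNIV. \<Sum>l\<in>UNIV.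
         (y $ m * y $ l - 1/2 * (\<Sum>r\<in>UNIV. \<Sum>s\<in>UNIV. y $ r * y $ s * ca r s x y * b m l x y))
         * dy m (dx l L) x y)
    + 1/2 * (\<Sum>k\<in>UNIV. \<Sum>m\<in>UNIV. \<Sum>l\<in>UNIV. y $ k * b m l x y *
         (dx m (ca l k) x y + dx k (ca l m) x y - dx l (ca m k) x y))
    + 1/2 * (\<Sum>k\<in>UNIV. \<Sum>s\<in>UNIV. \<Sum>m\<in>UNIV. \<Sum>l\<in>UNIV. y $ k * y $ s *
         (dy m (b m l) x y * (dx k (ca l s) x y - 1/2 * dx l (ca k s) x y)
          + b m l x y * (dy m (dx k (ca l s)) x y - 1/2 * dy m (dx l (ca k s)) x y)))
    - (\<Sum>m\<in>UNIV. y $ m * pderiv_at m (\<lambda>x. ln (\<sigma> x)) x))"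
    by (intro rat_diff rat_add rat_mult rat_const rat_sum rat_coord dy_dx_L_rat \<sigma>_rat b_rat ca_rat
        rat_pd[OF ca_rat] rat_pd[OF b_rat] rat_pd[OF rat_pd[OF ca_rat]])
qed (simp add: S_curvature_eq)

lemma S_rat_iff_contraction:
  "rat (S_curvature F \<sigma>) \<longleftrightarrow> rat (\<lambda>x y. \<Sum>l\<in>UNIV. cc l x y * dx l L x y)"
proof
  assume "rat (S_curvature F \<sigma>)"
  from rat_mult[OF rat_const[of 2] rat_diff[OF this S_rest_rat]]
  show "rat (\<lambda>x y. \<Sum>l\<in>UNIV. cc l x y * dx l L x y)" by (rule rat_cong) simp
next
  assume "rat (\<lambda>x y. \<Sum>l\<in>UNIV. cc l x y * dx l L x y)"
  from rat_add[OF S_rest_rat rat_mult[OF rat_const[of "1/2"] this]]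
  show "rat (S_curvature F \<sigma>)" by (rule rat_cong) simp
qed

text \<open>\<open>D\<close> is the logarithm of \<open>\<bar>det g\<bar>\<close>; the square spares a proof that the determinant is positive.\<close>

definition lndet where "lndet = (\<lambda>x y. 1/2 * ln ((det (a x y))\<^sup>2))"
definition D where "D = (\<lambda>x y. real CARD('n) * L x y + lndet x y)"

lemma det_sm: "sm (\<lambda>x y. det (a x y))" by (rule rat_sm[OF rat_det[OF a_rat]])

lemma det_sq_pos: "x \<in> U \<Longrightarrow> y \<noteq> 0 \<Longrightarrow> det (a x y) * det (a x y) > 0"
  using det_a[of x y] not_real_square_gt_zero by blast

lemma lndet_sm: "sm lndet"
proof -
  have "sm (\<lambda>x y. ln (det (a x y) * det (a x y)))"
    by (rule sm_ln[OF sm_mult[OF det_sm det_sm]]) (simp add: det_sq_pos)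
  then show ?thesis unfolding lndet_def power2_eq_square by (rule sm_mult[OF sm_const])
qed

lemma D_sm: "sm D"
  unfolding D_def by (intro sm_add sm_mult sm_const L_sm lndet_sm)

lemma pd_lndet:
  assumes x: "x \<in> U" and y: "y \<noteq> 0"
  shows "pd e lndet x y = (\<Sum>i\<in>UNIV. \<Sum>k\<in>UNIV. pd e (ca i k) x y * b k i x y)"
proof -
  have nz: "det (a x y) \<noteq> 0" by (rule det_a[OF x y])
  have y': "y \<in> - {0}" using y by simp
  have sq: "sm (\<lambda>x y. det (a x y) * det (a x y))" by (rule sm_mult[OF det_sm det_sm])
  have pos: "det (a x y) * det (a x y) > 0" if "x \<in> U" "y \<in> - {0}" for x y
    using det_sq_pos that by simp
  have "pd e lndet x y = 1/2 * (pd e (\<lambda>x y. det (a x y) * det (a x y)) x y / (det (a x y) * det (a x y)))"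
    unfolding lndet_def power2_eq_square
    by (simp only: pd_cmult[OF x y' sm_ln[OF sq pos]] pd_ln[OF x y' sq pos])
  also have "pd e (\<lambda>x y. det (a x y) * det (a x y)) x y = 2 * det (a x y) * pd e (\<lambda>x y. det (a x y)) x y"
    by (simp add: pd_mult[OF x y' det_sm det_sm])
  also have "pd e (\<lambda>x y. det (a x y)) x y = det (a x y) *
      (\<Sum>i\<in>UNIV. \<Sum>k\<in>UNIV. pd e (ca i k) x y * b k i x y)"
    unfolding ca_def b_def by (rule pd_det[OF x y' rat_sm[OF a_rat] nz])
  finally show ?thesis using nz by simp
qed

lemma pd_lndet_rat: "rat (pd e lndet)"
proof (rule rat_cong)
  show "rat (\<lambda>x y. \<Sum>i\<in>UNIV. \<Sum>k\<in>UNIV. pd e (ca i k) x y * b k i x y)"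
    by (intro rat_sum rat_mult rat_pd[OF ca_rat] b_rat)
qed (simp add: pd_lndet)

lemma pd_D: "x \<in> U \<Longrightarrow> y \<noteq> 0 \<Longrightarrow> pd e D x y = real CARD('n) * pd e L x y + pd e lndet x y"
  unfolding D_def by (simp add: pd_add pd_cmult base_sm lndet_sm)

lemma dy_D_rat: "rat (dy m D)"
proof (rule rat_cong)
  show "rat (\<lambda>x y. real CARD('n) * dy m L x y + dy m lndet x y)"
    by (intro rat_add rat_mult rat_const dy_L_rat pd_lndet_rat)
qed (simp add: pd_D)

lemma dx_D_rat_iff: "rat (dx l D) \<longleftrightarrow> rat (dx l L)"
proof
  assume "rat (dx l D)"
  from rat_mult[OF rat_const[of "1 / real CARD('n)"] rat_diff[OF this pd_lndet_rat[of "ex l"]]]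
  show "rat (dx l L)" by (rule rat_cong) (simp add: pd_D)
next
  assume "rat (dx l L)"
  from rat_add[OF rat_mult[OF rat_const[of "real CARD('n)"] this] pd_lndet_rat[of "ex l"]]
  show "rat (dx l D)" by (rule rat_cong) (simp add: pd_D)
qed

lemma dy_dx_D_rat: "rat (dy m (dx l D))"
  by (rule rat_cong[OF rat_pd[OF dy_D_rat[of m], of "ex l"] pd_commute[OF D_sm]]) auto

section \<open>The coefficient vector in terms of the determinant\<close>

lemma pd_b:
  assumes x: "x \<in> U" and y: "y \<noteq> 0"
  shows "pd e (b i l) x y = - (\<Sum>s\<in>UNIV. (\<Sum>k\<in>UNIV. b i k x y * pd e (ca k s) x y) * b s l x y)"
proof -
  have z: "(\<Sum>k\<in>UNIV. pd e (b i k) x y * ca k s x y) = - (\<Sum>k\<in>UNIV. b i k x y * pd e (ca k s) x y)" for s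
  proof -
    have "pd e (\<lambda>x y. \<Sum>k\<in>UNIV. b i k x y * ca k s x y) x y = pd e (\<lambda>x y. if i = s then 1 else 0) x y"
      by (rule pd_cong) (use x y ba in auto)
    then have "(\<Sum>k\<in>UNIV. pd e (b i k) x y * ca k s x y + b i k x y * pd e (ca k s) x y) = 0"
      using x y by (simp add: pd_sum pd_mult base_sm pd_const)
    then show ?thesis by (simp add: sum.distrib eq_neg_iff_add_eq_0)
  qed
  have "pd e (b i l) x y = (\<Sum>k\<in>UNIV. (if k = l then 1 else 0) * pd e (b i k) x y)"
    by (simp only: sum_delta_left)
  also have "\<dots> = (\<Sum>k\<in>UNIV. (\<Sum>s\<in>UNIV. ca k s x y * b s l x y) * pd e (b i k) x y)"
    by (simp only: ab[OF x y])
  also have "\<dots> = (\<Sum>s\<in>UNIV. (\<Sum>k\<in>UNIV. pd e (b i k) x y * ca k s x y) * b s l x y)"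
    unfolding sum_distrib_right by (subst sum.swap) (simp add: mult_ac)
  finally show ?thesis by (simp add: z sum_negf)
qed

text \<open>By \<open>dy_metric_sym\<close> the derivative index s can be taken out of the trace
  over m and k, where Jacobi's formula turns it into \<open>dy s D - dy s L\<close>. The L terms
  cancel against those of \<open>Q_dy_L\<close>.\<close>

lemma cc_eq_D:
  assumes x: "x \<in> U" and y: "y \<noteq> 0"
  shows "cc l x y = real CARD('n) * y $ l + 1/2 * (Q x y * (\<Sum>j\<in>UNIV. b l j x y * dy j D x y))"
proof -
  define n where "n = real CARD('n)"
  have tr: "(\<Sum>m\<in>UNIV. \<Sum>k\<in>UNIV. b m k x y * dy m (ca k s) x y) = dy s D x y - dy s L x y" for s
  proof -
    have "(\<Sum>m\<in>UNIV. \<Sum>k\<in>UNIV. b m k x y * dy m (ca k s) x y) =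
        (\<Sum>m\<in>UNIV. \<Sum>k\<in>UNIV. b m k x y * dy s (ca k m) x y)
        + dy s L x y * (\<Sum>m\<in>UNIV. \<Sum>k\<in>UNIV. b m k x y * ca k m x y)
        - (\<Sum>m\<in>UNIV. dy m L x y * (\<Sum>k\<in>UNIV. b m k x y * ca k s x y))"
      unfolding dy_metric_sym[OF x y, of _ _ s]
      by (simp add: sum.distrib sum_subtractf sum_distrib_left algebra_simps)
    also have "(\<Sum>m\<in>UNIV. \<Sum>k\<in>UNIV. b m k x y * ca k m x y) = n"
      by (simp add: ba[OF x y] n_def)
    also have "(\<Sum>m\<in>UNIV. dy m L x y * (\<Sum>k\<in>UNIV. b m k x y * ca k s x y)) = dy s L x y"
      unfolding ba[OF x y] by (simp add: if_distrib[of "\<lambda>x. _ * x"] cong: if_cong)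
    also have "(\<Sum>m\<in>UNIV. \<Sum>k\<in>UNIV. b m k x y * dy s (ca k m) x y) = dy s lndet x y"
      unfolding pd_lndet[OF x y] by (subst sum.swap) (simp add: mult.commute)
    finally show ?thesis by (simp add: pd_D[OF x y] n_def)
  qed
  have "(\<Sum>m\<in>UNIV. dy m (b m l) x y) =
      - (\<Sum>s\<in>UNIV. (\<Sum>m\<in>UNIV. \<Sum>k\<in>UNIV. b m k x y * dy m (ca k s) x y) * b s l x y)"
    unfolding pd_b[OF x y] sum_distrib_right sum_negf by (subst sum.swap) simp
  also have "\<dots> = - (\<Sum>s\<in>UNIV. b l s x y * dy s D x y) + (\<Sum>s\<in>UNIV. b s l x y * dy s L x y)"
    unfolding tr by (simp add: right_diff_distrib sum_subtractf b_sym[OF x y, of l] mult.commute)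
  finally have div: "(\<Sum>m\<in>UNIV. dy m (b m l) x y) =
      - (\<Sum>s\<in>UNIV. b l s x y * dy s D x y) + (\<Sum>s\<in>UNIV. b s l x y * dy s L x y)" .
  have A: "(\<Sum>r\<in>UNIV. \<Sum>s\<in>UNIV. y $ r * y $ s * dy m (ca r s) x y) = - (Q x y * dy m L x y)" for m
    using Q_dy_L[OF x y, of m] by simp
  have "(\<Sum>m\<in>UNIV. b m l x y * - (Q x y * dy m L x y) + Q x y * dy m (b m l) x y) =
      Q x y * ((\<Sum>m\<in>UNIV. dy m (b m l) x y) - (\<Sum>m\<in>UNIV. b m l x y * dy m L x y))"
    by (simp add: sum_subtractf[symmetric] sum_distrib_left algebra_simps)
  then show ?thesis unfolding cc_eq A by (simp add: div)
qed

section \<open>The fibres as Minkowski spaces\<close>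

lemma minkowski_fibre:
  assumes x: "x \<in> U"
  shows "minkowski (F x) (\<lambda>y. \<eta> x y *\<^sub>R (a x y *v y)) (\<lambda>y. \<eta> x y *\<^sub>R a x y) (D x) (\<lambda>y. \<chi> j. dy j D x y)"
proof
  fix y :: "real ^ 'n" assume y: "y \<noteq> 0"
  have y': "y \<in> - {0}" using y by simp
  have F2: "(F x y)\<^sup>2 = \<eta> x y * Q x y" using L2_eq[OF x y] by (simp add: L2_def)
  then have "(F x y)\<^sup>2 > 0" using \<eta>_pos[OF x y] Q_pos[OF x y] by simp
  then show Fp: "F x y > 0" using F_nonneg[OF x y] by (cases "F x y = 0") auto
  have p: "(\<eta> x y *\<^sub>R (a x y *v y)) $ i = 1/2 * dy i L2 x y" for i
    by (simp add: dy_L2[OF x y] matrix_vector_mult_def ca_def sum_distrib_left mult_ac)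
  have dyF: "dy i L2 x y = 2 * F x y * dy i F x y" for i
    unfolding L2_def power2_eq_square by (simp add: pd_mult[OF x y' F_sm F_sm])
  show "(F x has_derivative (\<lambda>v. ((\<eta> x y *\<^sub>R (a x y *v y)) \<bullet> v) / F x y)) (at y)"
  proof (rule has_derivative_eq_rhs[OF fibre_has_derivative[OF x y' F_sm]])
    define pv where "pv = \<eta> x y *\<^sub>R (a x y *v y)"
    have "pv $ i = F x y * dy i F x y" for i unfolding pv_def p dyF by simp
    then have "(\<chi> i. dy i F x y) = (1 / F x y) *\<^sub>R pv"
      using Fp by (simp add: vec_eq_iff)
    then have "(\<chi> i. dy i F x y) = (1 / F x y) *\<^sub>R (\<eta> x y *\<^sub>R (a x y *v y))" by (simp only: pv_def)
    then show "(\<lambda>v. (\<chi> i. dy i F x y) \<bullet> v) = (\<lambda>v. ((\<eta> x y *\<^sub>R (a x y *v y)) \<bullet> v) / F x y)"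
      by simp
  qed
  show "((\<lambda>y. \<eta> x y *\<^sub>R (a x y *v y)) has_derivative (\<lambda>v. (\<eta> x y *\<^sub>R a x y) *v v)) (at y)"
  proof (rule has_derivative_vecI)
    fix i
    have "((\<lambda>y. 1/2 * dy i L2 x y) has_derivative (\<lambda>v. 1/2 * ((\<chi> j. dy j (dy i L2) x y) \<bullet> v))) (at y)"
      by (intro has_derivative_mult_right fibre_has_derivative[OF x y' sm_pd[OF L2_sm]])
    moreover have "1/2 * ((\<chi> j. dy j (dy i L2) x y) \<bullet> v) = ((\<eta> x y *\<^sub>R a x y) *v v) $ i" for v
      using dy_dy_L2[OF x y, of _ i] a_sym[OF x y, of _ i]
      by (simp add: inner_vec_def matrix_vector_mult_def sum_distrib_left ca_def mult_ac)
    ultimately have "((\<lambda>y. 1/2 * dy i L2 x y) has_derivative (\<lambda>v. ((\<eta> x y *\<^sub>R a x y) *v v) $ i)) (at y)"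
      by simp
    then show "((\<lambda>y. (\<eta> x y *\<^sub>R (a x y *v y)) $ i) has_derivative (\<lambda>v. ((\<eta> x y *\<^sub>R a x y) *v v) $ i)) (at y)"
    proof (rule has_derivative_transform_within_open[of _ _ _ _ "- {0}"])
      fix z :: "real ^ 'n" assume "z \<in> - {0}"
      then have z: "z \<noteq> 0" by simp
      show "1/2 * dy i L2 x z = (\<eta> x z *\<^sub>R (a x z *v z)) $ i"
        by (simp add: dy_L2[OF x z] matrix_vector_mult_def ca_def sum_distrib_left mult_ac)
    qed (use y' in auto)
  qed
  show "(\<eta> x y *\<^sub>R (a x y *v y)) \<bullet> y = (F x y)\<^sup>2"
    unfolding F2 Q_inner by (simp add: inner_commute)
  show "(\<eta> x y *\<^sub>R a x y) *v y = \<eta> x y *\<^sub>R (a x y *v y)"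
    by (simp add: scaleR_matrix_vector_assoc)
  show "sym_posdef (\<eta> x y *\<^sub>R a x y)" using g_posdef[OF x y] g_eq[OF x y] by simp
  show "(D x has_derivative (\<lambda>v. (\<chi> j. dy j D x y) \<bullet> v)) (at y)"
    by (rule fibre_has_derivative[OF x y' D_sm])
  \<comment> \<open>Only the product \<eta> a is homogeneous, while \<eta> and a separately need not
    be. Hence D is formed from the determinant of the metric and not from that of a.\<close>
  have sc: "\<eta> x (t *\<^sub>R y) *\<^sub>R a x (t *\<^sub>R y) = \<eta> x y *\<^sub>R a x y" if "t > 0" for t
    using g_scale[OF x y that] by (simp add: vec_eq_iff)
  have Dsc: "D x (t *\<^sub>R y) = D x y" if t: "t > 0" for t
  proof -
    have DE: "D x z = 1/2 * ln ((det (\<eta> x z *\<^sub>R a x z))\<^sup>2)" if z: "z \<noteq> 0" for z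
    proof -
      have \<eta>: "\<eta> x z > 0" by (rule \<eta>_pos[OF x z])
      have "ln ((det (\<eta> x z *\<^sub>R a x z))\<^sup>2) = ln (\<eta> x z ^ (2 * CARD('n)) * (det (a x z))\<^sup>2)"
        by (simp add: det_scaleR power_mult_distrib power_mult[symmetric] mult.commute)
      also have "\<dots> = real (2 * CARD('n)) * ln (\<eta> x z) + ln ((det (a x z))\<^sup>2)"
        using \<eta> det_a[OF x z] by (subst ln_mult_pos) (auto simp: ln_realpow)
      finally show ?thesis by (simp add: D_def L_def lndet_def)
    qed
    have "t *\<^sub>R y \<noteq> 0" using y t by simp
    from DE[OF this] show ?thesis unfolding DE[OF y] sc[OF t] .
  qed
  show "(\<chi> j. dy j D x y) \<bullet> y = 0"
    using euler[OF D_sm x y, of 0] Dsc by (simp add: inner_vec_def mult.commute)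
  fix t :: real assume t: "t > 0"
  show "F x (t *\<^sub>R y) = t * F x y" by (rule F_scale[OF x y t])
  show "\<eta> x (t *\<^sub>R y) *\<^sub>R (a x (t *\<^sub>R y) *v (t *\<^sub>R y)) = t *\<^sub>R (\<eta> x y *\<^sub>R (a x y *v y))"
  proof -
    have "\<eta> x (t *\<^sub>R y) *\<^sub>R (a x (t *\<^sub>R y) *v (t *\<^sub>R y)) = (\<eta> x (t *\<^sub>R y) *\<^sub>R a x (t *\<^sub>R y)) *v (t *\<^sub>R y)"
      by (simp add: scaleR_matrix_vector_assoc)
    also have "\<dots> = t *\<^sub>R (\<eta> x y *\<^sub>R (a x y *v y))"
      unfolding sc[OF t] by (simp add: matrix_vector_mult_scaleR scaleR_matrix_vector_assoc)
    finally show ?thesis .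
  qed
  show "D x (t *\<^sub>R y) = D x y" by (rule Dsc[OF t])
qed

text \<open>This is F^2 g^{lj} \<partial>D/\<partial>y^j: the \<eta> in F^2 cancels the one in the
  inverse metric, so X is rational up to the derivatives of D, which are rational too.\<close>

definition X where "X x y = (\<chi> l. Q x y * (\<Sum>j\<in>UNIV. b l j x y * dy j D x y))"

lemma metric_X:
  assumes x: "x \<in> U" and y: "y \<noteq> 0"
  shows "(\<eta> x y *\<^sub>R a x y) *v X x y = (F x y)\<^sup>2 *\<^sub>R (\<chi> j. dy j D x y)"
proof -
  have "(\<Sum>l\<in>UNIV. ca k l x y * (\<Sum>j\<in>UNIV. b l j x y * dy j D x y)) = dy k D x y" for k
  proof -
    have "(\<Sum>l\<in>UNIV. ca k l x y * (\<Sum>j\<in>UNIV. b l j x y * dy j D x y)) =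
        (\<Sum>j\<in>UNIV. (\<Sum>l\<in>UNIV. ca k l x y * b l j x y) * dy j D x y)"
      unfolding sum_distrib_left sum_distrib_right by (subst sum.swap) (simp add: mult_ac)
    also have "\<dots> = dy k D x y" unfolding ab[OF x y] by (simp only: sum_delta_left)
    finally show ?thesis .
  qed
  then have "\<eta> x y * Q x y * (\<Sum>l\<in>UNIV. ca k l x y * (\<Sum>j\<in>UNIV. b l j x y * dy j D x y)) =
      (F x y)\<^sup>2 * dy k D x y" for k
    using L2_eq[OF x y] by (simp add: L2_def)
  then show ?thesis
    by (simp add: vec_eq_iff matrix_vector_mult_def X_def sum_distrib_left ca_def[symmetric] mult_ac)
       (simp add: ca_def mult_ac)
qed

text \<open>Symmetry of the metric shifts it from y to X, where it produces the gradient of D, and D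
  is constant along rays.\<close>

lemma X_orth:
  assumes x: "x \<in> U" and y: "y \<noteq> 0"
  shows "(\<eta> x y *\<^sub>R (a x y *v y)) \<bullet> X x y = 0"
proof -
  interpret M: minkowski "F x" "\<lambda>y. \<eta> x y *\<^sub>R (a x y *v y)" "\<lambda>y. \<eta> x y *\<^sub>R a x y" "D x" "\<lambda>y. \<chi> j. dy j D x y"
    by (rule minkowski_fibre[OF x])
  have "((\<eta> x y *\<^sub>R a x y) *v y) \<bullet> X x y = y \<bullet> ((F x y)\<^sup>2 *\<^sub>R (\<chi> j. dy j D x y))"
    using M.G_sym[OF y, of y "X x y"] metric_X[OF x y] by simp
  then show ?thesis using M.d_self[OF y] M.G_self[OF y] by (simp add: inner_commute)
qed

lemma cc_inner:
  assumes x: "x \<in> U" and y: "y \<noteq> 0"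
  shows "(\<Sum>l\<in>UNIV. h $ l * cc l x y) = real CARD('n) * (h \<bullet> y) + 1/2 * (h \<bullet> X x y)"
  by (simp add: cc_eq_D[OF x y] X_def inner_vec_def sum.distrib sum_distrib_left sum_divide_distrib distrib_left mult_ac)

lemma cc_independent:
  assumes x: "x \<in> U" and h: "\<And>y. y \<noteq> 0 \<Longrightarrow> (\<Sum>l\<in>UNIV. h $ l * cc l x y) = 0"
  shows "h = 0"
proof (rule ccontr)
  interpret M: minkowski "F x" "\<lambda>y. \<eta> x y *\<^sub>R (a x y *v y)" "\<lambda>y. \<eta> x y *\<^sub>R a x y" "D x" "\<lambda>y. \<chi> j. dy j D x y"
    by (rule minkowski_fibre[OF x])
  assume "h \<noteq> 0"
  then obtain y where y: "y \<noteq> 0" "\<eta> x y *\<^sub>R (a x y *v y) = h" by (rule M.legendre_surj)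
  have "h \<bullet> X x y = 0" using X_orth[OF x y(1)] unfolding y(2) .
  then have "h \<bullet> y = 0" using h[OF y(1)] cc_inner[OF x y(1), of h] by simp
  then show False using M.p_self[OF y(1)] M.N_pos[OF y(1)] unfolding y(2) by simp
qed

lemma dx_L_rat_if_S_rat:
  assumes "rat (S_curvature F \<sigma>)"
  shows "rat (dx l L)"
proof -
  have R: "rat (\<lambda>x y. \<Sum>l\<in>UNIV. cc l x y * dx l L x y)"
    using assms S_rat_iff_contraction by simp
  show ?thesis
  \<comment> \<open>S supplies a single equation for the n unknowns; its fibre derivatives are
    generated inside \<open>rational_system\<close>.\<close>
  proof (rule rational_system[where T = "{()}" and C = "\<lambda>_. cc" and \<Psi> = "\<lambda>l. dx l L"])
    fix \<Delta> N assume 1: "rat \<Delta>" "\<And>l. rat (N l)"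
      "\<And>x y l. x \<in> U \<Longrightarrow> y \<noteq> 0 \<Longrightarrow> \<Delta> x y * dx l L x y = N l x y"
    assume nz: "\<And>x y. x \<in> U \<Longrightarrow> (\<And>h. (\<And>t y. t \<in> {()} \<Longrightarrow> y \<noteq> 0 \<Longrightarrow> (\<Sum>l\<in>UNIV. h $ l * cc l x y) = 0) \<Longrightarrow> h = 0) \<Longrightarrow>
       y \<noteq> 0 \<Longrightarrow> \<Delta> x y \<noteq> 0"
    have nz': "\<Delta> x y \<noteq> 0" if xy: "x \<in> U" "y \<noteq> 0" for x y
      by (rule nz[OF xy(1) _ xy(2)], rule cc_independent[OF xy(1)]) simp
    have "rat (\<lambda>x y. N l x y / \<Delta> x y)" by (rule rat_divide[OF 1(2,1) nz'])
    then show "rat (dx l L)"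
    proof (rule rat_cong)
      fix x y :: "real ^ 'n" assume xy: "x \<in> U" "y \<noteq> 0"
      show "N l x y / \<Delta> x y = dx l L x y" using 1(3)[OF xy, of l] nz'[OF xy] by (simp add: field_simps)
    qed
  qed (use R in \<open>auto intro: cc_rat sm_pd L_sm dy_dx_L_rat\<close>)
qed

end

section \<open>Rationality of E\<close>

lemma (in slit) rat_contraction_dy:
  assumes c: "\<And>l. rat (c l)" and \<Psi>: "\<And>l. sm (\<Psi> l)" "\<And>l m. rat (pd (ey m) (\<Psi> l))"
  shows "rat (\<lambda>x y. pd (ey m) (\<lambda>x y. \<Sum>l\<in>UNIV. c l x y * \<Psi> l x y) x y
    - (\<Sum>l\<in>UNIV. pd (ey m) (c l) x y * \<Psi> l x y))"
proof (rule rat_cong)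
  show "rat (\<lambda>x y. \<Sum>l\<in>UNIV. c l x y * pd (ey m) (\<Psi> l) x y)"
    \<comment> \<open>The other half of the product rule: modulo rational functions a fibre
      derivative of the contraction acts on its coefficients alone.\<close>
    by (intro rat_sum rat_mult c \<Psi>)
qed (simp add: pd_sum pd_mult sm_mult rat_sm[OF c] \<Psi>(1) sum.distrib)

context AR_chart
begin

text \<open>Vanishing second derivatives make h_l c^l affine on the punctured fibre, which is
  connected in dimension at least two. The orthogonality of X removes the constant term, and a
  linear contraction would force D to be constant.\<close>

lemma nonconstant_independent:
  assumes n: "CARD('n) \<ge> 2" and x: "x \<in> U" and y1: "y1 \<noteq> 0" and y2: "y2 \<noteq> 0" and D12: "D x y1 \<noteq> D x y2"
    and h: "\<And>i j y. y \<noteq> 0 \<Longrightarrow> (\<Sum>l\<in>UNIV. h $ l * dy i (dy j (cc l)) x y) = 0"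
  shows "h = 0"
proof (rule ccontr)
  interpret M: minkowski "F x" "\<lambda>y. \<eta> x y *\<^sub>R (a x y *v y)" "\<lambda>y. \<eta> x y *\<^sub>R a x y" "D x" "\<lambda>y. \<chi> j. dy j D x y"
    by (rule minkowski_fibre[OF x])
  assume h0: "h \<noteq> 0"
  let ?Z = "\<lambda>x y. \<Sum>l\<in>UNIV. h $ l * cc l x y"
  have ccs: "sm (cc l)" for l by (rule rat_sm[OF cc_rat])
  have Zs: "sm ?Z" by (intro sm_sum sm_mult sm_const ccs)
  have conn: "connected (- {0 :: real ^ 'n})"
    using connected_punctured_universe[of "0 :: real ^ 'n"] n by simp
  have opn: "open (- {0 :: real ^ 'n})" by (simp add: open_Compl)
  have dZ: "dy j ?Z x y = (\<Sum>l\<in>UNIV. h $ l * dy j (cc l) x y)" if "x \<in> U" "y \<noteq> 0" for j x y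
    using that by (simp add: pd_sum pd_cmult sm_mult sm_const ccs)
  have ddZ: "dy i (dy j ?Z) x y = 0" if y: "y \<noteq> 0" for i j y
  proof -
    have "dy i (dy j ?Z) x y = dy i (\<lambda>x y. \<Sum>l\<in>UNIV. h $ l * dy j (cc l) x y) x y"
      by (rule pd_cong) (use x y dZ in auto)
    also have "\<dots> = 0"
      using x y h[OF y, of i j] by (simp add: pd_sum pd_cmult sm_mult sm_const sm_pd ccs)
    finally show ?thesis .
  qed
  have const: "dy j ?Z x y = dy j ?Z x y1" if y: "y \<noteq> 0" for j y
  proof (rule has_derivative_zero_unique_connected[OF opn conn])
    fix z :: "real ^ 'n" assume z: "z \<in> - {0}"
    from fibre_has_derivative[OF x z sm_pd[OF Zs, of "ey j"]]
    show "((\<lambda>y. dy j ?Z x y) has_derivative (\<lambda>v. 0)) (at z)"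
      using z by (simp add: ddZ zero_vec_def[symmetric])
  qed (use y y1 in auto)
  define u where "u = (\<chi> j. dy j ?Z x y1)"
  define c where "c = ?Z x y1 - u \<bullet> y1"
  have Z: "?Z x y = u \<bullet> y + c" if y: "y \<noteq> 0" for y
  proof -
    have "?Z x y - u \<bullet> y = ?Z x y1 - u \<bullet> y1"
    proof (rule has_derivative_zero_unique_connected[OF opn conn])
      fix z :: "real ^ 'n" assume z: "z \<in> - {0}"
      have "(\<chi> j. dy j ?Z x z) = u" using const[of z] z by (simp add: u_def)
      with fibre_has_derivative[OF x z Zs]
      have "((\<lambda>y. ?Z x y) has_derivative (\<lambda>v. u \<bullet> v)) (at z)" by simp
      moreover have "((\<lambda>y. u \<bullet> y) has_derivative (\<lambda>v. u \<bullet> v)) (at z)"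
        by (auto intro!: derivative_eq_intros)
      ultimately show "((\<lambda>y. ?Z x y - u \<bullet> y) has_derivative (\<lambda>v. 0)) (at z)"
        using has_derivative_diff by fastforce
    qed (use y y1 in auto)
    then show ?thesis by (simp add: c_def)
  qed
  define w where "w = u - real CARD('n) *\<^sub>R h"
  have hX: "h \<bullet> X x y = 2 * (w \<bullet> y) + 2 * c" if y: "y \<noteq> 0" for y
    using Z[OF y] cc_inner[OF x y, of h] by (simp add: w_def inner_diff_left)
  obtain y0 where y0: "y0 \<noteq> 0" "\<eta> x y0 *\<^sub>R (a x y0 *v y0) = h" using M.legendre_surj[OF h0] by blast
  \<comment> \<open>Along the ray through y0 the Legendre transform is a multiple of h, so h
    \<bullet> X vanishes there; two values of t give c = 0.\<close>
  have ray: "t * (w \<bullet> y0) + c = 0" if t: "t > 0" for t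
  proof -
    have ty: "t *\<^sub>R y0 \<noteq> 0" using t y0 by simp
    have "(t *\<^sub>R h) \<bullet> X x (t *\<^sub>R y0) = 0"
      using X_orth[OF x ty] M.p_scale[OF y0(1) t] y0(2) by simp
    then show ?thesis using hX[OF ty] t by simp
  qed
  have c0: "c = 0" using ray[of 1] ray[of 2] by simp
  have "D x y1 = D x y2"
  proof (rule M.constant_if_contraction_linear[OF n h0 _ _ _ y1 y2, of "X x" w])
    fix y :: "real ^ 'n" assume y: "y \<noteq> 0"
    show "(\<eta> x y *\<^sub>R a x y) *v X x y = (F x y)\<^sup>2 *\<^sub>R (\<chi> j. dy j D x y)" by (rule metric_X[OF x y])
    show "h \<bullet> X x y = 2 * (w \<bullet> y)" using hX[OF y] c0 by simp
    have "sm (\<lambda>x y. Q x y * (\<Sum>j\<in>UNIV. b l j x y * dy j D x y))" for l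
      by (intro sm_mult sm_sum Q_sm b_sm sm_pd[OF D_sm])
    note fd = fibre_has_derivative[OF x _ this, of y]
    have "(X x has_derivative (\<lambda>v. \<chi> l. (\<chi> i. dy i (\<lambda>x y. Q x y * (\<Sum>j\<in>UNIV. b l j x y * dy j D x y)) x y) \<bullet> v)) (at y)"
      by (rule has_derivative_vecI) (use fd y in \<open>simp add: X_def\<close>)
    then show "X x differentiable at y" by (rule differentiableI)
  qed
  with D12 show False by simp
qed

text \<open>The unknowns are \<open>dx l D\<close>, which equal n times \<open>dx l L\<close> up to
  rational functions. Over an open set of base points where D is constant on the fibres,
  \<open>dx l D\<close> does not depend on the direction, while \<open>dx l L\<close> may.\<close>

lemma dx_L_rat_if_E_rat:
  assumes n: "CARD('n) \<ge> 2" and E: "\<And>i j. rat (E_curvature F \<sigma> i j)"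
  shows "rat (dx l L)"
proof -
  have \<Psi>: "sm (dx l D)" "rat (dy m (dx l D))" for l m
    by (rule sm_pd[OF D_sm]) (rule dy_dx_D_rat)
  define Z where "Z = (\<lambda>x y. \<Sum>l\<in>UNIV. cc l x y * dx l D x y)"
  have Zs: "sm Z" unfolding Z_def by (intro sm_sum sm_mult rat_sm[OF cc_rat] \<Psi>)
  \<comment> \<open>Since D = n L + lndet, the factor 1 / (2 n) matches the factor 1 / 2 of the
    contraction with \<open>dx l L\<close> in S.\<close>
  define R where "R = (\<lambda>x y. S_curvature F \<sigma> x y - 1 / (2 * real CARD('n)) * Z x y)"
  have R: "rat R"
  proof (rule rat_cong)
    show "rat (\<lambda>x y. (S_curvature F \<sigma> x y - 1/2 * (\<Sum>l\<in>UNIV. cc l x y * dx l L x y))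
        - 1 / (2 * real CARD('n)) * (\<Sum>l\<in>UNIV. cc l x y * dx l lndet x y))"
      by (intro rat_diff S_rest_rat rat_mult rat_const rat_sum cc_rat pd_lndet_rat)
    fix x y assume xy: "x \<in> U" "y \<noteq> (0 :: real ^ 'n)"
    have "Z x y = real CARD('n) * (\<Sum>l\<in>UNIV. cc l x y * dx l L x y) + (\<Sum>l\<in>UNIV. cc l x y * dx l lndet x y)"
      unfolding Z_def pd_D[OF xy] by (simp add: sum.distrib sum_distrib_left algebra_simps)
    then show "(S_curvature F \<sigma> x y - 1/2 * (\<Sum>l\<in>UNIV. cc l x y * dx l L x y))
        - 1 / (2 * real CARD('n)) * (\<Sum>l\<in>UNIV. cc l x y * dx l lndet x y) = R x y"
      by (simp add: R_def field_simps)
  qed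
  have Z2: "rat (dy i (dy j Z))" for i j
  proof -
    have S: "S_curvature F \<sigma> x y = R x y + 1 / (2 * real CARD('n)) * Z x y" for x y by (simp add: R_def)
    have Ss: "sm (\<lambda>x y. R x y + 1 / (2 * real CARD('n)) * Z x y)"
      by (intro sm_add sm_mult sm_const Zs rat_sm[OF R])
    have 1: "dy j (S_curvature F \<sigma>) x y = dy j R x y + 1 / (2 * real CARD('n)) * dy j Z x y"
      if "x \<in> U" "y \<noteq> 0" for x y j
    proof -
      have "S_curvature F \<sigma> = (\<lambda>x y. R x y + 1 / (2 * real CARD('n)) * Z x y)" using S by (intro ext)
      then show ?thesis using that by (simp add: pd_add pd_cmult[OF _ _ Zs] sm_mult sm_const Zs rat_sm[OF R] del: times_divide_eq_left)
    qed
    have 2: "dy i (dy j (S_curvature F \<sigma>)) x y = dy i (dy j R) x y + 1 / (2 * real CARD('n)) * dy i (dy j Z) x y"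
      if xy: "x \<in> U" "y \<noteq> 0" for x y
    proof -
      have "dy i (dy j (S_curvature F \<sigma>)) x y = dy i (\<lambda>x y. dy j R x y + 1 / (2 * real CARD('n)) * dy j Z x y) x y"
        by (rule pd_cong) (use xy 1 in auto)
      then show ?thesis
        using xy by (simp add: pd_add pd_cmult[OF _ _ sm_pd[OF Zs]] sm_mult sm_const sm_pd Zs rat_sm[OF R] del: times_divide_eq_left)
    qed
    have "rat (\<lambda>x y. 2 * real CARD('n) * (2 * E_curvature F \<sigma> i j x y - dy i (dy j R) x y))"
      by (intro rat_mult rat_const rat_diff E rat_pd[OF rat_pd[OF R]])
    then show ?thesis
      by (rule rat_cong) (simp add: E_curvature_def Dy_pd 2)
  qed
  have T: "rat (\<lambda>x y. \<Sum>l\<in>UNIV. dy i (dy j (cc l)) x y * dx l D x y)" for i j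
  proof -
    define T1 where "T1 = (\<lambda>x y. \<Sum>l\<in>UNIV. dy j (cc l) x y * dx l D x y)"
    have T1s: "sm T1" unfolding T1_def by (intro sm_sum sm_mult sm_pd[OF rat_sm[OF cc_rat]] \<Psi>)
    have r1: "rat (\<lambda>x y. dy j Z x y - T1 x y)"
      unfolding Z_def T1_def by (rule rat_contraction_dy[OF cc_rat \<Psi>])
    have r2: "rat (\<lambda>x y. dy i T1 x y - (\<Sum>l\<in>UNIV. dy i (dy j (cc l)) x y * dx l D x y))"
      unfolding T1_def by (rule rat_contraction_dy[OF rat_pd[OF cc_rat] \<Psi>])
    have "rat (\<lambda>x y. dy i (dy j Z) x y - dy i (\<lambda>x y. dy j Z x y - T1 x y) x y
        - (dy i T1 x y - (\<Sum>l\<in>UNIV. dy i (dy j (cc l)) x y * dx l D x y)))"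
      by (intro rat_diff[OF rat_diff[OF Z2 rat_pd[OF r1]] r2])
    then show ?thesis
      by (rule rat_cong) (simp add: pd_diff sm_pd[OF Zs] T1s)
  qed
  \<comment> \<open>W is taken as an interior so that the constancy of D on fibres persists near x
    and can be differentiated in the base. Together with V it is dense, but boundary points may be
    missed.\<close>
  define V where "V = {x \<in> U. \<exists>y z. y \<noteq> 0 \<and> z \<noteq> 0 \<and> D x y \<noteq> D x z}"
  define W where "W = interior {x \<in> U. \<forall>y z. y \<noteq> 0 \<longrightarrow> z \<noteq> 0 \<longrightarrow> D x y = D x z}"
  have WU: "W \<subseteq> U" unfolding W_def using interior_subset by blast
  have "rat (dx l D)"
  proof (rule rational_system[where T = "UNIV :: ('n \<times> 'n) set" and C = "\<lambda>t l. dy (fst t) (dy (snd t) (cc l))"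
        and \<Psi> = "\<lambda>l. dx l D"])
    fix \<Delta> N assume 1: "rat \<Delta>" "\<And>l. rat (N l)"
      "\<And>x y l. x \<in> U \<Longrightarrow> y \<noteq> 0 \<Longrightarrow> \<Delta> x y * dx l D x y = N l x y"
    assume nz: "\<And>x y. x \<in> U \<Longrightarrow> (\<And>h. (\<And>t y. t \<in> (UNIV :: ('n \<times> 'n) set) \<Longrightarrow> y \<noteq> 0 \<Longrightarrow>
        (\<Sum>l\<in>UNIV. h $ l * dy (fst t) (dy (snd t) (cc l)) x y) = 0) \<Longrightarrow> h = 0) \<Longrightarrow>
       y \<noteq> 0 \<Longrightarrow> \<Delta> x y \<noteq> 0"
    show ?thesis
    proof (rule rat_of_rational_derivative[OF \<Psi>(1) \<Psi>(2) 1(1) 1(2) 1(3)])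
      show "V \<subseteq> U" "W \<subseteq> U" using WU by (auto simp: V_def)
      show "\<Delta> x y \<noteq> 0" if xV: "x \<in> V" and y: "y \<noteq> 0" for x y
      proof -
        obtain y1 y2 where x: "x \<in> U" and y12: "y1 \<noteq> 0" "y2 \<noteq> 0" "D x y1 \<noteq> D x y2"
          using xV by (auto simp: V_def)
        show ?thesis
        proof (rule nz[OF x _ y])
          fix h :: "real ^ 'n" assume 0: "\<And>t y. t \<in> (UNIV :: ('n \<times> 'n) set) \<Longrightarrow> y \<noteq> 0 \<Longrightarrow>
            (\<Sum>l\<in>UNIV. h $ l * dy (fst t) (dy (snd t) (cc l)) x y) = 0"
          show "h = 0"
          proof (rule nonconstant_independent[OF n x y12])
            fix i j y assume "y \<noteq> (0 :: real ^ 'n)"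
            then show "(\<Sum>l\<in>UNIV. h $ l * dy i (dy j (cc l)) x y) = 0" using 0[of "(i, j)" y] by simp
          qed
        qed
      qed
      show "dx l D x y = dx l D x z" if x: "x \<in> W" and y: "y \<noteq> 0" and z: "z \<noteq> 0" for x y z
        unfolding pd_def
      proof (rule deriv_cong_ev)
        have "((\<lambda>t. x + t *\<^sub>R fst (ex l)) \<longlongrightarrow> x + 0 *\<^sub>R fst (ex l)) (at (0::real))"
          by (intro tendsto_intros)
        then have "\<forall>\<^sub>F t in at (0::real). x + t *\<^sub>R fst (ex l) \<in> W"
          by (rule topological_tendstoD) (use x in \<open>simp_all add: W_def\<close>)
        then have "\<forall>\<^sub>F t in nhds (0::real). x + t *\<^sub>R fst (ex l) \<in> W"
          using x by (simp add: eventually_nhds_conv_at)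
        then show "\<forall>\<^sub>F t in nhds 0. D (x + t *\<^sub>R fst (ex l)) (y + t *\<^sub>R snd (ex l)) =
            D (x + t *\<^sub>R fst (ex l)) (z + t *\<^sub>R snd (ex l))"
        proof eventually_elim
          case (elim t)
          then have "x + t *\<^sub>R fst (ex l) \<in> {x \<in> U. \<forall>y z. y \<noteq> 0 \<longrightarrow> z \<noteq> 0 \<longrightarrow> D x y = D x z}"
            unfolding W_def using interior_subset by blast
          then have "D (x + t *\<^sub>R fst (ex l)) y = D (x + t *\<^sub>R fst (ex l)) z" using y z by blast
          then show ?case by simp
        qed
      qed simp
      show "U \<subseteq> closure (V \<union> W)"
      proof
        fix x assume x: "x \<in> U"
        show "x \<in> closure (V \<union> W)"
        proof (cases "x \<in> closure V")
          case True
          then show ?thesis by (simp add: closure_Un)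
        next
          case False
          have "U - closure V \<subseteq> {x \<in> U. \<forall>y z. y \<noteq> 0 \<longrightarrow> z \<noteq> 0 \<longrightarrow> D x y = D x z}"
            using closure_subset[of V] unfolding V_def by blast
          moreover have "open (U - closure V)" using open_dom by (intro open_Diff) auto
          ultimately have "U - closure V \<subseteq> W" unfolding W_def by (rule interior_maximal)
          then have "x \<in> W" using x False by blast
          then show ?thesis using closure_subset[of "V \<union> W"] by blast
        qed
      qed
    qed (use n in simp_all)
  qed (simp_all add: \<Psi> T rat_pd[OF rat_pd[OF cc_rat]])
  then show ?thesis by (simp add: dx_D_rat_iff)
qed

lemma S_rat_iff: "rat (S_curvature F \<sigma>) \<longleftrightarrow> (\<forall>i. rat (dx i L))"
proof
  assume "\<forall>i. rat (dx i L)"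
  then have "rat (\<lambda>x y. \<Sum>l\<in>UNIV. cc l x y * dx l L x y)"
    by (intro rat_sum rat_mult cc_rat) blast
  then show "rat (S_curvature F \<sigma>)" by (simp add: S_rat_iff_contraction)
qed (blast intro: dx_L_rat_if_S_rat)

lemma E_rat_iff:
  assumes "CARD('n) \<ge> 2"
  shows "(\<forall>i j. rat (E_curvature F \<sigma> i j)) \<longleftrightarrow> (\<forall>i. rat (dx i L))"
proof
  assume "\<forall>i j. rat (E_curvature F \<sigma> i j)"
  then show "\<forall>i. rat (dx i L)" using dx_L_rat_if_E_rat[OF assms] by blast
next
  assume "\<forall>i. rat (dx i L)"
  then have S: "rat (S_curvature F \<sigma>)" by (simp add: S_rat_iff)
  have "rat (E_curvature F \<sigma> i j)" for i j
    unfolding E_curvature_def[abs_def] Dy_pd by (intro rat_mult rat_const rat_pd[OF rat_pd[OF S]])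
  then show "\<forall>i j. rat (E_curvature F \<sigma> i j)" by blast
qed

end

subsection \<open>Passing to a chart\<close>

context
  fixes A :: "('m::{t2_space, second_countable_topology}, 'n::finite) chart set"
  assumes atlas: "smooth_atlas A"
begin

lemma chart_homeomorphism:
  assumes "c \<in> A"
  shows "open (fst c)" "open (coord_range c)" "homeomorphism (fst c) (coord_range c) (snd c) (point_of c)"
  using atlas assms unfolding smooth_atlas_def by auto

lemma point_of:
  assumes "c \<in> A" "x \<in> coord_range c"
  shows "point_of c x \<in> fst c" "snd c (point_of c x) = x"
  using chart_homeomorphism(3)[OF assms(1)] assms(2) unfolding homeomorphism_def by auto

lemma point_of_coord: "c \<in> A \<Longrightarrow> p \<in> fst c \<Longrightarrow> point_of c (snd c p) = p"
  using chart_homeomorphism(3)[of c] unfolding homeomorphism_def by auto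

lemma coord_in_range: "c \<in> A \<Longrightarrow> p \<in> fst c \<Longrightarrow> snd c p \<in> coord_range c"
  by (simp add: coord_range_def)

lemma transition_at: "c \<in> A \<Longrightarrow> x \<in> coord_range c \<Longrightarrow> transition c d x = snd d (point_of c x)"
  by (simp add: transition_def)

lemma overlap_open:
  assumes c: "c \<in> A" and d: "d \<in> A"
  shows "open (snd c ` (fst c \<inter> fst d))"
proof -
  have "openin (top_of_set (fst c)) (fst c \<inter> fst d)"
    using chart_homeomorphism(1)[OF d] by (rule openin_open_Int)
  then have "openin (top_of_set (coord_range c)) (snd c ` (fst c \<inter> fst d))"
    by (rule homeomorphism_imp_open_map[OF chart_homeomorphism(3)[OF c]])
  then show ?thesis using chart_homeomorphism(2)[OF c] openin_open_eq by blast
qed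

lemma overlap_mem:
  assumes "c \<in> A" "x \<in> coord_range c" "point_of c x \<in> fst d"
  shows "x \<in> snd c ` (fst c \<inter> fst d)"
  using point_of[OF assms(1,2)] assms(3) by (intro image_eqI[of _ _ "point_of c x"]) auto

lemma transition_has_derivative:
  assumes c: "c \<in> A" and d: "d \<in> A" and x: "x \<in> coord_range c" "point_of c x \<in> fst d"
  shows "(transition c d has_derivative frechet_derivative (transition c d) (at x)) (at x)"
proof -
  have "smooth_on (snd c ` (fst c \<inter> fst d)) (transition c d)"
    using atlas c d unfolding smooth_atlas_def by blast
  from smooth_on_imp_differentiable[OF this overlap_mem[OF c x]] show ?thesis
    by (rule frechet_derivative_worksI)
qed

lemma transition_refl:
  assumes c: "c \<in> A" and x: "x \<in> coord_range c"
  shows "frechet_derivative (transition c c) (at x) = (\<lambda>v. v)"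
proof (rule frechet_derivative_eq, rule has_derivative_transform_within_open)
  show "((\<lambda>x. x) has_derivative (\<lambda>v. v)) (at x)" by (rule has_derivative_ident)
  show "open (coord_range c)" by (rule chart_homeomorphism(2)[OF c])
  show "x' = transition c c x'" if "x' \<in> coord_range c" for x'
    using point_of(2)[OF c that] by (simp add: transition_def)
qed (rule x)

text \<open>The chain rule on the open overlap. This cocycle identity is what makes
  \<open>tangent_point\<close> a tangent vector with compatible columns in all charts.\<close>

lemma transition_chain:
  assumes c: "c \<in> A" and d: "d \<in> A" and e: "e \<in> A" and x: "x \<in> coord_range c"
    and p: "point_of c x \<in> fst d" "point_of c x \<in> fst e"
  shows "frechet_derivative (transition c e) (at x) v =
    frechet_derivative (transition d e) (at (snd d (point_of c x))) (frechet_derivative (transition c d) (at x) v)"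
proof -
  let ?p = "point_of c x"
  have "snd d ?p \<in> coord_range d" "point_of d (snd d ?p) \<in> fst e"
    using coord_in_range[OF d p(1)] point_of_coord[OF d p(1)] p by simp_all
  from transition_has_derivative[OF d e this]
  have "(transition d e has_derivative frechet_derivative (transition d e) (at (snd d ?p))) (at (transition c d x))"
    using transition_at[OF c x, of d] by simp
  from has_derivative_compose[OF transition_has_derivative[OF c d x p(1)] this]
  have "(transition c e has_derivative
      (\<lambda>v. frechet_derivative (transition d e) (at (snd d ?p)) (frechet_derivative (transition c d) (at x) v))) (at x)"
  proof (rule has_derivative_transform_within_open)
    show "open (snd c ` (fst c \<inter> fst d))" by (rule overlap_open[OF c d])
    show "x \<in> snd c ` (fst c \<inter> fst d)" by (rule overlap_mem[OF c x p(1)])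
    fix x' assume "x' \<in> snd c ` (fst c \<inter> fst d)"
    then obtain q where "q \<in> fst c" "q \<in> fst d" "x' = snd c q" by auto
    then show "transition d e (transition c d x') = transition c e x'"
      using point_of_coord[OF c, of q] point_of_coord[OF d, of q] by (simp add: transition_def)
  qed
  then show ?thesis by (simp add: frechet_derivative_eq)
qed

lemma tangent_point_in_bundle:
  assumes c: "c \<in> A" and x: "x \<in> coord_range c"
  shows "tangent_point A c x y \<in> tangent_bundle A"
proof -
  let ?p = "point_of c x"
  let ?v = "\<lambda>d. if d \<in> A \<and> ?p \<in> fst d then frechet_derivative (transition c d) (at x) y else 0"
  have v: "?v e = frechet_derivative (transition d e) (at (snd d ?p)) (?v d)"
    if "d \<in> A" "e \<in> A" "?p \<in> fst d" "?p \<in> fst e" for d e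
    using transition_chain[OF c that(1,2) x that(3,4)] that by simp
  have "?v \<in> tangent_space A ?p"
    unfolding tangent_space_def mem_Collect_eq
  proof (intro conjI allI ballI impI)
    show "?v d = 0" if "\<not> (d \<in> A \<and> ?p \<in> fst d)" for d using that by (rule if_not_P)
  qed (use v in blast)
  then show ?thesis
    using point_of(1)[OF c x] c by (auto simp: tangent_bundle_def tangent_point_def)
qed

text \<open>Linearity of the Jacobians translates the scaling of tangent vectors into the scaling of
  y.\<close>

lemma tangent_point_scale:
  assumes c: "c \<in> A" and x: "x \<in> coord_range c"
  shows "tangent_point A c x (t *\<^sub>R y) =
    (fst (tangent_point A c x y), \<lambda>d. t *\<^sub>R snd (tangent_point A c x y) d)"
proof -
  have "frechet_derivative (transition c d) (at x) (t *\<^sub>R y) = t *\<^sub>R frechet_derivative (transition c d) (at x) y"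
    if "d \<in> A" "point_of c x \<in> fst d" for d
    using has_derivative_linear[OF transition_has_derivative[OF c that(1) x that(2)]] by (rule linear_cmul)
  then show ?thesis by (auto simp: tangent_point_def fun_eq_iff)
qed

text \<open>Its column in the chart c itself is y.\<close>

lemma tangent_point_nonzero:
  assumes c: "c \<in> A" and x: "x \<in> coord_range c" and y: "y \<noteq> 0"
  shows "snd (tangent_point A c x y) \<noteq> (\<lambda>_. 0)"
proof
  assume "snd (tangent_point A c x y) = (\<lambda>_. 0)"
  then have "snd (tangent_point A c x y) c = 0" by simp
  then show False
    using c point_of(1)[OF c x] transition_refl[OF c x] y by (simp add: tangent_point_def)
qed

end

lemma AR_finsler_chart:
  fixes A :: "('m::{t2_space, second_countable_topology}, 'n::finite) chart set"
  assumes AR: "AR_finsler A F \<eta> amat" and vol: "volume_form A \<sigma>" and c: "c \<in> A"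
  shows "AR_chart (coord_range c) (in_coords A c F) (in_coords A c \<eta>) (amat c) (\<sigma> c)"
proof -
  have F: "finsler_metric A F" using AR unfolding AR_finsler_def by blast
  have atlas: "smooth_atlas A" using F unfolding finsler_metric_def by blast
  note F' = F[unfolded finsler_metric_def, THEN conjunct2]
  note F_nonneg = F'[THEN conjunct1]
  note F_smooth = F'[THEN conjunct2, THEN conjunct1]
  note F_hom = F'[THEN conjunct2, THEN conjunct2, THEN conjunct1]
  note F_pos = F'[THEN conjunct2, THEN conjunct2, THEN conjunct2]
  note \<eta>' = AR[unfolded AR_finsler_def, THEN conjunct2]
  note \<eta>_nonneg = \<eta>'[THEN conjunct1]
  note \<eta>_smooth = \<eta>'[THEN conjunct2, THEN conjunct1]
  note a_conds = \<eta>'[THEN conjunct2, THEN conjunct2, THEN conjunct1]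
  note a_rat = \<eta>'[THEN conjunct2, THEN conjunct2, THEN conjunct2]
  show ?thesis
  proof
    show "open (coord_range c)" by (rule chart_homeomorphism(2)[OF atlas c])
    show "smooth_on (coord_range c \<times> - {0}) (\<lambda>(x, y). in_coords A c F x y)"
      using F_smooth c unfolding smooth_on_slit_bundle_def by blast
    show "smooth_on (coord_range c \<times> - {0}) (\<lambda>(x, y). in_coords A c \<eta> x y)"
      using \<eta>_smooth c unfolding smooth_on_slit_bundle_def by blast
    show "rational_in_y (coord_range c) (\<lambda>x y. amat c x y $ i $ j)" for i j
      using a_rat c by blast
    show "smooth_on (coord_range c) (\<sigma> c)" using vol c unfolding volume_form_def by blast
    fix x assume x: "x \<in> coord_range c"
    show "\<sigma> c x > 0" using vol c x unfolding volume_form_def by blast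
    fix y :: "real ^ 'n" assume y: "y \<noteq> 0"
    have tb: "tangent_point A c x y \<in> tangent_bundle A" by (rule tangent_point_in_bundle[OF atlas c x])
    show "in_coords A c F x y \<ge> 0" using F_nonneg tb unfolding in_coords_def by blast
    have "case tangent_point A c x y of (p, v) \<Rightarrow> v \<noteq> (\<lambda>_. 0) \<longrightarrow> \<eta> (p, v) \<ge> 0"
      using bspec[OF \<eta>_nonneg tb] .
    then show "in_coords A c \<eta> x y \<ge> 0"
      using tangent_point_nonzero[OF atlas c x y] unfolding in_coords_def
      by (cases "tangent_point A c x y") simp
    show "sym_posdef (metric_tensor (in_coords A c F) x y)" using F_pos c x y by blast
    show "metric_tensor (in_coords A c F) x y = in_coords A c \<eta> x y *\<^sub>R amat c x y" using a_conds c x y by blast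
    show "sym_posdef (amat c x y)" using a_conds c x y by blast
    fix t :: real assume t: "t > 0"
    have "case tangent_point A c x y of (p, v) \<Rightarrow> \<forall>t>0. F (p, \<lambda>c. t *\<^sub>R v c) = t * F (p, v)"
      using bspec[OF F_hom tb] .
    then show "in_coords A c F x (t *\<^sub>R y) = t * in_coords A c F x y"
      using t unfolding in_coords_def tangent_point_scale[OF atlas c x]
      by (cases "tangent_point A c x y") simp
    show "in_coords A c \<eta> x (t *\<^sub>R y) * amat c x (t *\<^sub>R y) $ i $ j = in_coords A c \<eta> x y * amat c x y $ i $ j" for i j
      using a_conds c x y t by blast
  qed
qed

text \<open>The coefficient of \<open>Dx l (a m k)\<close> is -1, in place of the -1/4 in the
  English formula: for constant \<eta> and a depending on x only, -1 is the value for which the sum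
  becomes the derivative of ln sqrt(det a) along y. The dimension condition for E is essential. For
  n = 1, S is linear on each of the two rays of a fibre, so E vanishes, yet with a = 1 the function
  \<partial> ln \<eta> can be a different constant in y on each ray, and then it is not
  rational.\<close>

theorem proposition3p16:
  fixes A :: "('m::{t2_space, second_countable_topology}, 'n::finite) chart set"
    and F \<eta> :: "'m \<times> ('m, 'n) tangent \<Rightarrow> real"
    and amat :: "('m, 'n) chart \<Rightarrow> real ^ 'n \<Rightarrow> real ^ 'n \<Rightarrow> real ^ 'n ^ 'n"
    and \<sigma> :: "('m, 'n) chart \<Rightarrow> real ^ 'n \<Rightarrow> real"
  assumes "AR_finsler A F \<eta> amat" and "volume_form A \<sigma>" and "c \<in> A"
  shows "let U = coord_range c;
             S = S_curvature (in_coords A c F) (\<sigma> c);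
             E = E_curvature (in_coords A c F) (\<sigma> c);
             log_\<eta> = (\<lambda>x y. ln (in_coords A c \<eta> x y));
             a = (\<lambda>i j x y. amat c x y $ i $ j);
             b = (\<lambda>i j x y. matrix_inv (amat c x y) $ i $ j)
         in
           (\<forall>x\<in>U. \<forall>y. y \<noteq> 0 \<longrightarrow>
              S x y =
                1/2 * (\<Sum>l\<in>UNIV.
                   (real CARD('n) * y $ l
                    - 1/2 * (\<Sum>r\<in>UNIV. \<Sum>s\<in>UNIV. \<Sum>m\<in>UNIV. y $ r * y $ s *
                        (b m l x y * Dy m (a r s) x y + a r s x y * Dy m (b m l) x y)))
                   * Dx l log_\<eta> x y)
              + 1/2 * (\<Sum>m\<in>UNIV. \<Sum>l\<in>UNIV.
                   (y $ m * y $ l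
                    - 1/2 * (\<Sum>r\<in>UNIV. \<Sum>s\<in>UNIV. y $ r * y $ s * a r s x y * b m l x y))
                   * Dy m (Dx l log_\<eta>) x y)
              + 1/2 * (\<Sum>k\<in>UNIV. \<Sum>m\<in>UNIV. \<Sum>l\<in>UNIV. y $ k * b m l x y *
                   (Dx m (a l k) x y + Dx k (a l m) x y - Dx l (a m k) x y))
              + 1/2 * (\<Sum>k\<in>UNIV. \<Sum>s\<in>UNIV. \<Sum>m\<in>UNIV. \<Sum>l\<in>UNIV. y $ k * y $ s *
                   (Dy m (b m l) x y * (Dx k (a l s) x y - 1/2 * Dx l (a k s) x y)
                    + b m l x y * (Dy m (Dx k (a l s)) x y - 1/2 * Dy m (Dx l (a k s)) x y)))
              - (\<Sum>m\<in>UNIV. y $ m * pderiv_at m (\<lambda>x. ln (\<sigma> c x)) x)) \<and>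
           (rational_in_y U S \<longleftrightarrow> (\<forall>i. rational_in_y U (Dx i log_\<eta>))) \<and>
           (CARD('n) \<ge> 2 \<longrightarrow>
              ((\<forall>i j. rational_in_y U (E i j)) \<longleftrightarrow> (\<forall>i. rational_in_y U (Dx i log_\<eta>))))"
proof -
  interpret AR_chart "coord_range c" "in_coords A c F" "in_coords A c \<eta>" "amat c" "\<sigma> c"
    by (rule AR_finsler_chart[OF assms])
  show ?thesis
    unfolding Let_def Dx_pd Dy_pd
    using S_curvature_eq[unfolded cc_def ca_def b_def L_def] S_rat_iff[unfolded L_def] E_rat_iff[unfolded L_def]
    by blast
qed

end
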